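(* Let $\ell,m,n\ge1$ and let $V_n^{(\ell,m)}\subseteq\mathbb{C}[x_1,\dots,x_{n+1}]$ be the span of the polynomials $p(G)$ for $G$ ranging over slim sub-multigraphs of $K^{(\ell,m)}_{n+1}$, with homogeneous degree-$k$ components $V_n^{(\ell,m)}(k)$. Let $S_n$ act by permuting $x_1,\dots,x_n$. Then for every $k\ge0$, \[ V_n^{(\ell,m)}(k)\cong_{S_n}\bigoplus_D M^{\lambda(D)}, \] the sum over all $(\ell,m)$-Dyck paths $D$ of size $n$ with $\mathrm{area}(D)=k$. Moreover, for $k<n$, $V_n^{(\ell,m)}(k)=\mathrm{Sym}^k(V_n^{(\ell,m)}(1))$, i.e. $V_n^{(\ell,m)}(k)$ equals the span of all products of $k$ elements of $V_n^{(\ell,m)}(1)$. In the case $\ell=m$ (when $V_n^{(\ell,\ell)}$ is stable under $S_{n+1}$ permuting all $n+1$ variables), $V_n^{(\ell,\ell)}(1)$ is the reflection representation of $S_{n+1}$, and the top degree nonzero component of $V_n^{(\ell,\ell)}$ is isomorphic as an $S_{n+1}$-module to $\mathrm{Lie}_n\otimes(\mathrm{sign})^{\otimes\ell}$.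
   Context: $K^{(\ell,m)}_{n+1}$ is the multigraph on $[n+1]$ with $m$ parallel edges between $i$ and $j$ for all $1\le i<j\le n$ and $\ell$ parallel edges between $i$ and $n+1$ for all $1\le i\le n$. A sub-multigraph $G$ is slim if the multiset difference $K^{(\ell,m)}_{n+1}-G$ is a connected multigraph on $[n+1]$. $p(G)=\prod_{e\in G}(x_i-x_j)$, the product over the edges $e=\{i<j\}$ of $G$ counted with multiplicity. An $(\ell,m)$-Dyck path of size $n$ is a lattice path with unit steps $(0,1)$ (vertical) and $(1,0)$ (horizontal) from $(-\ell+1,0)$ to $(mn,n)$ staying weakly above the line $y=x/m$. Its vertical run partition $\lambda(D)\vdash n$ lists the lengths of its maximal runs of vertical steps in weakly decreasing order. Its area partition $\mu(D)$ is the partition with $n$ parts whose Ferrers diagram is the set of unit boxes of the rectangle $[-\ell+1,mn]\times[0,n]$ lying to the upper left of $D$ (equivalently, $\mu_i$ is $\ell-1$ plus the $x$-coordinate of the vertical step of $D$ in the $i$-th row from the top), and $\mathrm{area}(D)=|\mu(D)|$. $M^\lambda=\mathrm{Ind}_{S_\lambda}^{S_n}(\mathbf{1})$ for the Young subgroup $S_\lambda=S_{\lambda_1}\times\cdots\times S_{\lambda_k}$. $C_{n+1}=\langle(1,2,\dots,n+1)\rangle\le S_{n+1}$, $\zeta$ sends $(1,2,\dots,n+1)$ to $e^{2\pi i/(n+1)}$, $\mathrm{Lie}_n=\mathrm{Ind}_{C_{n+1}}^{S_{n+1}}(\zeta)$, and $\mathrm{sign}$ is the sign representation of $S_{n+1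}$.
   Formalization: The clause that V(1) is the reflection representation of S_{n+1} is stated except for ℓ=m=n=1, where it fails: the only slim subgraph is empty, so V(1)=0 while the reflection representation of S_2 is one-dimensional. *)

theory Defs
  imports
    Complex_Main
    "HOL-Library.Multiset"
    "HOL-Library.Poly_Mapping"
    "HOL-Library.Function_Algebras"
    "HOL-Combinatorics.Permutations"
    "HOL-Combinatorics.Cycles"
    "HOL-Algebra.Sym_Groups"
begin

section \<open>Complex representations\<close>

text \<open>
  The underlying vector space of a representation is a subset of an abelian group type that is
  a complex vector space under the scaling stored in the record.
\<close>

record ('g, 'v) crep =
  rep_space :: "'v set"
  rep_scale :: "complex \<Rightarrow> 'v \<Rightarrow> 'v"
  rep_act :: "'g \<Rightarrow> 'v \<Rightarrow> 'v"

definition is_rep :: "('g, 'b) monoid_scheme \<Rightarrow> ('g, 'v::ab_group_add) crep \<Rightarrow> bool" where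
  "is_rep G R \<longleftrightarrow>
     vector_space (rep_scale R) \<and>
     module.subspace (rep_scale R) (rep_space R) \<and>
     (\<forall>g\<in>carrier G. \<forall>v\<in>rep_space R. rep_act R g v \<in> rep_space R) \<and>
     (\<forall>g\<in>carrier G. \<forall>v\<in>rep_space R. \<forall>w\<in>rep_space R.
        rep_act R g (v + w) = rep_act R g v + rep_act R g w) \<and>
     (\<forall>g\<in>carrier G. \<forall>c. \<forall>v\<in>rep_space R.
        rep_act R g (rep_scale R c v) = rep_scale R c (rep_act R g v)) \<and>
     (\<forall>v\<in>rep_space R. rep_act R \<one>\<^bsub>G\<^esub> v = v) \<and>
     (\<forall>g\<in>carrier G. \<forall>h\<in>carrier G. \<forall>v\<in>rep_space R.
        rep_act R (g \<otimes>\<^bsub>G\<^esub> h) v = rep_act R g (rep_act R h v))"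

definition rep_iso ::
  "('g, 'b) monoid_scheme \<Rightarrow> ('g, 'v::ab_group_add) crep \<Rightarrow> ('g, 'w::ab_group_add) crep \<Rightarrow> bool"
where
  "rep_iso G R S \<longleftrightarrow>
     is_rep G R \<and> is_rep G S \<and>
     (\<exists>\<phi>. bij_betw \<phi> (rep_space R) (rep_space S) \<and>
        (\<forall>v\<in>rep_space R. \<forall>w\<in>rep_space R. \<phi> (v + w) = \<phi> v + \<phi> w) \<and>
        (\<forall>c. \<forall>v\<in>rep_space R. \<phi> (rep_scale R c v) = rep_scale S c (\<phi> v)) \<and>
        (\<forall>g\<in>carrier G. \<forall>v\<in>rep_space R. \<phi> (rep_act R g v) = rep_act S g (\<phi> v)))"

definition char_rep :: "('g \<Rightarrow> complex) \<Rightarrow> ('g, complex) crep" where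
  "char_rep \<chi> = \<lparr>rep_space = UNIV, rep_scale = (*), rep_act = (\<lambda>g z. \<chi> g * z)\<rparr>"

text \<open>
  The tensor product of a representation with a one-dimensional one, given by its character
  \<open>\<chi>\<close>: the space \<open>R \<otimes> \<complex>\<close> is identified with \<open>R\<close>.
\<close>

definition tensor_char :: "('g, 'v) crep \<Rightarrow> ('g \<Rightarrow> complex) \<Rightarrow> ('g, 'v) crep" where
  "tensor_char R \<chi> =
     \<lparr>rep_space = rep_space R, rep_scale = rep_scale R,
      rep_act = (\<lambda>g v. rep_scale R (\<chi> g) (rep_act R g v))\<rparr>"

text \<open>
  Induction from a subgroup \<open>H\<close> of a finite group \<open>G\<close>, as the space of functions
  \<open>f : G \<rightarrow> W\<close> with \<open>f (h g) = h (f g)\<close>, on which \<open>G\<close> acts by right translation.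
  Functions are extended by \<open>0\<close> outside \<open>G\<close>.
\<close>

definition induced_rep ::
  "('g, 'b) monoid_scheme \<Rightarrow> 'g set \<Rightarrow> ('g, 'v::ab_group_add) crep \<Rightarrow> ('g, 'g \<Rightarrow> 'v) crep"
where
  "induced_rep G H W =
     \<lparr>rep_space = {f. (\<forall>g. g \<notin> carrier G \<longrightarrow> f g = 0) \<and>
                      (\<forall>g\<in>carrier G. f g \<in> rep_space W) \<and>
                      (\<forall>h\<in>H. \<forall>g\<in>carrier G. f (h \<otimes>\<^bsub>G\<^esub> g) = rep_act W h (f g))},
      rep_scale = (\<lambda>c f g. rep_scale W c (f g)),
      rep_act = (\<lambda>x f g. if g \<in> carrier G then f (g \<otimes>\<^bsub>G\<^esub> x) else 0)\<rparr>"

definition direct_sum_rep ::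
  "'d set \<Rightarrow> ('d \<Rightarrow> ('g, 'v::ab_group_add) crep) \<Rightarrow> ('g, 'd \<Rightarrow> 'v) crep"
where
  "direct_sum_rep I R =
     \<lparr>rep_space = {f. (\<forall>d\<in>I. f d \<in> rep_space (R d)) \<and> (\<forall>d. d \<notin> I \<longrightarrow> f d = 0) \<and>
                      finite {d. f d \<noteq> 0}},
      rep_scale = (\<lambda>c f d. rep_scale (R d) c (f d)),
      rep_act = (\<lambda>g f d. if d \<in> I then rep_act (R d) g (f d) else 0)\<rparr>"


section \<open>Representations of symmetric groups\<close>

text \<open>The blocks are \<open>{1..\<lambda>\<^sub>1}\<close>, \<open>{\<lambda>\<^sub>1+1..\<lambda>\<^sub>1+\<lambda>\<^sub>2}\<close>, and so on.\<close>

definition young_subgroup :: "nat list \<Rightarrow> (nat \<Rightarrow> nat) set" where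
  "young_subgroup lam =
     {\<sigma>. \<sigma> permutes {1..sum_list lam} \<and>
         (\<forall>j<length lam. \<sigma> ` {sum_list (take j lam)<..sum_list (take (Suc j) lam)} =
                         {sum_list (take j lam)<..sum_list (take (Suc j) lam)})}"

definition young_module :: "nat \<Rightarrow> nat list \<Rightarrow> (nat \<Rightarrow> nat, (nat \<Rightarrow> nat) \<Rightarrow> complex) crep" where
  "young_module n lam = induced_rep (sym_group n) (young_subgroup lam) (char_rep (\<lambda>_. 1))"

definition long_cycle :: "nat \<Rightarrow> nat \<Rightarrow> nat" where
  "long_cycle n = cycle_of_list [1..<n + 2]"

definition cyclic_subgroup :: "nat \<Rightarrow> (nat \<Rightarrow> nat) set" where
  "cyclic_subgroup n = generate (sym_group (n + 1)) {long_cycle n}"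

definition zeta :: "nat \<Rightarrow> (nat \<Rightarrow> nat) \<Rightarrow> complex" where
  "zeta n g = exp (2 * of_real pi * \<i> / of_nat (n + 1)) ^ (LEAST k. (long_cycle n ^^ k) = g)"

text \<open>\<open>lie_rep n\<close> is a representation of the symmetric group on \<open>n + 1\<close> letters.\<close>

definition lie_rep :: "nat \<Rightarrow> (nat \<Rightarrow> nat, (nat \<Rightarrow> nat) \<Rightarrow> complex) crep" where
  "lie_rep n = induced_rep (sym_group (n + 1)) (cyclic_subgroup n) (char_rep (zeta n))"

definition sign_char :: "(nat \<Rightarrow> nat) \<Rightarrow> complex" where
  "sign_char \<sigma> = of_int (sign \<sigma>)"

definition reflection_rep :: "nat \<Rightarrow> (nat \<Rightarrow> nat, nat \<Rightarrow> complex) crep" where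
  "reflection_rep N =
     \<lparr>rep_space = {v. (\<forall>i. i \<notin> {1..N} \<longrightarrow> v i = 0) \<and> (\<Sum>i\<in>{1..N}. v i) = 0},
      rep_scale = (\<lambda>c v i. c * v i),
      rep_act = (\<lambda>\<sigma> v i. v (inv_into UNIV \<sigma> i))\<rparr>"


section \<open>Polynomials\<close>

text \<open>Exponent vectors are finitely supported; the variable \<open>x\<^sub>i\<close> is \<open>pvar i\<close>.\<close>

type_synonym cpoly = "(nat \<Rightarrow>\<^sub>0 nat) \<Rightarrow>\<^sub>0 complex"

definition pvar :: "nat \<Rightarrow> cpoly" where
  "pvar i = Poly_Mapping.single (Poly_Mapping.single i 1) 1"

definition pscale :: "complex \<Rightarrow> cpoly \<Rightarrow> cpoly" where
  "pscale c p = Poly_Mapping.single 0 c * p"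

interpretation cpoly: vector_space pscale
  by unfold_locales
     (simp_all add: pscale_def algebra_simps single_add mult_single flip: mult.assoc)

definition homogeneous :: "nat \<Rightarrow> cpoly \<Rightarrow> bool" where
  "homogeneous k p \<longleftrightarrow>
     (\<forall>t\<in>Poly_Mapping.keys p. (\<Sum>i\<in>Poly_Mapping.keys t. Poly_Mapping.lookup t i) = k)"

text \<open>The substitution \<open>x\<^sub>i \<mapsto> x\<^bsub>\<sigma> i\<^esub>\<close>.\<close>

definition permute_vars :: "(nat \<Rightarrow> nat) \<Rightarrow> cpoly \<Rightarrow> cpoly" where
  "permute_vars \<sigma> p =
     (\<Sum>t\<in>Poly_Mapping.keys p.
        pscale (Poly_Mapping.lookup p t)
          (\<Prod>i\<in>Poly_Mapping.keys t. pvar (\<sigma> i) ^ Poly_Mapping.lookup t i))"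


section \<open>Slim multigraphs\<close>

text \<open>An edge \<open>{i < j}\<close> is the pair \<open>(i, j)\<close>; a multigraph is its multiset of edges.\<close>

definition complete_multigraph :: "nat \<Rightarrow> nat \<Rightarrow> nat \<Rightarrow> (nat \<times> nat) multiset" where
  "complete_multigraph l m n =
     (\<Sum>i\<in>{1..n}. \<Sum>j\<in>{i<..n}. replicate_mset m (i, j)) +
     (\<Sum>i\<in>{1..n}. replicate_mset l (i, n + 1))"

definition connected_multigraph :: "nat set \<Rightarrow> (nat \<times> nat) multiset \<Rightarrow> bool" where
  "connected_multigraph U E \<longleftrightarrow> (\<forall>u\<in>U. \<forall>v\<in>U. (u, v) \<in> (set_mset E \<union> (set_mset E)\<inverse>)\<^sup>*)"

definition slim :: "nat \<Rightarrow> nat \<Rightarrow> nat \<Rightarrow> (nat \<times> nat) multiset \<Rightarrow> bool" where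
  "slim l m n G \<longleftrightarrow>
     G \<subseteq># complete_multigraph l m n \<and>
     connected_multigraph {1..n + 1} (complete_multigraph l m n - G)"

definition graph_poly :: "(nat \<times> nat) multiset \<Rightarrow> cpoly" where
  "graph_poly G = (\<Prod>(i, j)\<in>#G. pvar i - pvar j)"

definition slim_space :: "nat \<Rightarrow> nat \<Rightarrow> nat \<Rightarrow> cpoly set" where
  "slim_space l m n = cpoly.span {graph_poly G | G. slim l m n G}"

definition slim_component :: "nat \<Rightarrow> nat \<Rightarrow> nat \<Rightarrow> nat \<Rightarrow> cpoly set" where
  "slim_component l m n k = {p \<in> slim_space l m n. homogeneous k p}"

text \<open>
  The action is meaningful for permutations of \<open>{1..n}\<close>, and for those of \<open>{1..n + 1}\<close>
  if \<open>l = m\<close>.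
\<close>

definition slim_rep :: "nat \<Rightarrow> nat \<Rightarrow> nat \<Rightarrow> nat \<Rightarrow> (nat \<Rightarrow> nat, cpoly) crep" where
  "slim_rep l m n k =
     \<lparr>rep_space = slim_component l m n k, rep_scale = pscale, rep_act = permute_vars\<rparr>"


section \<open>Dyck paths\<close>

datatype step = Vert | Horiz

text \<open>The lattice point reached after the first \<open>i\<close> steps of a path starting at \<open>(-l+1, 0)\<close>.\<close>

definition path_point :: "nat \<Rightarrow> step list \<Rightarrow> nat \<Rightarrow> int \<times> int" where
  "path_point l D i =
     (- int l + 1 + int (count_list (take i D) Horiz), int (count_list (take i D) Vert))"

definition dyck_path :: "nat \<Rightarrow> nat \<Rightarrow> nat \<Rightarrow> step list \<Rightarrow> bool" where
  "dyck_path l m n D \<longleftrightarrow>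
     path_point l D (length D) = (int (m * n), int n) \<and>
     (\<forall>i\<le>length D. real_of_int (snd (path_point l D i)) \<ge>
                   real_of_int (fst (path_point l D i)) / real m)"

function vertical_runs :: "step list \<Rightarrow> nat list" where
  "vertical_runs [] = []"
| "vertical_runs (Horiz # D) = vertical_runs D"
| "vertical_runs (Vert # D) =
     Suc (length (takeWhile (\<lambda>s. s = Vert) D)) # vertical_runs (dropWhile (\<lambda>s. s = Vert) D)"
  by pat_completeness auto
termination
  by (relation "measure length") (auto simp: less_Suc_eq_le length_dropWhile_le)

definition vertical_run_partition :: "step list \<Rightarrow> nat list" where
  "vertical_run_partition D = rev (sort (vertical_runs D))"

text \<open>The rows are listed from top to bottom, hence in the reverse order of the path.\<close>

definition area_partition :: "nat \<Rightarrow> step list \<Rightarrow> nat list" where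
  "area_partition l D =
     rev (map (\<lambda>i. nat (int l - 1 + fst (path_point l D i)))
           (filter (\<lambda>i. D ! i = Vert) [0..<length D]))"

definition area :: "nat \<Rightarrow> step list \<Rightarrow> nat" where
  "area l D = sum_list (area_partition l D)"

end

theory Submission
  imports
    Defs
    "HOL-Computational_Algebra.Polynomial_Factorial"
    "HOL-Combinatorics.Multiset_Permutations"
begin

text \<open>
  Setting the last variable to zero identifies the slim space with a space attached to a multigraph
  \<open>E\<close> rooted at the last vertex. Restricted to this space, the map that reads off the coefficients at
  the monomials \<open>x\<^sup>f\<close>, \<open>f\<close> a parking function of \<open>E\<close>, is bijective. Both halves are proved by
  deleting and contracting an edge \<open>e\<close> between the root and a vertex \<open>i\<close>: the parking functions with
  \<open>f i = 0\<close> are those of the contraction and the others are those of the deletion shifted by one, while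
  a polynomial either survives setting \<open>x\<^sub>i = 0\<close> or is \<open>x\<^sub>i\<close> times one of the deletion. For injectivity
  the space is enlarged to all polynomials \<open>p\<close> such that \<open>p (x + t 1\<^sub>I)\<close> has degree in \<open>t\<close> below the
  size of the cut of every vertex set \<open>I\<close>; a posteriori the two spaces agree, so that every
  polynomial in the differences of degree below all cut sizes is in the slim space.

  For the complete multigraph the parking functions are the rearrangements of the row vectors of the
  Dyck paths, and the symmetric group permutes them, which gives the sum of permutation modules.

  In the top degree and for \<open>l = m\<close>, division by the \<open>l\<close>-th power of the Vandermonde product
  turns the generators into \<open>\<Prod> 1 / (x\<^sub>i - x\<^sub>j)\<close> over the edges of spanning trees. These are
  combinations of the products \<open>P\<^sub>w\<close> over paths \<open>w\<close>, and the \<open>P\<^sub>w\<close> sum to zero over the shuffles of two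
  nonempty words. Hence \<open>\<Sum>\<^sub>w q^maj(w\<^sup>-\<^sup>1) P\<^sub>w\<close> is \<open>\<Prod>\<^sub>i (1 - q^i)\<close> times \<open>P\<^sub>1\<^sub>2\<^sub>\<dots>\<close>. For a primitive root of
  unity \<open>q\<close> this shows that the equivariant map from the induced representation is onto, and both
  sides have dimension \<open>n!\<close>.
\<close>

text \<open>The enlargement of the space is forced by division: if a combination of generators is
  \<open>x_i\<close> times \<open>q\<close>, nothing shows directly that \<open>q\<close> is a
  combination of generators for the deleted graph, whereas a bound on the degree in \<open>t\<close>
  passes to \<open>q\<close> at once. The bound comes from connectedness: a factor
  \<open>x_a - x_b\<close> acquires \<open>t\<close> only if its edge crosses the cut of
  \<open>I\<close>, and the complement of a slim graph keeps at least one crossing edge. Reading off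
  coefficients, rather than constructing a basis indexed by parking functions, keeps the isomorphism
  equivariant, since the symmetric group merely permutes the parking monomials. In the top degree
  the weights are dictated by the cyclic group. Left multiplication by the long cycle changes the
  major index by -1 modulo \<open>n + 1\<close>, so \<open>q^maj\<close> lies in the induced space
  when \<open>q\<close> is the inverse of the root of unity that defines it. This \<open>q\<close>
  is primitive of order \<open>n + 1\<close>, hence no factor \<open>1 - q^i\<close> with
  \<open>1 \<le> i \<le> n\<close> vanishes.\<close>

abbreviation "lookup \<equiv> Poly_Mapping.lookup"
abbreviation "keys \<equiv> Poly_Mapping.keys"
abbreviation "single \<equiv> Poly_Mapping.single"
abbreviation "map_key \<equiv> Poly_Mapping.map_key"

hide_const (open) Poly_Mapping.degree


section \<open>Substitution homomorphisms\<close>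

definition monom_eval :: "(nat \<Rightarrow> 'a::comm_ring_1) \<Rightarrow> (nat \<Rightarrow>\<^sub>0 nat) \<Rightarrow> 'a" where
  "monom_eval \<theta> t = (\<Prod>i\<in>keys t. \<theta> i ^ lookup t i)"

text \<open>Coefficients are mapped as well because two targets occur: \<open>cpoly\<close> itself,
  with \<open>h = pconst\<close>, for permuting, killing and translating variables, and
  \<open>cpoly poly\<close> for the shift by a new indeterminate \<open>t\<close>.\<close>

definition psubst :: "(complex \<Rightarrow> 'a::comm_ring_1) \<Rightarrow> (nat \<Rightarrow> 'a) \<Rightarrow> cpoly \<Rightarrow> 'a" where
  "psubst h \<theta> p = (\<Sum>t\<in>keys p. h (lookup p t) * monom_eval \<theta> t)"

abbreviation pconst :: "complex \<Rightarrow> cpoly" where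
  "pconst \<equiv> single 0"

definition ring_hom_fun :: "('a::comm_ring_1 \<Rightarrow> 'b::comm_ring_1) \<Rightarrow> bool" where
  "ring_hom_fun h \<longleftrightarrow> h 1 = 1 \<and> (\<forall>x y. h (x + y) = h x + h y) \<and> (\<forall>x y. h (x * y) = h x * h y)"

lemma ring_hom_funI:
  assumes "h 1 = 1" "\<And>x y. h (x + y) = h x + h y" "\<And>x y. h (x * y) = h x * h y"
  shows "ring_hom_fun h"
  using assms by (auto simp: ring_hom_fun_def)

context
  fixes h :: "'a::comm_ring_1 \<Rightarrow> 'b::comm_ring_1"
  assumes h: "ring_hom_fun h"
begin

lemma rhom_one: "h 1 = 1"
  and rhom_add: "h (x + y) = h x + h y"
  and rhom_mult: "h (x * y) = h x * h y"
  using h by (auto simp: ring_hom_fun_def)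

lemma rhom_zero: "h 0 = 0"
  using rhom_add[of 0 0] by simp

lemma rhom_uminus: "h (- x) = - h x"
  using rhom_add[of x "- x"] rhom_zero by (simp add: eq_neg_iff_add_eq_0 add.commute)

lemma rhom_diff: "h (x - y) = h x - h y"
  using rhom_add[of x "- y"] rhom_uminus by simp

lemma rhom_power: "h (x ^ k) = h x ^ k"
  by (induction k) (auto simp: rhom_one rhom_mult)

lemma rhom_sum: "h (sum f A) = (\<Sum>a\<in>A. h (f a))"
  by (induction A rule: infinite_finite_induct) (auto simp: rhom_zero rhom_add)

lemma rhom_prod: "h (prod f A) = (\<Prod>a\<in>A. h (f a))"
  by (induction A rule: infinite_finite_induct) (auto simp: rhom_one rhom_mult)

end

lemma ring_hom_fun_comp: "ring_hom_fun g \<Longrightarrow> ring_hom_fun h \<Longrightarrow> ring_hom_fun (g \<circ> h)"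
  by (auto simp: ring_hom_fun_def)

lemma ring_hom_fun_pconst: "ring_hom_fun pconst"
  by (intro ring_hom_funI) (auto simp: single_add mult_single)

lemma monom_eval_superset:
  assumes "finite A" "keys t \<subseteq> A"
  shows "monom_eval \<theta> t = (\<Prod>i\<in>A. \<theta> i ^ lookup t i)"
  unfolding monom_eval_def using assms
  by (intro prod.mono_neutral_left) (auto simp: in_keys_iff)

lemma monom_eval_add: "monom_eval \<theta> (s + t) = monom_eval \<theta> s * monom_eval \<theta> t"
proof -
  let ?A = "keys s \<union> keys t"
  have "keys (s + t) \<subseteq> ?A"
    by (rule Poly_Mapping.keys_add)
  then show ?thesis
    by (simp add: monom_eval_superset[where A = ?A] lookup_add power_add prod.distrib)
qed

lemma monom_eval_0 [simp]: "monom_eval \<theta> 0 = 1"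
  by (simp add: monom_eval_def)

lemma monom_eval_single [simp]: "monom_eval \<theta> (single i k) = \<theta> i ^ k"
  by (cases "k = 0") (auto simp: monom_eval_def)

lemma monom_eval_hom: "ring_hom_fun f \<Longrightarrow> f (monom_eval \<theta> t) = monom_eval (\<lambda>i. f (\<theta> i)) t"
  by (simp add: monom_eval_def rhom_prod rhom_power)

lemma monom_eval_cong:
  "(\<And>i. i \<in> keys t \<Longrightarrow> \<theta> i = \<theta>' i) \<Longrightarrow> monom_eval \<theta> t = monom_eval \<theta>' t"
  by (simp add: monom_eval_def)

lemma cpoly_induct [case_names add single]:
  assumes "\<And>p q. P p \<Longrightarrow> P q \<Longrightarrow> P (p + q)" "\<And>t c. P (single t c)"
  shows "P (p :: 'k \<Rightarrow>\<^sub>0 complex)"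
proof (induction p rule: Poly_Mapping.update_induct)
  case const
  then show ?case using assms(2)[of undefined 0] by simp
next
  case (update f a b)
  have "Poly_Mapping.update a b f = f + single a b"
    using update by (intro poly_mapping_eqI)
      (auto simp: lookup_update lookup_add lookup_single in_keys_iff when_def)
  then show ?case using update assms by metis
qed

context
  fixes h :: "complex \<Rightarrow> 'a::comm_ring_1" and \<theta> :: "nat \<Rightarrow> 'a"
  assumes h: "ring_hom_fun h"
begin

lemma psubst_superset:
  assumes "finite A" "keys p \<subseteq> A"
  shows "psubst h \<theta> p = (\<Sum>t\<in>A. h (lookup p t) * monom_eval \<theta> t)"
  unfolding psubst_def using assms
  by (intro sum.mono_neutral_left) (auto simp: in_keys_iff rhom_zero[OF h])

lemma psubst_add: "psubst h \<theta> (p + q) = psubst h \<theta> p + psubst h \<theta> q"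
proof -
  let ?A = "keys p \<union> keys q"
  have "keys (p + q) \<subseteq> ?A"
    by (rule Poly_Mapping.keys_add)
  then show ?thesis
    by (simp add: psubst_superset[where A = ?A] lookup_add rhom_add[OF h] algebra_simps sum.distrib)
qed

lemma psubst_single: "psubst h \<theta> (single t c) = h c * monom_eval \<theta> t"
  by (cases "c = 0") (auto simp: psubst_def rhom_zero[OF h])

lemma psubst_mult: "psubst h \<theta> (p * q) = psubst h \<theta> p * psubst h \<theta> q"
proof (induction p rule: cpoly_induct)
  case (single t c)
  show ?case
    by (induction q rule: cpoly_induct)
      (simp_all add: algebra_simps psubst_add mult_single psubst_single rhom_mult[OF h] monom_eval_add)
qed (simp_all add: algebra_simps psubst_add)

lemma ring_hom_fun_psubst: "ring_hom_fun (psubst h \<theta>)"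
  using psubst_single[of 0 1] rhom_one[OF h]
  by (intro ring_hom_funI) (auto simp: psubst_add psubst_mult)

lemma psubst_pvar: "psubst h \<theta> (pvar i) = \<theta> i"
  by (simp add: pvar_def psubst_single rhom_one[OF h])

lemma psubst_pconst: "psubst h \<theta> (pconst c) = h c"
  by (simp add: psubst_single)

lemma psubst_pscale: "psubst h \<theta> (pscale c p) = h c * psubst h \<theta> p"
  by (simp add: pscale_def psubst_mult psubst_pconst)

lemma hom_psubst: "ring_hom_fun f \<Longrightarrow> f (psubst h \<theta> p) = psubst (\<lambda>c. f (h c)) (\<lambda>i. f (\<theta> i)) p"
  by (simp add: psubst_def rhom_sum rhom_mult monom_eval_hom)

end

definition vars_in :: "nat set \<Rightarrow> cpoly \<Rightarrow> bool" where
  "vars_in A p \<longleftrightarrow> (\<forall>t\<in>keys p. keys t \<subseteq> A)"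

lemma psubst_cong:
  "vars_in A p \<Longrightarrow> (\<And>i. i \<in> A \<Longrightarrow> \<theta> i = \<theta>' i) \<Longrightarrow> psubst h \<theta> p = psubst h \<theta>' p"
  unfolding psubst_def vars_in_def
  by (intro sum.cong refl arg_cong2[of _ _ _ _ "(*)"] monom_eval_cong) auto

lemma sum_single_lookup:
  "(\<Sum>i\<in>keys t. single i (lookup t i)) = t"
  by (rule poly_mapping_eqI) (auto simp: lookup_sum lookup_single when_def in_keys_iff)

lemma monom_eval_pvar: "monom_eval pvar t = single t 1"
proof -
  have pow: "pvar i ^ k = single (single i k) 1" for i k
    by (induction k) (auto simp: pvar_def mult_single simp flip: single_add)
  have "(\<Prod>i\<in>A. single (f i) (1::complex)) = single (\<Sum>i\<in>A. f i) 1"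
    if "finite A" for A :: "nat set" and f :: "nat \<Rightarrow> nat \<Rightarrow>\<^sub>0 nat"
    using that by (induction A) (auto simp: mult_single)
  then show ?thesis
    unfolding monom_eval_def pow by (simp add: sum_single_lookup)
qed

lemma psubst_id: "psubst pconst pvar p = p"
  by (induction p rule: cpoly_induct)
    (simp_all add: psubst_add psubst_single ring_hom_fun_pconst monom_eval_pvar mult_single)

lemma psubst_psubst:
  assumes "ring_hom_fun h"
  shows "psubst h \<theta> (psubst pconst \<theta>' p) = psubst h (\<lambda>i. psubst h \<theta> (\<theta>' i)) p"
  by (simp add: hom_psubst ring_hom_fun_psubst assms ring_hom_fun_pconst psubst_pconst)

abbreviation csubst :: "(nat \<Rightarrow> cpoly) \<Rightarrow> cpoly \<Rightarrow> cpoly" where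
  "csubst \<equiv> psubst pconst"

lemmas csubst_hom = ring_hom_fun_psubst[OF ring_hom_fun_pconst]

lemma csubst_pscale: "csubst \<theta> (pscale c p) = pscale c (csubst \<theta> p)"
  unfolding psubst_pscale[OF ring_hom_fun_pconst] by (simp add: pscale_def)

lemma permute_vars_csubst: "permute_vars \<sigma> = csubst (\<lambda>i. pvar (\<sigma> i))"
  by (simp add: fun_eq_iff permute_vars_def psubst_def pscale_def monom_eval_def)

lemmas permute_vars_hom = csubst_hom[where \<theta> = "\<lambda>i. pvar (\<sigma> i)" for \<sigma>, folded permute_vars_csubst]

lemma permute_vars_pvar: "permute_vars \<sigma> (pvar i) = pvar (\<sigma> i)"
  by (simp add: permute_vars_csubst psubst_pvar ring_hom_fun_pconst)

lemma permute_vars_pscale: "permute_vars \<sigma> (pscale c p) = pscale c (permute_vars \<sigma> p)"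
  by (simp add: permute_vars_csubst csubst_pscale)

lemma permute_vars_id: "permute_vars id p = p"
  by (simp add: permute_vars_csubst psubst_id)

lemma permute_vars_compose: "permute_vars (\<sigma> \<circ> \<tau>) p = permute_vars \<sigma> (permute_vars \<tau> p)"
  by (simp add: permute_vars_csubst psubst_psubst ring_hom_fun_pconst psubst_pvar)

lemma lookup_pscale: "lookup (pscale c p) t = c * lookup p t"
  by (simp add: pscale_def map.rep_eq when_def flip: mult_map_scale_conv_mult)

text \<open>\<open>map_key \<sigma> t\<close> is the exponent vector
  \<open>t \<circ> \<sigma>\<close>: a variable \<open>x_i\<close> of \<open>p\<close> becomes the
  one with index \<open>\<sigma> i\<close>, so its exponent is found in \<open>t\<close> at
  \<open>\<sigma> i\<close>.\<close>

lemma lookup_permute_vars: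
  assumes "bij \<sigma>"
  shows "lookup (permute_vars \<sigma> p) t = lookup p (map_key \<sigma> t)"
proof (induction p rule: cpoly_induct)
  case (add p q)
  then show ?case by (simp add: rhom_add[OF permute_vars_hom] lookup_add)
next
  case (single s c)
  have inj: "inj \<sigma>" "inj (inv' \<sigma>)" using assms by (auto simp: bij_is_inj bij_imp_bij_inv)
  have "monom_eval (\<lambda>i. pvar (\<sigma> i)) s = monom_eval pvar (map_key (inv' \<sigma>) s)"
  proof -
    have "keys (map_key (inv' \<sigma>) s) = \<sigma> ` keys s"
      using inj assms by (simp add: keys_map_key bij_vimage_eq_inv_image bij_imp_bij_inv inv_inv_eq)
    then show ?thesis
      unfolding monom_eval_def using inj
      by (simp add: prod.reindex inj_on_subset[OF inj(1)] map_key.rep_eq)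
  qed
  moreover have "map_key (inv' \<sigma>) s = t \<longleftrightarrow> s = map_key \<sigma> t"
    using inj assms by (auto simp: poly_mapping_eq_iff map_key.rep_eq fun_eq_iff bij_is_surj surj_f_inv_f)
      (metis bij_inv_eq_iff)+
  ultimately show ?case
    by (auto simp: permute_vars_csubst psubst_single ring_hom_fun_pconst monom_eval_pvar mult_single lookup_single when_def)
qed

section \<open>Setting variables to zero\<close>

definition kill_vars :: "nat set \<Rightarrow> cpoly \<Rightarrow> cpoly" where
  "kill_vars R = csubst (\<lambda>i. if i \<in> R then 0 else pvar i)"

lemmas kill_vars_hom = csubst_hom[where \<theta> = "\<lambda>i. if i \<in> R then 0 else pvar i" for R, folded kill_vars_def]

lemma kill_vars_pvar: "kill_vars R (pvar i) = (if i \<in> R then 0 else pvar i)"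
  by (simp add: kill_vars_def psubst_pvar ring_hom_fun_pconst)

lemma kill_vars_pscale: "kill_vars R (pscale c p) = pscale c (kill_vars R p)"
  by (simp add: kill_vars_def csubst_pscale)

lemma kill_vars_kill_vars: "kill_vars R (kill_vars S p) = kill_vars (R \<union> S) p"
  unfolding kill_vars_def psubst_psubst[OF ring_hom_fun_pconst]
  by (rule arg_cong2[of _ _ _ _ "csubst"])
    (auto simp: fun_eq_iff psubst_pvar ring_hom_fun_pconst rhom_zero[OF csubst_hom])

lemma lookup_kill_vars:
  "lookup (kill_vars R p) t = (if keys t \<inter> R = {} then lookup p t else 0)"
proof (induction p rule: cpoly_induct)
  case (add p q)
  then show ?case by (simp add: rhom_add[OF kill_vars_hom] lookup_add)
next
  case (single s c)
  have "monom_eval (\<lambda>i. if i \<in> R then 0 else pvar i) s =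
    (if keys s \<inter> R = {} then monom_eval pvar s else 0)"
  proof (cases "keys s \<inter> R = {}")
    case True
    then show ?thesis by (auto intro!: monom_eval_cong)
  next
    case False
    then obtain i where "i \<in> keys s" "i \<in> R" by auto
    then show ?thesis using False
      by (auto simp: monom_eval_def in_keys_iff intro!: bexI[of _ i])
  qed
  then show ?case
    by (auto simp: kill_vars_def psubst_single ring_hom_fun_pconst monom_eval_pvar mult_single lookup_single when_def)
qed

lemma in_keys_kill_vars:
  "t \<in> keys (kill_vars R p) \<longleftrightarrow> t \<in> keys p \<and> keys t \<inter> R = {}"
  unfolding in_keys_iff[of t] lookup_kill_vars by simp

lemma vars_in_kill_vars: "vars_in A p \<Longrightarrow> vars_in (A - R) (kill_vars R p)"
  unfolding vars_in_def by (auto simp only: in_keys_kill_vars)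

lemma lookup_pvar_mult:
  "lookup (pvar i * p) (t + single i 1) = lookup p t"
  by (induction p rule: cpoly_induct)
    (simp_all add: algebra_simps lookup_add pvar_def mult_single lookup_single when_def)

lemma lookup_pvar_mult_0:
  assumes "lookup t i = 0"
  shows "lookup (pvar i * p) t = 0"
proof (induction p rule: cpoly_induct)
  case (single s c)
  have "single i 1 + s \<noteq> t" using assms by (auto simp: lookup_add)
  then show ?case by (simp add: pvar_def mult_single lookup_single when_def)
qed (simp add: algebra_simps lookup_add)

lemma pvar_dvdI:
  assumes "\<And>t. t \<in> keys p \<Longrightarrow> lookup t i \<noteq> 0"
  obtains q where "p = pvar i * q"
proof -
  define q where "q = (\<Sum>t\<in>keys p. single (t - single i 1) (lookup p t))"
  have "pvar i * q = (\<Sum>t\<in>keys p. single t (lookup p t))"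
    unfolding q_def sum_distrib_left
  proof (rule sum.cong[OF refl])
    fix t assume "t \<in> keys p"
    then have "single i 1 + (t - single i 1) = t"
      using assms by (intro poly_mapping_eqI) (auto simp: lookup_add lookup_minus lookup_single when_def)
    then show "pvar i * single (t - single i 1) (lookup p t) =
      single t (lookup p t)"
      by (simp add: pvar_def mult_single)
  qed
  then show ?thesis using that sum_single_lookup by metis
qed


section \<open>The coefficient map of a rooted multigraph\<close>

lemma ring_hom_fun_map_poly:
  assumes "ring_hom_fun h"
  shows "ring_hom_fun (map_poly h)"
proof (intro ring_hom_funI)
  note [simp] = coeff_map_poly rhom_zero[OF assms] rhom_add[OF assms] rhom_mult[OF assms]
    rhom_one[OF assms] rhom_sum[OF assms]
  show "map_poly h 1 = 1" by (auto intro: poly_eqI simp: map_poly_1)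
  show "map_poly h (p + q) = map_poly h p + map_poly h q" for p q by (auto intro: poly_eqI)
  show "map_poly h (p * q) = map_poly h p * map_poly h q" for p q
    by (auto intro!: poly_eqI simp: coeff_mult)
qed

text \<open>This is \<open>p (x + t 1_I)\<close>, the outer polynomial indeterminate being
  \<open>t\<close>.\<close>

definition shift_vars :: "nat set \<Rightarrow> cpoly \<Rightarrow> cpoly poly" where
  "shift_vars I = psubst (\<lambda>c. [:pconst c:]) (\<lambda>i. [:pvar i, if i \<in> I then 1 else 0:])"

lemma ring_hom_fun_pconst_poly: "ring_hom_fun (\<lambda>c. [:pconst c:])"
  by (intro ring_hom_funI) (auto simp: single_add mult_single mult.commute)

lemmas shift_vars_hom = ring_hom_fun_psubst[OF ring_hom_fun_pconst_poly,
    where \<theta> = "\<lambda>i. [:pvar i, if i \<in> I then 1 else 0:]" for I, folded shift_vars_def]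

lemma pvar_neq_0: "pvar i \<noteq> 0"
  by (metis keys_single keys_zero pvar_def insert_not_empty zero_neq_one)

lemma shift_vars_pvar: "shift_vars I (pvar i) = [:pvar i, if i \<in> I then 1 else 0:]"
  by (simp add: shift_vars_def psubst_pvar ring_hom_fun_pconst_poly)

lemma shift_vars_pscale: "shift_vars I (pscale c p) = smult (pconst c) (shift_vars I p)"
  by (simp add: shift_vars_def psubst_pscale ring_hom_fun_pconst_poly)

lemma poly_shift_vars_0: "poly (shift_vars I p) 0 = p"
proof -
  have "ring_hom_fun (\<lambda>q::cpoly poly. poly q 0)" by (intro ring_hom_funI) auto
  from hom_psubst[OF ring_hom_fun_pconst_poly this] show ?thesis
    by (simp add: shift_vars_def psubst_id)
qed

lemma shift_vars_eq_0_iff: "shift_vars I p = 0 \<longleftrightarrow> p = 0"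
  using poly_shift_vars_0[of I p] rhom_zero[OF shift_vars_hom] by auto

text \<open>No killed variable is shifted, so the two substitutions act on separate variables. This
  hands the degree bounds of \<open>p\<close> on to its restriction to
  \<open>x_i = 0\<close>.\<close>

lemma shift_vars_kill_vars:
  assumes "I \<inter> R = {}"
  shows "shift_vars I (kill_vars R p) = map_poly (kill_vars R) (shift_vars I p)"
proof -
  note hom = ring_hom_fun_map_poly[OF kill_vars_hom[of R]]
  have "map_poly (kill_vars R) (shift_vars I p) =
    psubst (\<lambda>c. map_poly (kill_vars R) [:pconst c:])
      (\<lambda>i. map_poly (kill_vars R) [:pvar i, if i \<in> I then 1 else 0:]) p"
    unfolding shift_vars_def by (rule hom_psubst[OF ring_hom_fun_pconst_poly hom])
  also have "(\<lambda>c. map_poly (kill_vars R) [:pconst c:]) = (\<lambda>c. [:pconst c:])"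
  proof -
    have "kill_vars R (pconst c) = pconst c" for c
      by (simp add: kill_vars_def psubst_pconst ring_hom_fun_pconst)
    then show ?thesis by (simp add: map_poly_pCons rhom_zero[OF kill_vars_hom])
  qed
  also have "(\<lambda>i. map_poly (kill_vars R) [:pvar i, if i \<in> I then 1 else 0:]) =
    (\<lambda>i. shift_vars I (if i \<in> R then 0 else pvar i))"
    using assms by (auto simp: fun_eq_iff map_poly_pCons rhom_zero[OF kill_vars_hom] rhom_one[OF kill_vars_hom]
        kill_vars_pvar shift_vars_pvar rhom_zero[OF shift_vars_hom])
  also have "psubst (\<lambda>c. [:pconst c:]) (\<lambda>i. shift_vars I (if i \<in> R then 0 else pvar i)) p =
    shift_vars I (kill_vars R p)"
    unfolding shift_vars_def kill_vars_def psubst_psubst[OF ring_hom_fun_pconst_poly] ..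
  finally show ?thesis ..
qed

text \<open>
  A multigraph is rooted by a set \<open>A\<close> of vertices: all the vertices outside \<open>A\<close> are
  regarded as identified with the root.
\<close>

definition cut_size :: "(nat \<times> nat) multiset \<Rightarrow> nat set \<Rightarrow> nat" where
  "cut_size E I = size {#e \<in># E. (fst e \<in> I) \<noteq> (snd e \<in> I)#}"

definition out_degree :: "(nat \<times> nat) multiset \<Rightarrow> nat set \<Rightarrow> nat \<Rightarrow> nat" where
  "out_degree E I i = size {#e \<in># E. fst e = i \<and> snd e \<notin> I \<or> snd e = i \<and> fst e \<notin> I#}"

text \<open>The G-parking functions of the rooted graph, or superstable configurations of
  chip-firing with sink outside \<open>A\<close>: no nonempty set of vertices can fire without some
  member going into debt.\<close>

definition parking :: "(nat \<times> nat) multiset \<Rightarrow> nat set \<Rightarrow> (nat \<Rightarrow>\<^sub>0 nat) \<Rightarrow> bool" where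
  "parking E A f \<longleftrightarrow> keys f \<subseteq> A \<and>
     (\<forall>I\<subseteq>A. I \<noteq> {} \<longrightarrow> (\<exists>i\<in>I. lookup f i < out_degree E I i))"

text \<open>Connectedness of the graph in which the complement of \<open>A\<close> is contracted to
  a single root.\<close>

definition linked :: "(nat \<times> nat) multiset \<Rightarrow> nat set \<Rightarrow> bool" where
  "linked E A \<longleftrightarrow> (\<forall>a\<in>A. \<exists>r. r \<notin> A \<and> (a, r) \<in> (set_mset E \<union> (set_mset E)\<inverse>)\<^sup>*)"

definition rooted_gens :: "(nat \<times> nat) multiset \<Rightarrow> nat set \<Rightarrow> cpoly set" where
  "rooted_gens E A = {kill_vars (- A) (graph_poly H) | H. H \<subseteq># E \<and> linked (E - H) A}"

text \<open>Stated through coefficients instead of \<open>degree\<close>: for an empty cut the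
  condition has to force \<open>p = 0\<close>, while \<open>degree 0 = 0\<close> would make a strict
  degree bound fail even for the zero polynomial.\<close>

definition cut_bounded :: "(nat \<times> nat) multiset \<Rightarrow> nat set \<Rightarrow> cpoly \<Rightarrow> bool" where
  "cut_bounded E A p \<longleftrightarrow> vars_in A p \<and>
     (\<forall>I\<subseteq>A. I \<noteq> {} \<longrightarrow> (\<forall>j\<ge>cut_size E I. coeff (shift_vars I p) j = 0))"

lemma graph_poly_empty [simp]: "graph_poly {#} = 1"
  and graph_poly_add_mset: "graph_poly (add_mset e H) = (pvar (fst e) - pvar (snd e)) * graph_poly H"
  by (simp_all add: graph_poly_def case_prod_unfold)

lemma vars_in_kill_compl: "vars_in A (kill_vars (- A) p)"
  unfolding vars_in_def by (auto simp only: in_keys_kill_vars)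

lemma vars_in_add: "vars_in A p \<Longrightarrow> vars_in A q \<Longrightarrow> vars_in A (p + q)"
  using Poly_Mapping.keys_add[of p q] by (auto simp: vars_in_def)

lemma vars_in_pscale: "vars_in A p \<Longrightarrow> vars_in A (pscale c p)"
  by (force simp: vars_in_def in_keys_iff lookup_pscale)

lemma vars_in_0: "vars_in A 0"
  by (simp add: vars_in_def)

lemma subspace_cut_bounded: "cpoly.subspace {p. cut_bounded E A p}"
proof (rule cpoly.subspaceI)
  show "0 \<in> {p. cut_bounded E A p}"
    by (simp add: cut_bounded_def vars_in_0 rhom_zero[OF shift_vars_hom])
  show "p + q \<in> {p. cut_bounded E A p}" if "p \<in> {p. cut_bounded E A p}" "q \<in> {p. cut_bounded E A p}" for p q
    using that by (simp add: cut_bounded_def vars_in_add rhom_add[OF shift_vars_hom])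
  show "pscale c p \<in> {p. cut_bounded E A p}" if "p \<in> {p. cut_bounded E A p}" for c p
    using that by (simp add: cut_bounded_def vars_in_pscale shift_vars_pscale)
qed

text \<open>A walk from a vertex of \<open>I\<close> to a vertex outside \<open>A\<close> has to
  leave \<open>I\<close> somewhere.\<close>

lemma linked_imp_cut_pos:
  assumes "linked F A" "I \<subseteq> A" "I \<noteq> {}"
  shows "cut_size F I > 0"
proof (rule ccontr)
  assume "\<not> cut_size F I > 0"
  then have nc: "(fst e \<in> I) = (snd e \<in> I)" if "e \<in># F" for e
    using that by (auto simp: cut_size_def)
  obtain a where a: "a \<in> I" using assms by auto
  then obtain r where r: "r \<notin> A" "(a, r) \<in> (set_mset F \<union> (set_mset F)\<inverse>)\<^sup>*"
    using assms by (auto simp: linked_def)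
  from r(2) have "r \<in> I"
    by induction (use a nc in force)+
  then show False using r assms by auto
qed

lemma cut_size_union: "cut_size (E + F) I = cut_size E I + cut_size F I"
  by (simp add: cut_size_def)

text \<open>In a factor \<open>x_a - x_b\<close> the two copies of \<open>t\<close> cancel unless
  exactly one end lies in \<open>I\<close>. Killed variables lie outside \<open>A\<close>, hence
  outside \<open>I\<close>, and contribute no \<open>t\<close>.\<close>

lemma degree_shift_graph_poly:
  assumes "I \<subseteq> A"
  shows "degree (shift_vars I (kill_vars (- A) (graph_poly H))) \<le> cut_size H I"
proof (induction H)
  case empty
  then show ?case by (simp add: rhom_one[OF shift_vars_hom] rhom_one[OF kill_vars_hom])
next
  case (add e H)
  let ?\<psi> = "\<lambda>p. shift_vars I (kill_vars (- A) p)"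
  have var: "?\<psi> (pvar i) = [:if i \<in> A then pvar i else 0, if i \<in> I then 1 else 0:]" for i
    using assms by (auto simp: kill_vars_pvar shift_vars_pvar rhom_zero[OF shift_vars_hom])
  have "degree (?\<psi> (pvar (fst e) - pvar (snd e))) \<le> (if (fst e \<in> I) \<noteq> (snd e \<in> I) then 1 else 0)"
    by (simp add: rhom_diff[OF shift_vars_hom] rhom_diff[OF kill_vars_hom] var)
  then show ?case
    using add.IH degree_mult_le[of "?\<psi> (pvar (fst e) - pvar (snd e))" "?\<psi> (graph_poly H)"]
    by (simp add: graph_poly_add_mset rhom_mult[OF shift_vars_hom] rhom_mult[OF kill_vars_hom]
        cut_size_def split: if_splits)
qed

text \<open>The cut of \<open>E\<close> splits into the cuts of \<open>H\<close> and of
  \<open>E - H\<close>; the former bounds the degree in \<open>t\<close> and the latter is positive,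
  which makes the bound strict.\<close>

lemma rooted_gens_cut_bounded: "p \<in> rooted_gens E A \<Longrightarrow> cut_bounded E A p"
proof -
  assume "p \<in> rooted_gens E A"
  then obtain H where H: "p = kill_vars (- A) (graph_poly H)" "H \<subseteq># E" "linked (E - H) A"
    by (auto simp: rooted_gens_def)
  have "coeff (shift_vars I p) j = 0" if "I \<subseteq> A" "I \<noteq> {}" "j \<ge> cut_size E I" for I j
  proof (rule coeff_eq_0)
    have "cut_size E I = cut_size H I + cut_size (E - H) I"
      using H(2) by (simp flip: cut_size_union)
    then show "degree (shift_vars I p) < j"
      using degree_shift_graph_poly[OF that(1), of H] linked_imp_cut_pos[OF H(3) that(1,2)] that(3) H(1)
      by simp
  qed
  then show ?thesis by (simp add: cut_bounded_def H(1) vars_in_kill_compl)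
qed

lemma span_rooted_gens_cut_bounded: "p \<in> cpoly.span (rooted_gens E A) \<Longrightarrow> cut_bounded E A p"
  using cpoly.span_minimal[OF _ subspace_cut_bounded, of "rooted_gens E A"] rooted_gens_cut_bounded by blast

section \<open>Deletion and contraction of an edge at the root\<close>

definition root_edge :: "nat set \<Rightarrow> nat \<Rightarrow> nat \<times> nat \<Rightarrow> bool" where
  "root_edge A i e \<longleftrightarrow> i \<in> A \<and> (\<exists>r. r \<notin> A \<and> (e = (i, r) \<or> e = (r, i)))"

text \<open>Base case of both inductions: without root edges the set \<open>A\<close> itself is a
  cut without edges. For nonempty \<open>A\<close> it rules out parking functions as well as nonzero
  polynomials in the bounded space.\<close>

lemma no_root_edge_cut:
  assumes "\<And>e i. e \<in># E \<Longrightarrow> \<not> root_edge A i e"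
  shows "cut_size E A = 0" and "i \<in> A \<Longrightarrow> out_degree E A i = 0"
proof -
  have "(fst e \<in> A) = (snd e \<in> A)" if "e \<in># E" for e
    using assms[OF that] by (cases e) (auto simp: root_edge_def)
  then show "cut_size E A = 0" "i \<in> A \<Longrightarrow> out_degree E A i = 0"
    by (auto simp: cut_size_def out_degree_def)
qed

context
  fixes A :: "nat set" and i :: nat and e :: "nat \<times> nat"
  assumes e: "root_edge A i e"
begin

lemma out_degree_root_edge:
  "I \<subseteq> A \<Longrightarrow> j \<in> I \<Longrightarrow> out_degree (add_mset e E) I j = out_degree E I j + (if j = i then 1 else 0)"
  using e by (auto simp: root_edge_def out_degree_def)

lemma cut_size_root_edge:
  "I \<subseteq> A \<Longrightarrow> cut_size (add_mset e E) I = cut_size E I + (if i \<in> I then 1 else 0)"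
  using e by (auto simp: root_edge_def cut_size_def)

text \<open>If \<open>f\<close> vanishes at \<open>i\<close>, every set containing \<open>i\<close>
  has \<open>i\<close> as its witness, because \<open>e\<close> leaves that set. Only the sets
  avoiding \<open>i\<close> remain as constraints, and for these \<open>e\<close> is
  invisible.\<close>

lemma parking_contract:
  "parking (add_mset e E) A f \<and> lookup f i = 0 \<longleftrightarrow> parking E (A - {i}) f"
proof
  assume *: "parking (add_mset e E) A f \<and> lookup f i = 0"
  show "parking E (A - {i}) f"
    unfolding parking_def
  proof (intro conjI allI impI)
    show "keys f \<subseteq> A - {i}" using * by (auto simp: parking_def in_keys_iff)
    fix I assume I: "I \<subseteq> A - {i}" "I \<noteq> {}"
    then have "I \<subseteq> A" by auto
    then obtain j where "j \<in> I" "lookup f j < out_degree (add_mset e E) I j"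
      using * I unfolding parking_def by blast
    then show "\<exists>j\<in>I. lookup f j < out_degree E I j"
      using I \<open>I \<subseteq> A\<close> out_degree_root_edge[of I j E] by (intro bexI[of _ j]) (auto split: if_splits)
  qed
next
  assume *: "parking E (A - {i}) f"
  then have f0: "lookup f i = 0"
    using not_in_keys_iff_lookup_eq_zero[of i f] unfolding parking_def by blast
  have "\<exists>j\<in>I. lookup f j < out_degree (add_mset e E) I j" if I: "I \<subseteq> A" "I \<noteq> {}" for I
  proof (cases "i \<in> I")
    case True
    then show ?thesis using I f0 out_degree_root_edge[of I i E] by (intro bexI[of _ i]) auto
  next
    case False
    then have "I \<subseteq> A - {i}" using I by auto
    then obtain j where "j \<in> I" "lookup f j < out_degree E I j"
      using * I unfolding parking_def by blast
    then show ?thesis using I out_degree_root_edge[of I j E] by (intro bexI[of _ j]) auto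
  qed
  then show "parking (add_mset e E) A f \<and> lookup f i = 0"
    using * f0 unfolding parking_def by blast
qed

text \<open>Both sides of the inequality at \<open>i\<close> rise by one: the value of the function
  and the number of edges leaving the set.\<close>

lemma parking_delete: "parking (add_mset e E) A (f + single i 1) \<longleftrightarrow> parking E A f"
proof -
  have "keys (f + single i 1) = insert i (keys f)"
    by (auto simp: in_keys_iff lookup_add lookup_single when_def split: if_splits)
  moreover have "i \<in> A" using e by (simp add: root_edge_def)
  moreover have "lookup (f + single i 1) j < out_degree (add_mset e E) I j \<longleftrightarrow>
    lookup f j < out_degree E I j" if "I \<subseteq> A" "j \<in> I" for I j
    using out_degree_root_edge[OF that, of E] by (auto simp: lookup_add lookup_single when_def)
  ultimately show ?thesis unfolding parking_def by (metis insert_subset)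
qed

lemma kill_vars_root_edge:
  "kill_vars (- A) (pvar (fst e) - pvar (snd e)) = pvar i \<or> kill_vars (- A) (pvar (fst e) - pvar (snd e)) = - pvar i"
  using e by (auto simp: root_edge_def rhom_diff[OF kill_vars_hom] kill_vars_pvar)

text \<open>In the contraction \<open>i\<close> counts as part of the root; a walk ending there is
  prolonged by \<open>e\<close> to the true root.\<close>

lemma linked_contract: "linked E (A - {i}) \<Longrightarrow> linked (add_mset e E) A"
  unfolding linked_def
proof
  fix a assume *: "\<forall>a\<in>A - {i}. \<exists>r. r \<notin> A - {i} \<and> (a, r) \<in> (set_mset E \<union> (set_mset E)\<inverse>)\<^sup>*" and a: "a \<in> A"
  let ?r = "(set_mset (add_mset e E) \<union> (set_mset (add_mset e E))\<inverse>)\<^sup>*"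
  have mono: "(set_mset E \<union> (set_mset E)\<inverse>)\<^sup>* \<subseteq> ?r" by (rule rtrancl_mono) auto
  obtain r0 where r0: "r0 \<notin> A" "(i, r0) \<in> ?r" using e by (auto simp: root_edge_def)
  show "\<exists>r. r \<notin> A \<and> (a, r) \<in> ?r"
  proof (cases "a = i")
    case True
    then show ?thesis using r0 by auto
  next
    case False
    then obtain r where "r \<notin> A - {i}" "(a, r) \<in> ?r" using * a mono by blast
    then show ?thesis using r0 by (cases "r = i") (auto intro: rtrancl_trans)
  qed
qed

end

text \<open>Injectivity of the coefficient map. The contraction shows that \<open>p\<close> vanishes
  at \<open>x_i = 0\<close>, so \<open>p = pvar i * q\<close>; the deletion then shows
  \<open>q = 0\<close>. Both polynomials satisfy the bounds of the smaller graph, with no need to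
  exhibit them as combinations of generators.\<close>

theorem cut_bounded_eq_0I:
  assumes "finite A" "cut_bounded E A p" "\<And>f. parking E A f \<Longrightarrow> lookup p f = 0"
  shows "p = 0"
  using assms
proof (induction "size E" arbitrary: E A p rule: less_induct)
  case less
  show ?case
  proof (cases "\<exists>e i. e \<in># E \<and> root_edge A i e")
    case False
    then have nr: "\<And>e i. e \<in># E \<Longrightarrow> \<not> root_edge A i e" by blast
    show ?thesis
    proof (cases "A = {}")
      case True
      then have "parking E A 0" by (auto simp: parking_def)
      then have "lookup p 0 = 0" using less.prems by blast
      moreover have "keys p \<subseteq> {0}"
        using less.prems True by (auto simp: cut_bounded_def vars_in_def)
      ultimately show ?thesis
        by (intro poly_mapping_eqI) (metis in_keys_iff lookup_zero singletonD subsetD)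
    next
      case False
      \<comment> \<open>The cut of \<open>A\<close> is empty, so every coefficient of the shifted
        polynomial is zero.\<close>
      then have "coeff (shift_vars A p) j = 0" for j
        using less.prems no_root_edge_cut(1)[OF nr] by (auto simp: cut_bounded_def)
      then show ?thesis by (metis shift_vars_eq_0_iff poly_eqI coeff_0)
    qed
  next
    case True
    then obtain e i where ei: "e \<in># E" "root_edge A i e" by auto
    then obtain E' where E: "E = add_mset e E'" by (meson mset_add)
    have iA: "i \<in> A" using ei by (simp add: root_edge_def)
    \<comment> \<open>The contraction only has sets avoiding \<open>i\<close>; their cuts do not
      contain \<open>e\<close>, so the bounds of \<open>p\<close> are inherited unchanged.\<close>
    let ?p0 = "kill_vars {i} p"
    have "cut_bounded E' (A - {i}) ?p0"
      unfolding cut_bounded_def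
    proof (intro conjI allI impI)
      show "vars_in (A - {i}) ?p0" using less.prems by (simp add: cut_bounded_def vars_in_kill_vars)
      fix I j assume I: "I \<subseteq> A - {i}" "I \<noteq> {}" "cut_size E' I \<le> j"
      then have "coeff (shift_vars I p) j = 0"
      proof -
        have "I \<subseteq> A" "i \<notin> I" using I by auto
        then show ?thesis
          using less.prems(2) I cut_size_root_edge[OF ei(2), of I E'] by (simp add: cut_bounded_def E)
      qed
      moreover have "I \<inter> {i} = {}" using I by auto
      ultimately show "coeff (shift_vars I ?p0) j = 0"
        by (simp add: shift_vars_kill_vars coeff_map_poly rhom_zero[OF kill_vars_hom])
    qed
    moreover have "lookup ?p0 f = 0" if "parking E' (A - {i}) f" for f
      using parking_contract[OF ei(2), of E' f] that less.prems(3)[of f] by (simp add: lookup_kill_vars E)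
    ultimately have p0: "?p0 = 0"
      using less.prems(1) less.hyps[of E' "A - {i}" ?p0] by (simp add: E)
    have "lookup t i \<noteq> 0" if "t \<in> keys p" for t
      using that in_keys_kill_vars[of t "{i}" p] by (auto simp: p0 in_keys_iff)
    then obtain q where q: "p = pvar i * q" by (rule pvar_dvdI)
    have "cut_bounded E' A q"
      unfolding cut_bounded_def
    proof (intro conjI allI impI)
      show "vars_in A q"
        unfolding vars_in_def
      proof
        fix t assume "t \<in> keys q"
        then have "t + single i 1 \<in> keys p"
          using lookup_pvar_mult[of i q t] by (simp add: in_keys_iff q)
        then have "keys (t + single i 1) \<subseteq> A"
          using less.prems(2) by (auto simp: cut_bounded_def vars_in_def)
        then show "keys t \<subseteq> A" by (auto simp: in_keys_iff lookup_add)
      qed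
      fix I j assume I: "I \<subseteq> A" "I \<noteq> {}" "cut_size E' I \<le> j"
      show "coeff (shift_vars I q) j = 0"
      proof (cases "q = 0")
        case True
        then show ?thesis by (simp add: rhom_zero[OF shift_vars_hom])
      next
        case False
        let ?x = "shift_vars I (pvar i)" and ?q = "shift_vars I q"
        have x: "?x \<noteq> 0" "degree ?x = (if i \<in> I then 1 else 0)"
          by (simp_all add: shift_vars_pvar pvar_neq_0)
        have sp: "shift_vars I p = ?x * ?q" by (simp add: q rhom_mult[OF shift_vars_hom])
        have q0: "?q \<noteq> 0" using False by (simp add: shift_vars_eq_0_iff)
        \<comment> \<open>The leading coefficient of a nonzero product is nonzero, so the condition
          on coefficients becomes a strict degree bound. The factor \<open>?x\<close> takes up one
          degree exactly if \<open>i \<in> I\<close>, which is when \<open>e\<close> contributes to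
          the cut.\<close>
        have "degree (?x * ?q) < cut_size E I"
        proof (rule ccontr)
          assume "\<not> degree (?x * ?q) < cut_size E I"
          then have "coeff (shift_vars I p) (degree (?x * ?q)) = 0"
            using less.prems(2) I by (auto simp: cut_bounded_def)
          then show False using x(1) q0 sp by auto
        qed
        then show ?thesis
          using x q0 I cut_size_root_edge[OF ei(2), of I E']
          by (intro coeff_eq_0) (auto simp: degree_mult_eq E split: if_splits)
      qed
    qed
    moreover have "lookup q f = 0" if "parking E' A f" for f
      using parking_delete[OF ei(2), of E' f] that less.prems(3)[of "f + single i 1"]
        lookup_pvar_mult[of i q f]
      by (simp add: E q)
    ultimately have "q = 0"
      using less.prems(1) less.hyps[of E' A q] by (simp add: E)
    then show ?thesis by (simp add: q)
  qed
qed

text \<open>Adding \<open>e\<close> both to the graph and to the chosen subgraph leaves the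
  complement unchanged, and multiplies the generator by \<open>pvar i\<close> up to sign.\<close>

lemma rooted_gens_mult_root_edge:
  assumes e: "root_edge A i e" and p: "p \<in> cpoly.span (rooted_gens E A)"
  shows "pvar i * p \<in> cpoly.span (rooted_gens (add_mset e E) A)"
  using p
proof (induction rule: cpoly.span_induct_alt)
  case base
  then show ?case by (simp add: cpoly.span_zero)
next
  case (step c x y)
  obtain H where H: "x = kill_vars (- A) (graph_poly H)" "H \<subseteq># E" "linked (E - H) A"
    using step by (auto simp: rooted_gens_def)
  have "kill_vars (- A) (graph_poly (add_mset e H)) \<in> rooted_gens (add_mset e E) A"
    using H unfolding rooted_gens_def by (intro CollectI exI[of _ "add_mset e H"]) auto
  then have *: "kill_vars (- A) (pvar (fst e) - pvar (snd e)) * x \<in> cpoly.span (rooted_gens (add_mset e E) A)"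
    by (simp add: graph_poly_add_mset rhom_mult[OF kill_vars_hom] H cpoly.span_base)
  have "pvar i * x \<in> cpoly.span (rooted_gens (add_mset e E) A)"
    using kill_vars_root_edge[OF e]
  proof
    assume "kill_vars (- A) (pvar (fst e) - pvar (snd e)) = - pvar i"
    then show ?thesis using cpoly.span_neg[OF *] by simp
  qed (use * in simp)
  moreover have "pvar i * (pscale c x + y) = pscale c (pvar i * x) + pvar i * y"
    by (simp add: pscale_def algebra_simps)
  ultimately show ?case
    using step by (simp add: cpoly.span_add cpoly.span_scale)
qed

text \<open>The same subgraph \<open>H\<close> serves for both graphs: \<open>e\<close> stays in the
  complement, where it joins \<open>i\<close> to the root, and killing \<open>x_i\<close> turns one
  generator into the other.\<close>

lemma rooted_gens_lift:
  assumes e: "root_edge A i e" and p: "p \<in> cpoly.span (rooted_gens E (A - {i}))"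
  obtains q where "q \<in> cpoly.span (rooted_gens (add_mset e E) A)" "kill_vars {i} q = p"
proof -
  have "\<exists>q. q \<in> cpoly.span (rooted_gens (add_mset e E) A) \<and> kill_vars {i} q = p"
    using p
  proof (induction rule: cpoly.span_induct_alt)
    case base
    then show ?case by (intro exI[of _ 0]) (simp add: cpoly.span_zero rhom_zero[OF kill_vars_hom])
  next
    case (step c x y)
    obtain H where H: "x = kill_vars (- (A - {i})) (graph_poly H)" "H \<subseteq># E" "linked (E - H) (A - {i})"
      using step by (auto simp: rooted_gens_def)
    obtain q where q: "q \<in> cpoly.span (rooted_gens (add_mset e E) A)" "kill_vars {i} q = y"
      using step by auto
    have HE: "H \<subseteq># add_mset e E" using H(2) by (metis add_mset_add_single subset_mset.le_add_same_cancel1 subset_mset.order_trans subset_mset.zero_le)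
    have "linked (add_mset e (E - H)) A" by (rule linked_contract[OF e H(3)])
    moreover have "add_mset e (E - H) = add_mset e E - H"
      using subset_mset.add_diff_assoc2[OF H(2), of "{#e#}"] by simp
    ultimately have "kill_vars (- A) (graph_poly H) \<in> rooted_gens (add_mset e E) A"
      using HE by (auto simp: rooted_gens_def)
    moreover have "kill_vars {i} (kill_vars (- A) (graph_poly H)) = x"
    proof -
      have "{i} \<union> - A = - (A - {i})" by auto
      then show ?thesis by (simp add: kill_vars_kill_vars H(1))
    qed
    ultimately show ?case
      using q by (intro exI[of _ "pscale c (kill_vars (- A) (graph_poly H)) + q"])
        (simp add: rhom_add[OF kill_vars_hom] kill_vars_pscale cpoly.span_add cpoly.span_scale cpoly.span_base)
  qed
  then show ?thesis using that by blast
qed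

text \<open>Surjectivity of the coefficient map, already on the span of the generators. A lift of
  the solution for the contraction is right at all \<open>f\<close> with value 0 at
  \<open>i\<close>; a multiple of \<open>x_i\<close> corrects the remaining coefficients without
  touching those.\<close>

theorem rooted_gens_prescribed_coeffs:
  assumes "finite A"
  shows "\<exists>p\<in>cpoly.span (rooted_gens E A). \<forall>f. parking E A f \<longrightarrow> lookup p f = F f"
  using assms
proof (induction "size E" arbitrary: E A F rule: less_induct)
  case less
  show ?case
  proof (cases "\<exists>e i. e \<in># E \<and> root_edge A i e")
    case False
    then have nr: "\<And>e i. e \<in># E \<Longrightarrow> \<not> root_edge A i e" by blast
    show ?thesis
    proof (cases "A = {}")
      case True
      then have "kill_vars (- A) (graph_poly {#}) \<in> rooted_gens E A"
        unfolding rooted_gens_def by (intro CollectI exI[of _ "{#}"]) (auto simp: linked_def)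
      then have "1 \<in> rooted_gens E A" by (simp add: rhom_one[OF kill_vars_hom])
      then have "pscale (F 0) 1 \<in> cpoly.span (rooted_gens E A)" by (intro cpoly.span_scale cpoly.span_base)
      moreover have "lookup (pscale (F 0) 1) f = F f" if "parking E A f" for f
      proof -
        have "f = 0" using that True by (simp add: parking_def)
        then show ?thesis by (simp add: lookup_pscale)
      qed
      ultimately show ?thesis by blast
    next
      case False
      then have "\<not> parking E A f" for f
        using no_root_edge_cut(2)[OF nr] by (auto simp: parking_def intro!: exI[of _ A])
      then show ?thesis using cpoly.span_zero by blast
    qed
  next
    case True
    then obtain e i where ei: "e \<in># E" "root_edge A i e" by auto
    then obtain E' where E: "E = add_mset e E'" by (meson mset_add)
    obtain p0 where p0: "p0 \<in> cpoly.span (rooted_gens E' (A - {i}))"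
      "\<And>f. parking E' (A - {i}) f \<Longrightarrow> lookup p0 f = F f"
      using less.hyps[of E' "A - {i}" F] less.prems by (auto simp: E)
    obtain p1 where p1: "p1 \<in> cpoly.span (rooted_gens E A)" "kill_vars {i} p1 = p0"
      using rooted_gens_lift[OF ei(2) p0(1)] unfolding E by metis
    \<comment> \<open>The prescribed values are the errors of \<open>p1\<close>, moved down by one
      at \<open>i\<close>.\<close>
    obtain p2 where p2: "p2 \<in> cpoly.span (rooted_gens E' A)"
      "\<And>f. parking E' A f \<Longrightarrow> lookup p2 f =
         F (f + single i 1) - lookup p1 (f + single i 1)"
      using less.hyps[of E' A "\<lambda>f. F (f + single i 1) - lookup p1 (f + single i 1)"]
        less.prems by (auto simp: E)
    have "lookup (p1 + pvar i * p2) f = F f" if f: "parking E A f" for f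
    proof (cases "lookup f i = 0")
      case True
      then have "lookup p0 f = F f"
        using f p0(2) parking_contract[OF ei(2), of E' f] by (simp add: E)
      moreover have "lookup p0 f = lookup p1 f"
        using True by (simp add: lookup_kill_vars in_keys_iff flip: p1(2))
      ultimately show ?thesis by (simp add: lookup_add lookup_pvar_mult_0[OF True])
    next
      case False
      define g where "g = f - single i 1"
      have g: "f = g + single i 1"
        using False by (intro poly_mapping_eqI) (auto simp: g_def lookup_add lookup_minus lookup_single when_def)
      then have "parking E' A g" using f parking_delete[OF ei(2), of E' g] by (simp add: E)
      then show ?thesis using p2(2)[of g] lookup_pvar_mult[of i p2 g] by (simp add: g lookup_add)
    qed
    moreover have "p1 + pvar i * p2 \<in> cpoly.span (rooted_gens E A)"
      using p1(1) rooted_gens_mult_root_edge[OF ei(2) p2(1)] by (auto simp: E intro: cpoly.span_add)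
    ultimately show ?thesis by blast
  qed
qed

text \<open>No dimension is computed: a member of the large space has the same parking coefficients
  as some combination of generators, and injectivity holds on the large space, which contains
  both.\<close>

theorem span_rooted_gens_eq:
  assumes "finite A"
  shows "cpoly.span (rooted_gens E A) = {p. cut_bounded E A p}"
proof (intro subset_antisym subsetI)
  fix p assume "p \<in> {p. cut_bounded E A p}"
  then have p: "cut_bounded E A p" by simp
  obtain q where q: "q \<in> cpoly.span (rooted_gens E A)"
    "\<And>f. parking E A f \<Longrightarrow> lookup q f = lookup p f"
    using rooted_gens_prescribed_coeffs[OF assms, of E "lookup p"] by auto
  have "cut_bounded E A (p - q)"
    using cpoly.subspace_diff[OF subspace_cut_bounded] p span_rooted_gens_cut_bounded[OF q(1)] by simp
  then have "p - q = 0"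
    using q by (intro cut_bounded_eq_0I[OF assms]) (auto simp: lookup_minus)
  then show "p \<in> cpoly.span (rooted_gens E A)" using q by simp
qed (use span_rooted_gens_cut_bounded in blast)

declare One_nat_def [simp del]


section \<open>Homogeneous components\<close>

definition monom_degree :: "(nat \<Rightarrow>\<^sub>0 nat) \<Rightarrow> nat" where
  "monom_degree t = (\<Sum>i\<in>keys t. lookup t i)"

lemma monom_degree_superset:
  "finite A \<Longrightarrow> keys t \<subseteq> A \<Longrightarrow> monom_degree t = (\<Sum>i\<in>A. lookup t i)"
  unfolding monom_degree_def by (intro sum.mono_neutral_left) (auto simp: in_keys_iff)

lemma monom_degree_add: "monom_degree (s + t) = monom_degree s + monom_degree t"
proof -
  let ?A = "keys s \<union> keys t"
  have "keys (s + t) \<subseteq> ?A"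
    by (rule Poly_Mapping.keys_add)
  then show ?thesis
    by (simp add: monom_degree_superset[where A = ?A] lookup_add sum.distrib)
qed

lemma homogeneous_iff: "homogeneous k p \<longleftrightarrow> (\<forall>t. lookup p t \<noteq> 0 \<longrightarrow> monom_degree t = k)"
  unfolding homogeneous_def monom_degree_def[symmetric] by (auto simp: in_keys_iff)

lemma homogeneous_0 [simp]: "homogeneous k 0"
  by (simp add: homogeneous_iff)

lemma homogeneous_1: "homogeneous 0 1"
  by (auto simp: homogeneous_def)

lemma homogeneous_add: "homogeneous k p \<Longrightarrow> homogeneous k q \<Longrightarrow> homogeneous k (p + q)"
  unfolding homogeneous_iff lookup_add by (metis add.right_neutral)

lemma homogeneous_pscale: "homogeneous k p \<Longrightarrow> homogeneous k (pscale c p)"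
  by (auto simp: homogeneous_iff lookup_pscale)

lemma homogeneous_diff: "homogeneous k p \<Longrightarrow> homogeneous k q \<Longrightarrow> homogeneous k (p - q)"
  unfolding homogeneous_iff lookup_minus by (metis diff_zero)

lemma homogeneous_sum: "(\<And>a. a \<in> A \<Longrightarrow> homogeneous k (f a)) \<Longrightarrow> homogeneous k (sum f A)"
  by (induction A rule: infinite_finite_induct) (auto intro: homogeneous_add)

lemma homogeneous_mult: "homogeneous j p \<Longrightarrow> homogeneous k q \<Longrightarrow> homogeneous (j + k) (p * q)"
  unfolding homogeneous_def monom_degree_def[symmetric]
  using Poly_Mapping.keys_mult[of p q] by (fastforce simp: monom_degree_add)

lemma homogeneous_pvar: "homogeneous 1 (pvar i)"
  by (simp add: homogeneous_def pvar_def)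

lemma homogeneous_power: "homogeneous j p \<Longrightarrow> homogeneous (j * k) (p ^ k)"
  by (induction k) (auto simp: homogeneous_1 intro: homogeneous_mult)

lemma homogeneous_prod:
  "(\<And>a. a \<in> A \<Longrightarrow> homogeneous (d a) (f a)) \<Longrightarrow> homogeneous (sum d A) (prod f A)"
  by (induction A rule: infinite_finite_induct) (auto intro: homogeneous_mult homogeneous_1)

lemma homogeneous_prod_list:
  "(\<And>p. p \<in> set ps \<Longrightarrow> homogeneous 1 p) \<Longrightarrow> homogeneous (length ps) (prod_list ps)"
proof (induction ps)
  case (Cons p ps)
  then show ?case using homogeneous_mult[of 1 p "length ps" "prod_list ps"] by (simp add: plus_1_eq_Suc)
qed (simp add: homogeneous_1)

lemma homogeneous_monom_eval:
  "(\<And>i. homogeneous 1 (\<theta> i)) \<Longrightarrow> homogeneous (monom_degree t) (monom_eval \<theta> t)"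
  unfolding monom_eval_def monom_degree_def
  by (intro homogeneous_prod) (use homogeneous_power[of 1] in auto)

lemma homogeneous_csubst:
  assumes "\<And>i. homogeneous 1 (\<theta> i)" "homogeneous k p"
  shows "homogeneous k (csubst \<theta> p)"
  unfolding psubst_def pscale_def[symmetric]
proof (intro homogeneous_sum homogeneous_pscale)
  fix t assume "t \<in> keys p"
  then have "monom_degree t = k" using assms(2) by (simp add: homogeneous_def monom_degree_def)
  then show "homogeneous k (monom_eval \<theta> t)" using homogeneous_monom_eval assms(1) by metis
qed

lemma homogeneous_permute_vars: "homogeneous k p \<Longrightarrow> homogeneous k (permute_vars \<sigma> p)"
  unfolding permute_vars_csubst by (intro homogeneous_csubst homogeneous_pvar)

lemma homogeneous_kill_vars: "homogeneous k p \<Longrightarrow> homogeneous k (kill_vars R p)"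
  unfolding kill_vars_def using homogeneous_pvar by (intro homogeneous_csubst) auto

lemma homogeneous_graph_poly: "homogeneous (size G) (graph_poly G)"
proof (induction G)
  case (add e G)
  then show ?case
    using homogeneous_mult[OF homogeneous_diff[OF homogeneous_pvar homogeneous_pvar] add]
    by (simp add: graph_poly_add_mset plus_1_eq_Suc)
qed (simp add: homogeneous_1)

definition hom_part :: "nat \<Rightarrow> cpoly \<Rightarrow> cpoly" where
  "hom_part k p = (\<Sum>t\<in>{t \<in> keys p. monom_degree t = k}. single t (lookup p t))"

lemma lookup_hom_part:
  "lookup (hom_part k p) t = (if monom_degree t = k then lookup p t else 0)"
  by (auto simp: hom_part_def lookup_sum lookup_single when_def in_keys_iff)

lemma homogeneous_hom_part: "homogeneous k (hom_part k p)"
  by (simp add: homogeneous_iff lookup_hom_part)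

lemma hom_part_add: "hom_part k (p + q) = hom_part k p + hom_part k q"
  by (rule poly_mapping_eqI) (simp add: lookup_hom_part lookup_add)

lemma hom_part_pscale: "hom_part k (pscale c p) = pscale c (hom_part k p)"
  by (rule poly_mapping_eqI) (simp add: lookup_hom_part lookup_pscale)

lemma hom_part_homogeneous: "homogeneous j p \<Longrightarrow> hom_part k p = (if j = k then p else 0)"
  by (rule poly_mapping_eqI) (auto simp: lookup_hom_part homogeneous_iff)


section \<open>The slim space\<close>

lemma size_filter_sum_replicate:
  "finite A \<Longrightarrow> size (filter_mset P (\<Sum>x\<in>A. replicate_mset m (g x))) = m * card {x \<in> A. P (g x)}"
proof (induction A rule: finite_induct)
  case (insert x A)
  have "filter_mset P (replicate_mset m (g x)) = (if P (g x) then replicate_mset m (g x) else {#})"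
    by (induction m) auto
  moreover have "{y \<in> insert x A. P (g y)} = (if P (g x) then insert x else id) {y \<in> A. P (g y)}"
    by auto
  ultimately show ?case using insert by simp
qed simp

lemma complete_multigraph_pairs:
  "complete_multigraph l m n =
     (\<Sum>e\<in>(SIGMA i:{1..n}. {i<..n}). replicate_mset m e) + (\<Sum>i\<in>{1..n}. replicate_mset l (i, n + 1))"
  by (simp add: complete_multigraph_def sum.Sigma)

lemma mem_complete_multigraph:
  assumes "e \<in># complete_multigraph l m n"
  shows "1 \<le> fst e" "fst e < snd e" "snd e \<le> n + 1"
  using assms by (auto simp: complete_multigraph_def set_mset_sum)

text \<open>There are \<open>l\<close> edges to the root and \<open>m\<close> to each vertex outside
  \<open>I\<close>. Only the size of \<open>I\<close> enters, so being a parking function depends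
  only on the sorted values.\<close>

lemma out_degree_complete_multigraph:
  assumes I: "I \<subseteq> {1..n}" and i: "i \<in> I"
  shows "out_degree (complete_multigraph l m n) I i = l + m * (n - card I)"
proof -
  define P where "P = (\<lambda>e. fst e = i \<and> snd e \<notin> I \<or> snd e = i \<and> fst e \<notin> I)"
  have "{e \<in> (SIGMA i:{1..n}. {i<..n}). P e} = (\<lambda>j. (min i j, max i j)) ` ({1..n} - I)" (is "?L = ?R")
  proof (rule subset_antisym; rule subsetI)
    fix e assume e: "e \<in> ?L"
    obtain a b where ab: "e = (a, b)" by (cases e)
    show "e \<in> ?R"
    proof (cases "a = i")
      case True
      then show ?thesis using e ab I i by (intro image_eqI[of _ _ b]) (auto simp: P_def)
    next
      case False
      then show ?thesis using e ab I i by (intro image_eqI[of _ _ a]) (auto simp: P_def)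
    qed
  next
    fix e assume "e \<in> ?R"
    then obtain j where j: "e = (min i j, max i j)" "j \<in> {1..n}" "j \<notin> I" by auto
    then have "i \<noteq> j" "i \<in> {1..n}" using i I by auto
    then consider "i < j" | "j < i" by linarith
    then show "e \<in> ?L"
      using j i \<open>i \<in> {1..n}\<close> by cases (auto simp: P_def)
  qed
  moreover have "inj_on (\<lambda>j. (min i j, max i j)) ({1..n} - I)"
    by (auto simp: inj_on_def min_def max_def split: if_splits)
  ultimately have 1: "card {e \<in> (SIGMA i:{1..n}. {i<..n}). P e} = n - card I"
    using I by (simp add: card_image card_Diff_subset finite_subset[OF I])
  have "{j \<in> {1..n}. P (j, n + 1)} = {i}"
    using i I by (auto simp: P_def)
  then have 2: "card {j \<in> {1..n}. P (j, n + 1)} = 1" by simp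
  show ?thesis
    unfolding out_degree_def P_def[symmetric] complete_multigraph_pairs filter_union_mset size_union
    using 1 2 size_filter_sum_replicate[of "SIGMA i:{1..n}. {i<..n}" P m "\<lambda>e. e"]
      size_filter_sum_replicate[of "{1..n}" P l "\<lambda>i. (i, n + 1)"] by simp
qed

text \<open>An edge of the cut has exactly one end in \<open>I\<close> and is counted there.\<close>

lemma cut_size_eq_sum_out_degree: "finite I \<Longrightarrow> cut_size E I = (\<Sum>i\<in>I. out_degree E I i)"
proof (induction E)
  case empty
  then show ?case by (simp add: cut_size_def out_degree_def)
next
  case (add e E)
  obtain a b where e: "e = (a, b)" by (cases e)
  have "out_degree (add_mset e E) I i = out_degree E I i + (if a = i then (if b \<in> I then 0 else 1) else 0)
      + (if b = i then (if a \<in> I then 0 else 1) else 0)" if "i \<in> I" for i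
    using that by (auto simp: out_degree_def e)
  then have "(\<Sum>i\<in>I. out_degree (add_mset e E) I i) =
    (\<Sum>i\<in>I. out_degree E I i) + (\<Sum>i\<in>I. if a = i then (if b \<in> I then 0 else 1) else 0)
     + (\<Sum>i\<in>I. if b = i then (if a \<in> I then 0 else 1) else 0)"
    by (simp add: sum.distrib)
  then show ?case
    using add by (auto simp: cut_size_def e)
qed

lemma cut_size_complete_multigraph:
  assumes I: "I \<subseteq> {1..n}"
  shows "cut_size (complete_multigraph l m n) I = card I * (l + m * (n - card I))"
  using I by (simp add: cut_size_eq_sum_out_degree finite_subset[OF I] out_degree_complete_multigraph)

text \<open>With \<open>c\<close> vertices in \<open>I\<close> the cut has at least
  \<open>c * (1 + n - c)\<close> edges, and this is at least \<open>n\<close>. It is the origin of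
  the range \<open>k < n\<close> in the statement on products.\<close>

lemma cut_size_complete_multigraph_ge:
  assumes I: "I \<subseteq> {1..n}" "I \<noteq> {}" and lm: "l \<ge> 1" "m \<ge> 1"
  shows "cut_size (complete_multigraph l m n) I \<ge> n"
proof -
  have c: "1 \<le> card I" "card I \<le> n"
    using I card_mono[of "{1..n}" I] card_gt_0_iff[of I] finite_subset[OF I(1)] by auto
  then obtain a b where ab: "card I = Suc a" "n = Suc a + b"
    by (metis Suc_le_D le_Suc_ex One_nat_def)
  have "n \<le> Suc a * (1 + 1 * b)" by (simp add: ab)
  also have "\<dots> \<le> Suc a * (l + m * b)" using lm by (intro mult_le_mono add_le_mono) auto
  finally show ?thesis using ab(1) cut_size_complete_multigraph[OF I(1), of l m] by (simp add: ab(2))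
qed

text \<open>No edge leaves \<open>{1..n + 1}\<close>, so the only vertex outside
  \<open>{1..n}\<close> that can be reached is the root \<open>n + 1\<close>.\<close>

lemma slim_iff_linked:
  "slim l m n G \<longleftrightarrow> G \<subseteq># complete_multigraph l m n \<and> linked (complete_multigraph l m n - G) {1..n}"
proof -
  let ?E = "complete_multigraph l m n - G"
  let ?r = "set_mset ?E \<union> (set_mset ?E)\<inverse>"
  have sub: "1 \<le> u \<and> u \<le> n + 1 \<and> 1 \<le> v \<and> v \<le> n + 1" if uv: "(u, v) \<in> ?r" for u v
  proof -
    obtain e where "e \<in># complete_multigraph l m n" "e = (u, v) \<or> e = (v, u)"
      using uv by (metis Un_iff converse_iff in_diffD)
    then show ?thesis using mem_complete_multigraph[of e l m n] by auto
  qed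
  have stay: "1 \<le> v \<and> v \<le> n + 1" if "(u, v) \<in> ?r\<^sup>*" "1 \<le> u" "u \<le> n + 1" for u v
    using that by (induction rule: rtrancl_induct) (use sub in blast)+
  have "sym (?r\<^sup>*)" by (intro sym_rtrancl) (auto simp: sym_def)
  then have sym: "(u, v) \<in> ?r\<^sup>*" if "(v, u) \<in> ?r\<^sup>*" for u v
    using that by (auto simp: sym_def)
  have "connected_multigraph {1..n + 1} ?E \<longleftrightarrow> linked ?E {1..n}"
  proof
    assume c: "connected_multigraph {1..n + 1} ?E"
    have "n + 1 \<notin> {1..n} \<and> (a, n + 1) \<in> ?r\<^sup>*" if "a \<in> {1..n}" for a
      using c that by (auto simp: connected_multigraph_def)
    then show "linked ?E {1..n}" unfolding linked_def by blast
  next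
    assume lk: "linked ?E {1..n}"
    have root: "(u, n + 1) \<in> ?r\<^sup>*" if u: "u \<in> {1..n + 1}" for u
    proof (cases "u = n + 1")
      case False
      then have "u \<in> {1..n}" using u by auto
      then obtain r where r: "r \<notin> {1..n}" "(u, r) \<in> ?r\<^sup>*" using lk unfolding linked_def by blast
      then have "r = n + 1" using stay[OF r(2)] u by auto
      then show ?thesis using r by simp
    qed simp
    show "connected_multigraph {1..n + 1} ?E"
      unfolding connected_multigraph_def using root sym rtrancl_trans by meson
  qed
  then show ?thesis by (simp add: slim_def)
qed

text \<open>Differences of variables are unchanged by a common translation; so this substitution
  recovers a polynomial in the differences from its restriction to
  \<open>x_(n+1) = 0\<close>.\<close>

definition translate :: "nat \<Rightarrow> cpoly \<Rightarrow> cpoly" where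
  "translate n = csubst (\<lambda>i. pvar i - pvar (n + 1))"

lemmas translate_hom = csubst_hom[where \<theta> = "\<lambda>i. pvar i - pvar (n + 1)" for n, folded translate_def]

lemma translate_pvar: "translate n (pvar i) = pvar i - pvar (n + 1)"
  by (simp add: translate_def psubst_pvar ring_hom_fun_pconst)

lemma translate_pscale: "translate n (pscale c p) = pscale c (translate n p)"
  by (simp add: translate_def csubst_pscale)

lemma homogeneous_translate: "homogeneous k p \<Longrightarrow> homogeneous k (translate n p)"
  unfolding translate_def by (intro homogeneous_csubst homogeneous_diff homogeneous_pvar)

abbreviation at_root :: "nat \<Rightarrow> cpoly \<Rightarrow> cpoly" where
  "at_root n \<equiv> kill_vars (- {1..n})"

lemma at_root_translate:
  assumes "vars_in {1..n} q"
  shows "at_root n (translate n q) = q"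
proof -
  have "at_root n (translate n q) = csubst (\<lambda>i. at_root n (pvar i - pvar (n + 1))) q"
    unfolding translate_def kill_vars_def psubst_psubst[OF ring_hom_fun_pconst] ..
  also have "\<dots> = csubst pvar q"
    using assms by (rule psubst_cong) (auto simp: rhom_diff[OF kill_vars_hom] kill_vars_pvar)
  finally show ?thesis by (simp add: psubst_id)
qed

lemma translate_at_root_graph_poly:
  assumes "\<And>e. e \<in># G \<Longrightarrow> fst e \<in> {1..n + 1} \<and> snd e \<in> {1..n + 1}"
  shows "translate n (at_root n (graph_poly G)) = graph_poly G"
  using assms
proof (induction G)
  case empty
  then show ?case by (simp add: rhom_one[OF translate_hom] rhom_one[OF kill_vars_hom])
next
  case (add e G)
  have var: "translate n (at_root n (pvar i)) = pvar i - pvar (n + 1)" if "i \<in> {1..n + 1}" for i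
  proof -
    have "i \<in> {1..n} \<or> i = n + 1" using that by auto
    then show ?thesis by (auto simp: kill_vars_pvar translate_pvar rhom_zero[OF translate_hom])
  qed
  have e: "fst e \<in> {1..n + 1}" "snd e \<in> {1..n + 1}" using add.prems[of e] by auto
  show ?case
    using add e by (simp add: graph_poly_add_mset rhom_mult[OF translate_hom] rhom_mult[OF kill_vars_hom]
        rhom_diff[OF translate_hom] rhom_diff[OF kill_vars_hom] var del: atLeastAtMost_iff)
qed

context
  fixes l m n :: nat
begin

private abbreviation (input) "K \<equiv> complete_multigraph l m n"

lemma slim_space_at_root:
  assumes "p \<in> slim_space l m n"
  shows "translate n (at_root n p) = p \<and> at_root n p \<in> cpoly.span (rooted_gens K {1..n})"
  using assms unfolding slim_space_def
proof (induction rule: cpoly.span_induct_alt)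
  case base
  then show ?case by (simp add: rhom_zero[OF translate_hom] rhom_zero[OF kill_vars_hom] cpoly.span_zero)
next
  case (step c x y)
  then obtain G where G: "x = graph_poly G" "slim l m n G" by auto
  then have "G \<subseteq># K" by (simp add: slim_def)
  then have "fst e \<in> {1..n + 1} \<and> snd e \<in> {1..n + 1}" if "e \<in># G" for e
    using mem_complete_multigraph[OF mset_subset_eqD[OF \<open>G \<subseteq># K\<close> that]] by auto
  then have "translate n (at_root n x) = x" by (simp add: G(1) translate_at_root_graph_poly)
  moreover have "at_root n x \<in> rooted_gens K {1..n}"
    using G by (auto simp: slim_iff_linked rooted_gens_def)
  ultimately show ?case
    using step by (simp add: rhom_add[OF translate_hom] rhom_add[OF kill_vars_hom] kill_vars_pscale
        translate_pscale cpoly.span_add cpoly.span_scale cpoly.span_base)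
qed

lemma translate_rooted_gens:
  assumes "q \<in> cpoly.span (rooted_gens K {1..n})"
  shows "translate n q \<in> slim_space l m n"
  using assms
proof (induction rule: cpoly.span_induct_alt)
  case base
  then show ?case by (simp add: rhom_zero[OF translate_hom] slim_space_def cpoly.span_zero)
next
  case (step c x y)
  then obtain G where G: "x = at_root n (graph_poly G)" "slim l m n G"
    by (auto simp: rooted_gens_def slim_iff_linked)
  then have *: "graph_poly G \<in> slim_space l m n"
    unfolding slim_space_def by (intro cpoly.span_base) auto
  then have "translate n x = graph_poly G" using G slim_space_at_root by simp
  then show ?case
    using step * by (simp add: rhom_add[OF translate_hom] translate_pscale slim_space_def
        cpoly.span_add cpoly.span_scale)
qed

lemma translate_mem_slim_space_iff:
  "vars_in {1..n} q \<Longrightarrow> translate n q \<in> slim_space l m n \<longleftrightarrow> cut_bounded K {1..n} q"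
  using slim_space_at_root[of "translate n q"] translate_rooted_gens[of q] at_root_translate[of n q]
  by (auto simp: span_rooted_gens_eq)

lemma cut_bounded_at_root: "p \<in> slim_space l m n \<Longrightarrow> cut_bounded K {1..n} (at_root n p)"
  using slim_space_at_root[of p] by (simp add: span_rooted_gens_eq)

text \<open>Monomials free of the last variable keep their coefficients under the restriction. The
  coefficient map can thus be read off the slim polynomial itself.\<close>

lemma lookup_at_root: "keys f \<subseteq> {1..n} \<Longrightarrow> lookup (at_root n p) f = lookup p f"
  by (simp add: lookup_kill_vars disjoint_eq_subset_Compl)

lemma subspace_slim_space: "cpoly.subspace (slim_space l m n)"
  by (simp add: slim_space_def)

lemma subspace_slim_component: "cpoly.subspace (slim_component l m n k)"
  using subspace_slim_space unfolding slim_component_def cpoly.subspace_def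
  by (auto intro: homogeneous_add homogeneous_pscale)

lemma hom_part_slim_space:
  assumes "p \<in> slim_space l m n"
  shows "hom_part k p \<in> slim_space l m n"
  using assms unfolding slim_space_def
proof (induction rule: cpoly.span_induct_alt)
  case base
  then show ?case using hom_part_homogeneous[of k 0] by (simp add: cpoly.span_zero)
next
  case (step c x y)
  then obtain G where G: "x = graph_poly G" "slim l m n G" by auto
  then have "hom_part k x = x \<or> hom_part k x = 0"
    using hom_part_homogeneous[OF homogeneous_graph_poly] by auto
  then have "hom_part k x \<in> cpoly.span {graph_poly G |G. slim l m n G}"
    using step(1) by (auto intro: cpoly.span_base cpoly.span_zero)
  then show ?case
    using step by (simp add: hom_part_add hom_part_pscale cpoly.span_add cpoly.span_scale)
qed

definition parking_degree :: "nat \<Rightarrow> (nat \<Rightarrow>\<^sub>0 nat) set" where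
  "parking_degree k = {f. parking K {1..n} f \<and> monom_degree f = k}"

lemma slim_component_eq_0I:
  assumes "p \<in> slim_component l m n k" "\<And>f. f \<in> parking_degree k \<Longrightarrow> lookup p f = 0"
  shows "p = 0"
proof -
  have p: "p \<in> slim_space l m n" "homogeneous k p" using assms by (auto simp: slim_component_def)
  have "at_root n p = 0"
  proof (rule cut_bounded_eq_0I[OF _ cut_bounded_at_root[OF p(1)]])
    fix f assume f: "parking K {1..n} f"
    then have "lookup (at_root n p) f = lookup p f"
      by (simp add: lookup_at_root parking_def)
    then show "lookup (at_root n p) f = 0"
      using assms(2)[of f] f p(2) by (auto simp: parking_degree_def homogeneous_iff)
  qed simp
  then show ?thesis using slim_space_at_root[OF p(1)] rhom_zero[OF translate_hom] by metis
qed

lemma slim_component_prescribed_coeffs: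
  obtains p where "p \<in> slim_component l m n k"
    "\<And>f. f \<in> parking_degree k \<Longrightarrow> lookup p f = F f"
proof -
  obtain q where q: "q \<in> cpoly.span (rooted_gens K {1..n})"
    "\<And>f. parking K {1..n} f \<Longrightarrow> lookup q f = F f"
    using rooted_gens_prescribed_coeffs[of "{1..n}" K F] by auto
  \<comment> \<open>Passing to the part of degree \<open>k\<close> stays in the slim space, whose
    generators are homogeneous, and changes no coefficient in degree \<open>k\<close>.\<close>
  define p where "p = hom_part k (translate n q)"
  have "p \<in> slim_component l m n k"
    by (simp add: p_def slim_component_def homogeneous_hom_part hom_part_slim_space translate_rooted_gens[OF q(1)])
  moreover have "lookup p f = F f" if "f \<in> parking_degree k" for f
  proof -
    have f: "parking K {1..n} f" "monom_degree f = k" using that by (auto simp: parking_degree_def)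
    have "vars_in {1..n} q" using span_rooted_gens_cut_bounded[OF q(1)] by (simp add: cut_bounded_def)
    then have "lookup q f = lookup (translate n q) f"
      using lookup_at_root[of f "translate n q"] f by (simp add: at_root_translate parking_def)
    then show ?thesis using q(2)[OF f(1)] f(2) by (simp add: p_def lookup_hom_part)
  qed
  ultimately show ?thesis using that by blast
qed

end

section \<open>Degrees below all cut sizes\<close>

lemma degree_psubst_le:
  fixes \<theta> :: "nat \<Rightarrow> cpoly poly"
  assumes "\<And>i. degree (\<theta> i) \<le> 1" "homogeneous k p"
  shows "degree (psubst (\<lambda>c. [:pconst c:]) \<theta> p) \<le> k"
  unfolding psubst_def
proof (intro degree_sum_le finite_keys)
  fix t assume "t \<in> keys p"
  then have t: "monom_degree t = k" using assms(2) by (simp add: homogeneous_def monom_degree_def)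
  have "degree (monom_eval \<theta> t) \<le> (\<Sum>i\<in>keys t. degree (\<theta> i ^ lookup t i))"
    unfolding monom_eval_def by (rule degree_prod_sum_le[OF finite_keys, unfolded comp_def])
  also have "\<dots> \<le> (\<Sum>i\<in>keys t. lookup t i)"
  proof (rule sum_mono)
    fix i
    have "degree (\<theta> i ^ lookup t i) \<le> degree (\<theta> i) * lookup t i"
      by (rule degree_power_le)
    also have "\<dots> \<le> 1 * lookup t i" by (intro mult_le_mono1 assms)
    finally show "degree (\<theta> i ^ lookup t i) \<le> lookup t i" by simp
  qed
  finally have "degree (monom_eval \<theta> t) \<le> k" by (simp add: t[symmetric] monom_degree_def)
  then show "degree ([:pconst (lookup p t):] * monom_eval \<theta> t) \<le> k"
    using degree_mult_le[of "[:pconst (lookup p t):]" "monom_eval \<theta> t"] by simp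
qed

text \<open>The degree in \<open>t\<close> never exceeds the total degree, so below all cut sizes
  the defining bounds hold automatically.\<close>

lemma translate_mem_slim_component:
  assumes q: "vars_in {1..n} q" "homogeneous k q"
    and k: "\<And>I. I \<subseteq> {1..n} \<Longrightarrow> I \<noteq> {} \<Longrightarrow> k < cut_size (complete_multigraph l m n) I"
  shows "translate n q \<in> slim_component l m n k"
proof -
  have "coeff (shift_vars I q) j = 0" if "I \<subseteq> {1..n}" "I \<noteq> {}" "j \<ge> cut_size (complete_multigraph l m n) I" for I j
  proof (rule coeff_eq_0)
    have "degree (shift_vars I q) \<le> k"
      unfolding shift_vars_def by (rule degree_psubst_le[OF _ q(2)]) simp
    then show "degree (shift_vars I q) < j" using k[OF that(1,2)] that(3) by simp
  qed
  then have "cut_bounded (complete_multigraph l m n) {1..n} q" using q by (simp add: cut_bounded_def)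
  then show ?thesis using q by (simp add: slim_component_def translate_mem_slim_space_iff homogeneous_translate)
qed

lemma vars_in_mult: "vars_in A p \<Longrightarrow> vars_in A q \<Longrightarrow> vars_in A (p * q)"
  unfolding vars_in_def
proof
  fix t assume *: "\<forall>t\<in>keys p. keys t \<subseteq> A" "\<forall>t\<in>keys q. keys t \<subseteq> A"
    and "t \<in> keys (p * q)"
  then obtain a b where "t = a + b" "a \<in> keys p" "b \<in> keys q"
    using Poly_Mapping.keys_mult[of p q] by blast
  then show "keys t \<subseteq> A"
    using * Poly_Mapping.keys_add[of a b] by blast
qed

lemma vars_in_prod_list: "(\<And>p. p \<in> set ps \<Longrightarrow> vars_in A p) \<Longrightarrow> vars_in A (prod_list ps)"
  by (induction ps) (auto intro: vars_in_mult simp: vars_in_def[of _ 1])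

lemma vars_in_pvar: "i \<in> A \<Longrightarrow> vars_in A (pvar i)"
  by (simp add: vars_in_def pvar_def)

lemma monom_eval_prod_list:
  obtains fs where "monom_eval \<theta> t = prod_list fs" "length fs = monom_degree t" "set fs \<subseteq> \<theta> ` keys t"
proof -
  have "\<exists>fs. (\<Prod>i\<in>A. \<theta> i ^ e i) = prod_list fs \<and> length fs = sum e A \<and> set fs \<subseteq> \<theta> ` A"
    if "finite A" for A and e :: "nat \<Rightarrow> nat"
    using that
  proof (induction A)
    case empty
    then show ?case by (intro exI[of _ "[]"]) auto
  next
    case (insert i A)
    then obtain fs where "(\<Prod>i\<in>A. \<theta> i ^ e i) = prod_list fs" "length fs = sum e A" "set fs \<subseteq> \<theta> ` A"
      by auto
    then show ?case using insert
      by (intro exI[of _ "replicate (e i) (\<theta> i) @ fs"]) (auto simp: prod_list_replicate set_replicate_conv_if)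
  qed
  from this[OF finite_keys[of t], of "lookup t"] that show ?thesis
    unfolding monom_eval_def monom_degree_def by blast
qed

text \<open>For \<open>k < n\<close> both sides consist of all polynomials of degree
  \<open>k\<close> in the differences: products of linear forms stay below every cut, and conversely
  a monomial in the \<open>x_i - x_(n+1)\<close> is such a product.\<close>

theorem slim_component_eq_span_products:
  assumes lm: "l \<ge> 1" "m \<ge> 1" and k: "k < n"
  shows "slim_component l m n k =
    cpoly.span {prod_list fs | fs. length fs = k \<and> set fs \<subseteq> slim_component l m n 1}" (is "?L = cpoly.span ?G")
proof (rule subset_antisym)
  have small: "j < cut_size (complete_multigraph l m n) I" if "I \<subseteq> {1..n}" "I \<noteq> {}" "j < n" for I j
    using cut_size_complete_multigraph_ge[OF that(1,2) lm] that(3) by simp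
  show "cpoly.span ?G \<subseteq> ?L"
  proof (rule cpoly.span_minimal[OF _ subspace_slim_component])
    show "?G \<subseteq> ?L"
    proof
      fix p assume "p \<in> ?G"
      then obtain fs where fs: "p = prod_list fs" "length fs = k" "set fs \<subseteq> slim_component l m n 1" by auto
      define qs where "qs = map (at_root n) fs"
      have "translate n (at_root n f) = f" if "f \<in> set fs" for f
        using fs(3) that slim_space_at_root[of f l m n] by (auto simp: slim_component_def)
      then have "fs = map (translate n) qs" by (simp add: qs_def map_idI)
      moreover have "prod_list (map (translate n) qs) = translate n (prod_list qs)" for qs
        by (induction qs) (simp_all add: rhom_mult[OF translate_hom] rhom_one[OF translate_hom])
      ultimately have p: "p = translate n (prod_list qs)" by (simp add: fs(1))
      have "homogeneous (length qs) (prod_list qs)"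
        using fs(3) by (intro homogeneous_prod_list)
          (auto simp: qs_def slim_component_def intro!: homogeneous_kill_vars)
      moreover have "vars_in {1..n} (prod_list qs)"
        by (intro vars_in_prod_list) (auto simp: qs_def intro: vars_in_kill_compl)
      ultimately show "p \<in> ?L"
        unfolding p using fs(2) k small by (intro translate_mem_slim_component) (auto simp: qs_def)
    qed
  qed
  show "?L \<subseteq> cpoly.span ?G"
  proof
    fix p assume p: "p \<in> ?L"
    define q where "q = at_root n p"
    have q: "vars_in {1..n} q" "homogeneous k q"
      using p by (auto simp: q_def slim_component_def vars_in_kill_compl homogeneous_kill_vars)
    have "p = translate n q" using p slim_space_at_root[of p l m n] by (simp add: q_def slim_component_def)
    also have "translate n q \<in> cpoly.span ?G"
      unfolding translate_def psubst_def pscale_def[symmetric]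
    proof (intro cpoly.span_sum cpoly.span_scale cpoly.span_base)
      fix t assume t: "t \<in> keys q"
      then have deg: "monom_degree t = k" using q(2) by (simp add: homogeneous_def monom_degree_def)
      obtain fs where fs: "monom_eval (\<lambda>i. pvar i - pvar (n + 1)) t = prod_list fs" "length fs = k"
        "set fs \<subseteq> (\<lambda>i. pvar i - pvar (n + 1)) ` keys t"
        using monom_eval_prod_list[of "\<lambda>i. pvar i - pvar (n + 1)" t] deg by metis
      have "set fs \<subseteq> slim_component l m n 1"
      proof
        fix f assume f: "f \<in> set fs"
        then obtain i where i: "f = pvar i - pvar (n + 1)" "i \<in> keys t" using fs(3) by auto
        \<comment> \<open>A factor exists only for positive \<open>k\<close>; then
          \<open>n > 1\<close>, so degree one lies below every cut as well. For \<open>k = 0\<close>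
          the product is empty.\<close>
        have "k > 0" using f fs(2) by (cases fs) auto
        then have "1 < n" using k by simp
        moreover have "i \<in> {1..n}" using i(2) t q(1) unfolding vars_in_def by blast
        ultimately have "translate n (pvar i) \<in> slim_component l m n 1"
          using small by (intro translate_mem_slim_component vars_in_pvar homogeneous_pvar) auto
        then show "f \<in> slim_component l m n 1" by (simp add: i translate_pvar)
      qed
      then show "monom_eval (\<lambda>i. pvar i - pvar (n + 1)) t \<in> ?G" using fs by auto
    qed
    finally show "p \<in> cpoly.span ?G" .
  qed
qed


section \<open>Representations\<close>

lemma vector_space_subspace_iff:
  assumes "vector_space s"
  shows "module.subspace s S \<longleftrightarrow> 0 \<in> S \<and> (\<forall>x\<in>S. \<forall>y\<in>S. x + y \<in> S) \<and> (\<forall>c. \<forall>x\<in>S. s c x \<in> S)"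
proof -
  interpret vector_space s by fact
  show ?thesis by (rule subspace_def)
qed

lemma vector_space_pointwise:
  assumes "\<And>d. vector_space (s d)"
  shows "vector_space (\<lambda>c f d. s d c (f d))"
proof -
  have "s d a (x + y) = s d a x + s d a y" "s d (a + b) x = s d a x + s d b x"
    "s d a (s d b x) = s d (a * b) x" "s d 1 x = x" for d a b x y
    using assms[of d] by (auto simp: vector_space_def)
  then show ?thesis by unfold_locales (auto simp: fun_eq_iff)
qed

lemma vector_space_mult: "vector_space ((*) :: complex \<Rightarrow> complex \<Rightarrow> complex)"
  by unfold_locales (auto simp: algebra_simps)

lemma vector_space_function: "vector_space (\<lambda>c (f :: 'x \<Rightarrow> complex) g. c * f g)"
  by (rule vector_space_pointwise[OF vector_space_mult])

lemma is_repD: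
  assumes "is_rep G R"
  shows "vector_space (rep_scale R)"
    and "0 \<in> rep_space R"
    and "v \<in> rep_space R \<Longrightarrow> w \<in> rep_space R \<Longrightarrow> v + w \<in> rep_space R"
    and "v \<in> rep_space R \<Longrightarrow> rep_scale R c v \<in> rep_space R"
    and "g \<in> carrier G \<Longrightarrow> v \<in> rep_space R \<Longrightarrow> rep_act R g v \<in> rep_space R"
  using assms vector_space_subspace_iff[of "rep_scale R" "rep_space R"] by (auto simp: is_rep_def)

text \<open>For the reflection and the Lie representation the explicit map runs from the model into
  the polynomials, against the direction that \<open>rep_iso\<close> asks for.\<close>

lemma rep_iso_by_inverse:
  assumes R: "is_rep G R" and S: "is_rep G S" and bij: "bij_betw \<psi> (rep_space S) (rep_space R)"
    and add: "\<And>v w. v \<in> rep_space S \<Longrightarrow> w \<in> rep_space S \<Longrightarrow> \<psi> (v + w) = \<psi> v + \<psi> w"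
    and scale: "\<And>c v. v \<in> rep_space S \<Longrightarrow> \<psi> (rep_scale S c v) = rep_scale R c (\<psi> v)"
    and act: "\<And>g v. g \<in> carrier G \<Longrightarrow> v \<in> rep_space S \<Longrightarrow> \<psi> (rep_act S g v) = rep_act R g (\<psi> v)"
  shows "rep_iso G R S"
proof -
  define \<phi> where "\<phi> = inv_into (rep_space S) \<psi>"
  have \<phi>: "bij_betw \<phi> (rep_space R) (rep_space S)" unfolding \<phi>_def by (rule bij_betw_inv_into[OF bij])
  have in_S: "\<phi> v \<in> rep_space S" and right: "\<psi> (\<phi> v) = v" if "v \<in> rep_space R" for v
    using that bij bij_betwE[OF \<phi>] by (auto simp: \<phi>_def bij_betw_inv_into_right)
  have left: "\<phi> (\<psi> v) = v" if "v \<in> rep_space S" for v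
    using that bij by (simp add: \<phi>_def bij_betw_inv_into_left)
  note S' = is_repD[OF S]
  have "\<phi> (v + w) = \<phi> v + \<phi> w" if "v \<in> rep_space R" "w \<in> rep_space R" for v w
    using left[of "\<phi> v + \<phi> w"] that by (simp add: add in_S right S')
  moreover have "\<phi> (rep_scale R c v) = rep_scale S c (\<phi> v)" if "v \<in> rep_space R" for c v
    using left[of "rep_scale S c (\<phi> v)"] that by (simp add: scale in_S right S')
  moreover have "\<phi> (rep_act R g v) = rep_act S g (\<phi> v)" if "g \<in> carrier G" "v \<in> rep_space R" for g v
    using left[of "rep_act S g (\<phi> v)"] that by (simp add: act in_S right S')
  ultimately show ?thesis
    unfolding rep_iso_def using R S \<phi> by blast
qed

lemma is_rep_induced_char:
  assumes "group G" "H \<subseteq> carrier G"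
  shows "is_rep G (induced_rep G H (char_rep \<chi>))"
proof -
  interpret group G by fact
  have H: "h \<otimes>\<^bsub>G\<^esub> g \<in> carrier G" if "h \<in> H" "g \<in> carrier G" for h g using that assms by auto
  show ?thesis
    unfolding is_rep_def using H assms(2)
    by (auto simp: induced_rep_def char_rep_def vector_space_function vector_space_subspace_iff
        fun_eq_iff algebra_simps m_assoc subset_iff)
qed

lemma is_rep_tensor_char:
  assumes R: "is_rep G R" and "\<chi> \<one>\<^bsub>G\<^esub> = 1"
    and "\<And>g h. g \<in> carrier G \<Longrightarrow> h \<in> carrier G \<Longrightarrow> \<chi> (g \<otimes>\<^bsub>G\<^esub> h) = \<chi> g * \<chi> h"
  shows "is_rep G (tensor_char R \<chi>)"
proof -
  interpret vector_space "rep_scale R" by (rule is_repD(1)[OF R])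
  show ?thesis
    using assms unfolding is_rep_def
    by (auto simp: tensor_char_def scale_right_distrib subspace_scale mult.commute)
qed

text \<open>The scaling of the direct sum refers to \<open>R d\<close> at every index, also outside
  \<open>I\<close>; hence the vector space axioms are asked for all \<open>d\<close>, and the action
  only for \<open>d \<in> I\<close>.\<close>

lemma is_rep_direct_sum:
  assumes "\<And>d. vector_space (rep_scale (R d))" "\<And>d. d \<in> I \<Longrightarrow> is_rep G (R d)"
  shows "is_rep G (direct_sum_rep I R)"
proof -
  note D = is_repD[OF assms(2)]
  have zero: "rep_scale (R d) c 0 = 0" for d c
  proof -
    interpret vector_space "rep_scale (R d)" by (rule assms(1))
    show ?thesis by simp
  qed
  have act0: "rep_act (R d) g 0 = 0" if "d \<in> I" "g \<in> carrier G" for d g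
  proof -
    interpret vector_space "rep_scale (R d)" by (rule assms(1))
    have "rep_act (R d) g (rep_scale (R d) 0 0) = rep_scale (R d) 0 (rep_act (R d) g 0)"
      using assms(2)[OF that(1)] that(2) D(2)[OF that(1)] unfolding is_rep_def by blast
    then show ?thesis by simp
  qed
  have fin_add: "finite {d. f d + g d \<noteq> 0}" if "finite {d. f d \<noteq> 0}" "finite {d. g d \<noteq> 0}"
    for f g :: "'a \<Rightarrow> 'b"
    by (rule finite_subset[OF _ finite_UnI[OF that]]) auto
  have fin_scale: "finite {d. rep_scale (R d) c (f d) \<noteq> 0}" if "finite {d. f d \<noteq> 0}" for f c
    by (rule finite_subset[OF _ that]) (auto simp: zero)
  have fin_act: "finite {d. (d \<in> I \<longrightarrow> rep_act (R d) g (f d) \<noteq> 0) \<and> d \<in> I}" if "finite {d. f d \<noteq> 0}" "g \<in> carrier G" for f g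
    by (rule finite_subset[OF _ that(1)]) (use act0 that(2) in auto)
  have "rep_act (R d) g (v + w) = rep_act (R d) g v + rep_act (R d) g w"
    "rep_act (R d) g (rep_scale (R d) c v) = rep_scale (R d) c (rep_act (R d) g v)"
    "rep_act (R d) \<one>\<^bsub>G\<^esub> v = v"
    "h \<in> carrier G \<Longrightarrow> rep_act (R d) (g \<otimes>\<^bsub>G\<^esub> h) v = rep_act (R d) g (rep_act (R d) h v)"
    if "d \<in> I" "g \<in> carrier G" "v \<in> rep_space (R d)" "w \<in> rep_space (R d)" for d g h c v w
    using assms(2)[OF that(1)] that(2-) by (auto simp: is_rep_def)
  note R = this
  have vs: "vector_space (rep_scale (direct_sum_rep I R))"
    using vector_space_pointwise[of "\<lambda>d. rep_scale (R d)", OF assms(1)] by (simp add: direct_sum_rep_def)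
  show ?thesis
    unfolding is_rep_def vector_space_subspace_iff[OF vs]
  proof (intro conjI ballI allI vs)
    show "0 \<in> rep_space (direct_sum_rep I R)" using D(2) by (auto simp: direct_sum_rep_def)
    show "v + w \<in> rep_space (direct_sum_rep I R)"
      if "v \<in> rep_space (direct_sum_rep I R)" "w \<in> rep_space (direct_sum_rep I R)" for v w
      using that D(3) by (auto simp: direct_sum_rep_def intro: fin_add)
    show "rep_scale (direct_sum_rep I R) c v \<in> rep_space (direct_sum_rep I R)"
      if "v \<in> rep_space (direct_sum_rep I R)" for c v
      using that D(4) by (auto simp: direct_sum_rep_def zero intro: fin_scale)
    show "rep_act (direct_sum_rep I R) g v \<in> rep_space (direct_sum_rep I R)"
      if "g \<in> carrier G" "v \<in> rep_space (direct_sum_rep I R)" for g v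
      using that D(5) fin_act by (auto simp: direct_sum_rep_def)
    show "rep_act (direct_sum_rep I R) g (v + w) =
        rep_act (direct_sum_rep I R) g v + rep_act (direct_sum_rep I R) g w"
      if "g \<in> carrier G" "v \<in> rep_space (direct_sum_rep I R)" "w \<in> rep_space (direct_sum_rep I R)" for g v w
      using that R(1) by (auto simp: direct_sum_rep_def fun_eq_iff)
    show "rep_act (direct_sum_rep I R) g (rep_scale (direct_sum_rep I R) c v) =
        rep_scale (direct_sum_rep I R) c (rep_act (direct_sum_rep I R) g v)"
      if "g \<in> carrier G" "v \<in> rep_space (direct_sum_rep I R)" for g c v
      using that R(2) by (auto simp: direct_sum_rep_def fun_eq_iff zero)
    show "rep_act (direct_sum_rep I R) \<one>\<^bsub>G\<^esub> v = v" if "v \<in> rep_space (direct_sum_rep I R)" for v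
      using that assms(2) by (auto simp: direct_sum_rep_def fun_eq_iff is_rep_def)
    show "rep_act (direct_sum_rep I R) (g \<otimes>\<^bsub>G\<^esub> h) v =
        rep_act (direct_sum_rep I R) g (rep_act (direct_sum_rep I R) h v)"
      if "g \<in> carrier G" "h \<in> carrier G" "v \<in> rep_space (direct_sum_rep I R)" for g h v
      using that R(4) by (auto simp: direct_sum_rep_def fun_eq_iff)
  qed
qed


section \<open>Symmetry of the slim space\<close>

text \<open>Minimum and maximum restore the convention that the smaller end of an edge comes
  first.\<close>

definition permute_edge :: "(nat \<Rightarrow> nat) \<Rightarrow> nat \<times> nat \<Rightarrow> nat \<times> nat" where
  "permute_edge \<sigma> e = (min (\<sigma> (fst e)) (\<sigma> (snd e)), max (\<sigma> (fst e)) (\<sigma> (snd e)))"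

text \<open>Each edge whose ends change order contributes a sign. The span absorbs it.\<close>

lemma graph_poly_permute_edges:
  "graph_poly (image_mset (permute_edge \<sigma>) G) = permute_vars \<sigma> (graph_poly G) \<or>
   graph_poly (image_mset (permute_edge \<sigma>) G) = - permute_vars \<sigma> (graph_poly G)"
proof (induction G)
  case empty
  then show ?case by (simp add: rhom_one[OF permute_vars_hom])
next
  case (add e G)
  have "pvar (fst (permute_edge \<sigma> e)) - pvar (snd (permute_edge \<sigma> e)) = permute_vars \<sigma> (pvar (fst e) - pvar (snd e)) \<or>
    pvar (fst (permute_edge \<sigma> e)) - pvar (snd (permute_edge \<sigma> e)) = - permute_vars \<sigma> (pvar (fst e) - pvar (snd e))"
    by (auto simp: permute_edge_def rhom_diff[OF permute_vars_hom] permute_vars_pvar min_def max_def)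
  with add show ?case
    by (auto simp: graph_poly_add_mset rhom_mult[OF permute_vars_hom])
qed

definition all_edges :: "nat \<Rightarrow> (nat \<times> nat) set" where
  "all_edges n = (SIGMA i:{1..n}. {i<..n + 1})"

lemma finite_all_edges: "finite (all_edges n)"
  by (simp add: all_edges_def)

lemma complete_multigraph_all_edges:
  "complete_multigraph l m n = (\<Sum>e\<in>all_edges n. replicate_mset (if snd e = n + 1 then l else m) e)"
proof -
  have "(\<Sum>e\<in>all_edges n. replicate_mset (if snd e = n + 1 then l else m) e) =
    (\<Sum>i\<in>{1..n}. \<Sum>j\<in>{i<..n + 1}. replicate_mset (if j = n + 1 then l else m) (i, j))"
    by (simp add: all_edges_def sum.Sigma case_prod_unfold)
  also have "\<dots> = (\<Sum>i\<in>{1..n}. (\<Sum>j\<in>{i<..n}. replicate_mset m (i, j)) + replicate_mset l (i, n + 1))"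
  proof (rule sum.cong[OF refl])
    fix i assume "i \<in> {1..n}"
    then have "{i<..n + 1} = insert (n + 1) {i<..n}" by auto
    moreover have "n + 1 \<notin> {i<..n}" by simp
    ultimately show "(\<Sum>j\<in>{i<..n + 1}. replicate_mset (if j = n + 1 then l else m) (i, j)) =
      (\<Sum>j\<in>{i<..n}. replicate_mset m (i, j)) + replicate_mset l (i, n + 1)"
      by (simp add: add.commute)
  qed
  finally show ?thesis by (simp add: complete_multigraph_def sum.distrib)
qed

lemma permute_edge_bij:
  assumes "\<sigma> permutes {1..n + 1}"
  shows "bij_betw (permute_edge \<sigma>) (all_edges n) (all_edges n)"
proof -
  have edge: "(i, j) \<in> all_edges n \<longleftrightarrow> i \<in> {1..n + 1} \<and> j \<in> {1..n + 1} \<and> i < j" for i j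
    by (auto simp: all_edges_def)
  have inj: "inj \<sigma>" using permutes_inj[OF assms] .
  have "inj_on (permute_edge \<sigma>) (all_edges n)"
  proof (rule inj_onI)
    fix e e' assume *: "e \<in> all_edges n" "e' \<in> all_edges n" "permute_edge \<sigma> e = permute_edge \<sigma> e'"
    obtain a b a' b' where e: "e = (a, b)" "e' = (a', b')" by (cases e, cases e')
    have "a < b" "a' < b'" using * by (auto simp: e edge)
    moreover have "\<sigma> a = \<sigma> a' \<and> \<sigma> b = \<sigma> b' \<or> \<sigma> a = \<sigma> b' \<and> \<sigma> b = \<sigma> a'"
      using *(3) by (auto simp: e permute_edge_def min_def max_def split: if_splits)
    ultimately show "e = e'" using inj by (auto simp: e inj_eq)
  qed
  moreover have "permute_edge \<sigma> ` all_edges n \<subseteq> all_edges n"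
  proof (rule image_subsetI)
    fix e assume *: "e \<in> all_edges n"
    obtain a b where e: "e = (a, b)" by (cases e)
    have "a \<in> {1..n + 1}" "b \<in> {1..n + 1}" "a \<noteq> b" using * unfolding e edge by auto
    then have "\<sigma> a \<in> {1..n + 1}" "\<sigma> b \<in> {1..n + 1}" "\<sigma> a \<noteq> \<sigma> b"
      using permutes_in_image[OF assms] inj by (auto simp: inj_eq)
    then show "permute_edge \<sigma> e \<in> all_edges n" by (auto simp: e permute_edge_def edge)
  qed
  ultimately show ?thesis
    using endo_inj_surj[OF finite_all_edges] by (simp add: bij_betw_def)
qed

lemma permutes_last:
  fixes \<sigma> :: "nat \<Rightarrow> nat"
  assumes "\<sigma> permutes {1..n}" "i \<in> {1..n + 1}"
  shows "\<sigma> i = n + 1 \<longleftrightarrow> i = n + 1"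
proof
  have fix_last: "\<sigma> (n + 1) = n + 1" using assms(1) by (rule permutes_not_in) simp
  then show "\<sigma> i = n + 1" if "i = n + 1" using that by simp
  show "i = n + 1" if "\<sigma> i = n + 1"
    using that fix_last permutes_inj[OF assms(1)] by (metis injD)
qed

text \<open>The multiplicity of an edge depends on whether it meets \<open>n + 1\<close>, so the
  permutation must fix this vertex unless the two multiplicities coincide.\<close>

lemma complete_multigraph_permute:
  assumes \<sigma>: "\<sigma> permutes {1..n + 1}" and lm: "\<sigma> permutes {1..n} \<or> l = m"
  shows "image_mset (permute_edge \<sigma>) (complete_multigraph l m n) = complete_multigraph l m n"
proof -
  let ?w = "\<lambda>e. if snd e = n + 1 then l else m"
  have w: "?w (permute_edge \<sigma> e) = ?w e" if e: "e \<in> all_edges n" for e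
  proof (cases "l = m")
    case False
    obtain a b where ab: "e = (a, b)" by (cases e)
    have "a \<in> {1..n + 1}" "b \<in> {1..n + 1}" "a < b" using e by (auto simp: all_edges_def ab)
    moreover have "\<sigma> x \<le> n + 1" if "x \<in> {1..n + 1}" for x
      using permutes_in_image[OF \<sigma>, of x] that by auto
    ultimately show ?thesis
      using permutes_last[of \<sigma> n a] permutes_last[of \<sigma> n b] lm False
      by (auto simp: ab permute_edge_def max_def)
  qed simp
  have "image_mset (permute_edge \<sigma>) (\<Sum>e\<in>A. replicate_mset (?w e) e) = (\<Sum>e\<in>A. replicate_mset (?w e) (permute_edge \<sigma> e))"
    if "finite A" for A
    using that by induction auto
  then have "image_mset (permute_edge \<sigma>) (complete_multigraph l m n) =
      (\<Sum>e\<in>all_edges n. replicate_mset (?w e) (permute_edge \<sigma> e))"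
    unfolding complete_multigraph_all_edges using finite_all_edges by blast
  also have "\<dots> = (\<Sum>e\<in>all_edges n. replicate_mset (?w (permute_edge \<sigma> e)) (permute_edge \<sigma> e))"
    using w by (intro sum.cong) auto
  also have "\<dots> = complete_multigraph l m n"
    unfolding complete_multigraph_all_edges by (rule sum.reindex_bij_betw[OF permute_edge_bij[OF \<sigma>]])
  finally show ?thesis .
qed

lemma connected_multigraph_permute:
  assumes \<sigma>: "\<sigma> permutes U" and c: "connected_multigraph U E"
  shows "connected_multigraph U (image_mset (permute_edge \<sigma>) E)"
proof -
  let ?r = "set_mset E \<union> (set_mset E)\<inverse>" and ?E' = "image_mset (permute_edge \<sigma>) E"
  let ?r' = "set_mset ?E' \<union> (set_mset ?E')\<inverse>"
  have step_edge: "(\<sigma> u, \<sigma> v) \<in> ?r'" if "(u, v) \<in> ?r" for u v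
  proof -
    have "permute_edge \<sigma> (u, v) \<in># ?E' \<or> permute_edge \<sigma> (v, u) \<in># ?E'"
      using that by auto
    then show ?thesis by (auto simp: permute_edge_def min_def max_def split: if_splits)
  qed
  have path: "(\<sigma> u, \<sigma> v) \<in> ?r'\<^sup>*" if "(u, v) \<in> ?r\<^sup>*" for u v
    using that
  proof induction
    case (step y z)
    then show ?case using step_edge[OF step(2)] by (rule_tac rtrancl_into_rtrancl)
  qed simp
  show ?thesis
    unfolding connected_multigraph_def
  proof (intro ballI)
    fix u v assume "u \<in> U" "v \<in> U"
    then obtain a b where "a \<in> U" "b \<in> U" "u = \<sigma> a" "v = \<sigma> b"
      using permutes_image[OF \<sigma>] by (metis imageE)
    then show "(u, v) \<in> ?r'\<^sup>*" using c path by (auto simp: connected_multigraph_def)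
  qed
qed

lemma permute_vars_slim_space:
  assumes \<sigma>: "\<sigma> permutes {1..n + 1}" and lm: "\<sigma> permutes {1..n} \<or> l = m"
    and p: "p \<in> slim_space l m n"
  shows "permute_vars \<sigma> p \<in> slim_space l m n"
  using p unfolding slim_space_def
proof (induction rule: cpoly.span_induct_alt)
  case base
  then show ?case by (simp add: rhom_zero[OF permute_vars_hom] cpoly.span_zero)
next
  case (step c x y)
  then obtain G where G: "x = graph_poly G" "slim l m n G" by auto
  let ?G = "image_mset (permute_edge \<sigma>) G"
  have "slim l m n ?G"
    using G(2) complete_multigraph_permute[OF \<sigma> lm]
      connected_multigraph_permute[OF \<sigma>, of "complete_multigraph l m n - G"]
      image_mset_subseteq_mono[of G "complete_multigraph l m n" "permute_edge \<sigma>"]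
    by (simp add: slim_def image_mset_Diff)
  then have *: "graph_poly ?G \<in> cpoly.span {graph_poly G |G. slim l m n G}"
    by (intro cpoly.span_base) auto
  have "permute_vars \<sigma> x \<in> cpoly.span {graph_poly G |G. slim l m n G}"
    using graph_poly_permute_edges[of \<sigma> G] * cpoly.span_neg[OF *] by (auto simp: G)
  then show ?case
    using step by (simp add: rhom_add[OF permute_vars_hom] permute_vars_pscale cpoly.span_add cpoly.span_scale)
qed

lemma permutes_Suc_range: "(\<sigma> :: nat \<Rightarrow> nat) permutes {1..n} \<Longrightarrow> \<sigma> permutes {1..n + 1}"
  by (erule permutes_subset) auto

lemma is_rep_slim_rep:
  assumes "r = n \<or> r = n + 1 \<and> l = m"
  shows "is_rep (sym_group r) (slim_rep l m n k)"
proof -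
  have "permute_vars \<sigma> p \<in> slim_component l m n k"
    if "\<sigma> permutes {1..r}" "p \<in> slim_component l m n k" for \<sigma> p
    using that assms permutes_Suc_range[of \<sigma> n]
    by (auto simp: slim_component_def homogeneous_permute_vars intro!: permute_vars_slim_space)
  then show ?thesis
    using subspace_slim_component[of l m n k]
    by (simp add: is_rep_def slim_rep_def cpoly.vector_space_axioms sym_group_carrier sym_group_mult
        sym_group_one rhom_add[OF permute_vars_hom] permute_vars_pscale permute_vars_id permute_vars_compose)
qed


section \<open>The reflection representation\<close>

definition linear_form :: "nat set \<Rightarrow> (nat \<Rightarrow> complex) \<Rightarrow> cpoly" where
  "linear_form A v = (\<Sum>i\<in>A. pscale (v i) (pvar i))"

lemma homogeneous_linear_form: "homogeneous 1 (linear_form A v)"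
  unfolding linear_form_def by (intro homogeneous_sum homogeneous_pscale homogeneous_pvar)

lemma vars_in_sum: "(\<And>a. a \<in> B \<Longrightarrow> vars_in A (f a)) \<Longrightarrow> vars_in A (sum f B)"
  by (induction B rule: infinite_finite_induct) (auto intro: vars_in_add vars_in_0)

lemma vars_in_linear_form: "vars_in A (linear_form A v)"
  unfolding linear_form_def by (intro vars_in_sum vars_in_pscale vars_in_pvar)

lemma lookup_linear_form:
  assumes "finite A" "i \<in> A"
  shows "lookup (linear_form A v) (single i 1) = v i"
proof -
  have "single j (1::nat) = single i 1 \<longleftrightarrow> j = i" for j
    by (metis lookup_single_eq lookup_single_not_eq zero_neq_one)
  then show ?thesis using assms
    by (simp add: linear_form_def lookup_sum lookup_pscale pvar_def lookup_single when_def if_distrib[of "(*) _"] cong: if_cong)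
qed

lemma monom_degree_1D:
  assumes "monom_degree t = 1"
  obtains i where "t = single i 1"
proof -
  have "\<exists>i\<in>keys t. lookup t i = 1 \<and> (\<forall>j\<in>keys t. j \<noteq> i \<longrightarrow> lookup t j = 0)"
    using assms sum_eq_1_iff[OF finite_keys[of t], of "lookup t"] unfolding monom_degree_def by metis
  then obtain i where i: "lookup t i = 1" "\<And>j. j \<noteq> i \<Longrightarrow> lookup t j = 0"
    by (metis in_keys_iff)
  then have "t = single i 1"
    by (intro poly_mapping_eqI) (auto simp: lookup_single when_def)
  then show ?thesis using that by blast
qed

lemma homogeneous_1_linear_form:
  assumes "finite A" "vars_in A q" "homogeneous 1 q"
  shows "q = linear_form A (\<lambda>i. lookup q (single i 1))"
proof (rule poly_mapping_eqI)
  fix t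
  let ?L = "linear_form A (\<lambda>i. lookup q (single i 1))"
  show "lookup q t = lookup ?L t"
  proof (cases "\<exists>i\<in>A. t = single i 1")
    case True
    then show ?thesis using lookup_linear_form[OF assms(1)] by auto
  next
    case False
    have "lookup p t = 0" if p: "vars_in A p" "homogeneous 1 p" for p
    proof (rule ccontr)
      assume nz: "lookup p t \<noteq> 0"
      then have "monom_degree t = 1" using p(2) by (simp add: homogeneous_iff)
      then obtain i where i: "t = single i 1" by (rule monom_degree_1D)
      moreover have "keys t \<subseteq> A" using nz p(1) by (auto simp: vars_in_def in_keys_iff[of t])
      ultimately have "i \<in> A" by simp
      then show False using False i by blast
    qed
    then show ?thesis using assms vars_in_linear_form homogeneous_linear_form by simp
  qed
qed

text \<open>The coefficient that arises at the last variable makes the coefficients sum to zero,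
  which is the defining equation of the reflection representation.\<close>

lemma translate_linear_form:
  "translate n (linear_form {1..n} v) = linear_form {1..n + 1} (v(n + 1 := - (\<Sum>i\<in>{1..n}. v i)))"
proof -
  have "translate n (linear_form {1..n} v) = (\<Sum>i\<in>{1..n}. pscale (v i) (pvar i)) - (\<Sum>i\<in>{1..n}. pscale (v i) (pvar (n + 1)))"
    by (simp add: linear_form_def rhom_sum[OF translate_hom] translate_pscale translate_pvar
        cpoly.scale_right_diff_distrib sum_subtractf)
  also have "(\<Sum>i\<in>{1..n}. pscale (v i) (pvar (n + 1))) = pscale (\<Sum>i\<in>{1..n}. v i) (pvar (n + 1))"
    by (simp add: cpoly.scale_sum_left)
  also have "(\<Sum>i\<in>{1..n}. pscale (v i) (pvar i)) - pscale (\<Sum>i\<in>{1..n}. v i) (pvar (n + 1)) =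
    linear_form {1..n + 1} (v(n + 1 := - (\<Sum>i\<in>{1..n}. v i)))"
  proof -
    have "{1..n + 1} = insert (n + 1) {1..n}" by auto
    moreover have "(\<Sum>i\<in>{1..n}. pscale ((v(n + 1 := - (\<Sum>i\<in>{1..n}. v i))) i) (pvar i)) = (\<Sum>i\<in>{1..n}. pscale (v i) (pvar i))"
      by (intro sum.cong) auto
    ultimately show ?thesis by (simp add: linear_form_def)
  qed
  finally show ?thesis .
qed

lemma is_rep_reflection_rep: "is_rep (sym_group N) (reflection_rep N)"
proof -
  have inv: "inv' \<sigma> permutes {1..N}" if "\<sigma> permutes {1..N}" for \<sigma> using that by (rule permutes_inv)
  have sum: "(\<Sum>i\<in>{1..N}. v (inv' \<sigma> i)) = (\<Sum>i\<in>{1..N}. v i)" if "\<sigma> permutes {1..N}" for \<sigma> and v :: "nat \<Rightarrow> complex"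
    using sum.permute[OF inv[OF that], of v] by (simp add: comp_def)
  have notin: "inv' \<sigma> i \<notin> {1..N}" if "\<sigma> permutes {1..N}" "i \<notin> {1..N}" for \<sigma> i
    using permutes_in_image[OF inv[OF that(1)]] that(2) by blast
  have inv_comp: "inv' (g \<circ> h) i = inv' h (inv' g i)" if "g permutes {1..N}" "h permutes {1..N}" for g h i
    using that by (simp add: o_inv_distrib permutes_bij)
  show ?thesis
    unfolding is_rep_def
    using sum notin
    by (auto simp: reflection_rep_def sym_group_carrier sym_group_mult sym_group_one vector_space_function
        vector_space_subspace_iff sum.distrib fun_eq_iff inv_comp inv_id simp flip: sum_distrib_left
        simp del: atLeastAtMost_iff)
qed

text \<open>Degree one lies below every cut, so the component consists of all linear forms whose
  coefficients sum to zero. For \<open>l = n = 1\<close> the graph is a single edge that may not be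
  removed: the component is zero while the reflection representation has dimension one, whence the
  exclusion.\<close>

theorem slim_component_1_reflection:
  assumes l: "l \<ge> 1" "n \<ge> 1" "\<not> (l = 1 \<and> n = 1)"
  shows "rep_iso (sym_group (n + 1)) (slim_rep l l n 1) (reflection_rep (n + 1))"
proof (rule rep_iso_by_inverse[where \<psi> = "linear_form {1..n + 1}"])
  show "is_rep (sym_group (n + 1)) (slim_rep l l n 1)" by (rule is_rep_slim_rep) simp
  show "is_rep (sym_group (n + 1)) (reflection_rep (n + 1))" by (rule is_rep_reflection_rep)
  let ?S = "rep_space (reflection_rep (n + 1))"
  have last: "{1..n + 1} = insert (n + 1) {1..n}" by auto
  have small: "1 < cut_size (complete_multigraph l l n) I" if I: "I \<subseteq> {1..n}" "I \<noteq> {}" for I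
  proof (cases "n = 1")
    case True
    then have "I = {1}" using I by auto
    then show ?thesis using l True cut_size_complete_multigraph[OF I(1), of l l] by simp
  next
    case False
    then show ?thesis using cut_size_complete_multigraph_ge[OF I] l by force
  qed
  have lin: "linear_form {1..n + 1} v = translate n (linear_form {1..n} v)" if "v \<in> ?S" for v
  proof -
    have "(\<Sum>i\<in>{1..n + 1}. v i) = 0" using that by (simp add: reflection_rep_def)
    then have "v (n + 1) = - (\<Sum>i\<in>{1..n}. v i)" unfolding last by (simp add: eq_neg_iff_add_eq_0)
    then have "v(n + 1 := - (\<Sum>i\<in>{1..n}. v i)) = v" by auto
    then show ?thesis unfolding translate_linear_form by simp
  qed
  show "bij_betw (linear_form {1..n + 1}) ?S (rep_space (slim_rep l l n 1))"
    unfolding bij_betw_def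
  proof (intro conjI inj_onI subset_antisym subsetI)
    fix v w assume *: "v \<in> ?S" "w \<in> ?S" "linear_form {1..n + 1} v = linear_form {1..n + 1} w"
    show "v = w"
    proof
      fix i
      show "v i = w i"
      proof (cases "i \<in> {1..n + 1}")
        case True
        then show ?thesis
          using *(3) lookup_linear_form[of "{1..n + 1}" i v] lookup_linear_form[of "{1..n + 1}" i w] by simp
      next
        case False
        then have "v i = 0" "w i = 0" using *(1,2) unfolding reflection_rep_def by simp_all
        then show ?thesis by simp
      qed
    qed
  next
    fix p assume "p \<in> linear_form {1..n + 1} ` ?S"
    then obtain v where "v \<in> ?S" "p = linear_form {1..n + 1} v" by auto
    then show "p \<in> rep_space (slim_rep l l n 1)"
      using translate_mem_slim_component[OF vars_in_linear_form homogeneous_linear_form small] lin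
      by (simp add: slim_rep_def)
  next
    fix p assume "p \<in> rep_space (slim_rep l l n 1)"
    then have p: "p \<in> slim_space l l n" "homogeneous 1 p" by (auto simp: slim_rep_def slim_component_def)
    define c where "c = (\<lambda>i. if i \<in> {1..n} then lookup (at_root n p) (single i 1) else 0)"
    define v where "v = c(n + 1 := - (\<Sum>i\<in>{1..n}. c i))"
    have "at_root n p = linear_form {1..n} (\<lambda>i. lookup (at_root n p) (single i 1))"
      by (rule homogeneous_1_linear_form) (auto intro: vars_in_kill_compl homogeneous_kill_vars p)
    also have "\<dots> = linear_form {1..n} c"
      unfolding linear_form_def c_def by (intro sum.cong) auto
    finally have "p = translate n (linear_form {1..n} c)"
      using slim_space_at_root[OF p(1)] by simp
    then have "p = linear_form {1..n + 1} v" by (simp add: translate_linear_form v_def)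
    moreover have "v \<in> ?S"
    proof -
      have "(\<Sum>i\<in>{1..n}. v i) = (\<Sum>i\<in>{1..n}. c i)" by (intro sum.cong) (auto simp: v_def)
      then have "(\<Sum>i\<in>{1..n + 1}. v i) = 0" unfolding last by (simp add: v_def)
      moreover have "v i = 0" if "i \<notin> {1..n + 1}" for i
        using that unfolding v_def c_def by auto
      ultimately show ?thesis by (simp add: reflection_rep_def)
    qed
    ultimately show "p \<in> linear_form {1..n + 1} ` ?S" by auto
  qed
  show "linear_form {1..n + 1} (v + w) = linear_form {1..n + 1} v + linear_form {1..n + 1} w" for v w
    by (simp add: linear_form_def cpoly.scale_left_distrib sum.distrib)
  show "linear_form {1..n + 1} (rep_scale (reflection_rep (n + 1)) c v) =
    rep_scale (slim_rep l l n 1) c (linear_form {1..n + 1} v)" for c v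
    by (simp add: linear_form_def reflection_rep_def slim_rep_def cpoly.scale_sum_right)
  show "linear_form {1..n + 1} (rep_act (reflection_rep (n + 1)) g v) =
    rep_act (slim_rep l l n 1) g (linear_form {1..n + 1} v)" if "g \<in> carrier (sym_group (n + 1))" for g v
  proof -
    have g: "g permutes {1..n + 1}" using that by (simp add: sym_group_carrier)
    have "linear_form {1..n + 1} (\<lambda>i. v (inv' g i)) = (\<Sum>i\<in>{1..n + 1}. pscale (v (inv' g (g i))) (pvar (g i)))"
      unfolding linear_form_def using sum.permute[OF g, of "\<lambda>i. pscale (v (inv' g i)) (pvar i)"] by (simp add: comp_def)
    then show ?thesis
      by (simp add: reflection_rep_def slim_rep_def linear_form_def rhom_sum[OF permute_vars_hom]
          permute_vars_pscale permute_vars_pvar permutes_inverses[OF g])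
  qed
qed


section \<open>Dyck paths and parking functions\<close>

text \<open>The accumulator counts the horizontal steps made so far. Started at 0, the list gives
  the distances of the vertical steps from the left side of the rectangle, from bottom to top: the
  area partition read backwards.\<close>

fun rows :: "nat \<Rightarrow> step list \<Rightarrow> nat list" where
  "rows h [] = []"
| "rows h (Horiz # D) = rows (Suc h) D"
| "rows h (Vert # D) = h # rows h D"

lemma rows_eq_filter:
  "map (\<lambda>i. h + count_list (take i D) Horiz) (filter (\<lambda>i. D ! i = Vert) [0..<length D]) = rows h D"
proof (induction D arbitrary: h)
  case (Cons s D)
  have "[0..<length (s # D)] = 0 # map Suc [0..<length D]"
    by (simp add: upt_conv_Cons map_Suc_upt del: upt_Suc)
  then show ?case
    using Cons[of h] Cons[of "Suc h"] by (cases s) (simp_all add: filter_map comp_def One_nat_def)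
qed simp

lemma area_partition_eq_rows: "area_partition l D = rev (rows 0 D)"
proof -
  have "nat (int l - 1 + fst (path_point l D i)) = 0 + count_list (take i D) Horiz" for i
    by (simp add: path_point_def)
  then show ?thesis unfolding area_partition_def by (simp add: rows_eq_filter[of 0, simplified])
qed

lemma area_eq_sum_rows: "area l D = sum_list (rows 0 D)"
  by (simp add: area_def area_partition_eq_rows)

lemma length_rows: "length (rows h D) = count_list D Vert"
  by (induction h D rule: rows.induct) auto

lemma rows_bounds: "x \<in> set (rows h D) \<Longrightarrow> h \<le> x \<and> x \<le> h + count_list D Horiz"
  by (induction h D rule: rows.induct) auto

lemma sorted_rows: "sorted (rows h D)"
  by (induction h D rule: rows.induct) (auto dest: rows_bounds)

text \<open>At each height the rightmost point is the one just before the vertical step, and these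
  are the rows. At the final height it is the end point, which by assumption lies on the boundary
  line.\<close>

lemma rows_bounded_iff:
  assumes "h + count_list D Horiz = c + m * (v + count_list D Vert)"
  shows "(\<forall>i\<le>length D. h + count_list (take i D) Horiz \<le> c + m * (v + count_list (take i D) Vert)) \<longleftrightarrow>
         (\<forall>j<length (rows h D). rows h D ! j \<le> c + m * (v + j))"
  using assms
proof (induction h D arbitrary: v rule: rows.induct)
  case (1 h)
  then show ?case by simp
next
  case (2 h D)
  have split: "(\<forall>i\<le>length (Horiz # D). P i) \<longleftrightarrow> P 0 \<and> (\<forall>i\<le>length D. P (Suc i))" for P
    by (metis (no_types, lifting) Suc_le_mono length_Cons le0 not0_implies_Suc)
  show ?case
    unfolding split using 2(1)[of v] 2(2) by (auto dest: spec[of _ 0])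
next
  case (3 h D)
  have split: "(\<forall>i\<le>length (Vert # D). P i) \<longleftrightarrow> P 0 \<and> (\<forall>i\<le>length D. P (Suc i))" for P
    by (metis (no_types, lifting) Suc_le_mono length_Cons le0 not0_implies_Suc)
  have split': "(\<forall>j<length (rows h (Vert # D)). P j) \<longleftrightarrow> P 0 \<and> (\<forall>j<length (rows h D). P (Suc j))" for P
    by (simp add: All_less_Suc2)
  show ?case
    unfolding split split' using 3(1)[of "Suc v"] 3(2) by (simp add: One_nat_def)
qed

text \<open>Moving the origin to the start of the path turns the line \<open>y = x / m\<close> into
  \<open>x = l - 1 + m * y\<close>.\<close>

lemma dyck_path_iff:
  assumes "l \<ge> 1" "m \<ge> 1"
  shows "dyck_path l m n D \<longleftrightarrow> count_list D Horiz = l - 1 + m * n \<and> count_list D Vert = n \<and>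
    (\<forall>j<n. rows 0 D ! j \<le> l - 1 + m * j)"
proof -
  have end_iff: "path_point l D (length D) = (int (m * n), int n) \<longleftrightarrow>
      count_list D Horiz = l - 1 + m * n \<and> count_list D Vert = n"
  proof -
    have "int (l - 1 + m * n) = int l - 1 + int (m * n)" using assms by (simp add: of_nat_diff)
    then have "path_point l D (length D) = (int (m * n), int n) \<longleftrightarrow>
        int (count_list D Horiz) = int (l - 1 + m * n) \<and> int (count_list D Vert) = int n"
      by (auto simp: path_point_def)
    then show ?thesis by (simp only: of_nat_eq_iff)
  qed
  have line_iff: "real_of_int (snd (path_point l D i)) \<ge> real_of_int (fst (path_point l D i)) / real m \<longleftrightarrow>
      0 + count_list (take i D) Horiz \<le> l - 1 + m * (0 + count_list (take i D) Vert)" for i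
  proof -
    let ?H = "count_list (take i D) Horiz" and ?V = "count_list (take i D) Vert"
    have "real_of_int (snd (path_point l D i)) \<ge> real_of_int (fst (path_point l D i)) / real m \<longleftrightarrow>
        real_of_int (fst (path_point l D i)) \<le> real m * real_of_int (snd (path_point l D i))"
      using assms by (simp add: divide_le_eq mult.commute)
    also have "\<dots> \<longleftrightarrow> fst (path_point l D i) \<le> int m * snd (path_point l D i)"
      by (metis of_int_le_iff of_int_mult of_int_of_nat_eq)
    also have "\<dots> \<longleftrightarrow> int ?H \<le> int (l - 1 + m * ?V)"
      using assms by (simp add: path_point_def of_nat_diff algebra_simps)
    finally show ?thesis by (simp only: of_nat_le_iff add_0)
  qed
  show ?thesis
    unfolding dyck_path_def end_iff line_iff
    using rows_bounded_iff[of 0 D "l - 1" m 0] by (auto simp: length_rows)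
qed

text \<open>The rows do not see the horizontal steps after the last vertical one; the total number
  of horizontal steps supplies them.\<close>

lemma rows_inject:
  "rows h D = rows h D' \<Longrightarrow> count_list D Horiz = count_list D' Horiz \<Longrightarrow> D = D'"
proof (induction h D arbitrary: D' rule: rows.induct)
  case (1 h)
  then show ?case by (cases "(h, D')" rule: rows.cases) (auto split: if_splits)
next
  case (2 h D)
  then show ?case
  proof (cases "(h, D')" rule: rows.cases)
    case (3 h' D'')
    then have "h \<in> set (rows (Suc h) D)" using 2 by auto
    then show ?thesis using rows_bounds[of h "Suc h" D] by auto
  qed (auto split: if_splits)
next
  case (3 h D)
  then show ?case
  proof (cases "(h, D')" rule: rows.cases)
    case (2 h' D'')
    then have "h \<in> set (rows (Suc h) D'')" using 3(2) by (metis Pair_inject list.set_intros(1) rows.simps(2,3))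
    then show ?thesis using rows_bounds[of h "Suc h" D''] by auto
  qed (auto split: if_splits)
qed

lemma rows_replicate_Horiz: "rows h (replicate k Horiz @ D) = rows (h + k) D"
  by (induction k arbitrary: h) auto

lemma rows_replicate_Vert: "rows h (replicate k Vert @ D) = replicate k h @ rows h D"
  by (induction k) auto

lemma count_list_replicate: "count_list (replicate k x) y = (if x = y then k else 0)"
  by (induction k) auto

lemma rows_exists:
  "sorted as \<Longrightarrow> (\<And>x. x \<in> set as \<Longrightarrow> h \<le> x \<and> x \<le> H) \<Longrightarrow> h \<le> H \<Longrightarrow> \<exists>D. rows h D = as \<and> h + count_list D Horiz = H"
proof (induction as arbitrary: h)
  case Nil
  then show ?case
    using rows_replicate_Horiz[of h "H - h" "[]"]
    by (intro exI[of _ "replicate (H - h) Horiz"]) (simp add: count_list_replicate)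
next
  case (Cons a as)
  have a: "h \<le> a" "a \<le> H" using Cons.prems(2)[of a] by auto
  have "\<exists>D. rows a D = as \<and> a + count_list D Horiz = H"
    using Cons.prems a by (intro Cons.IH) auto
  then obtain D where D: "rows a D = as" "a + count_list D Horiz = H" by auto
  then show ?case
    using a rows_replicate_Horiz[of h "a - h" "Vert # D"]
    by (intro exI[of _ "replicate (a - h) Horiz @ Vert # D"]) (simp add: count_list_replicate)
qed

text \<open>The list \<open>zs\<close> pairs the length of a vertical run with its horizontal
  position. Positions of different runs differ, because a horizontal step separates them.\<close>

lemma vertical_runs_rows:
  "\<exists>zs. map fst zs = vertical_runs D \<and> rows h D = concat (map (\<lambda>(k, x). replicate k x) zs) \<and>
     distinct (map snd zs) \<and> snd ` set zs = set (rows h D)"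
proof (induction D arbitrary: h rule: vertical_runs.induct)
  case 1
  then show ?case by (intro exI[of _ "[]"]) simp
next
  case (2 D)
  then show ?case by simp
next
  case (3 D)
  let ?k = "length (takeWhile (\<lambda>s. s = Vert) D)" and ?D' = "dropWhile (\<lambda>s. s = Vert) D"
  obtain zs where zs: "map fst zs = vertical_runs ?D'" "rows h ?D' = concat (map (\<lambda>(k, x). replicate k x) zs)"
    "distinct (map snd zs)" "snd ` set zs = set (rows h ?D')"
    using 3[of h] by auto
  have "takeWhile (\<lambda>s. s = Vert) D = replicate ?k Vert"
    by (rule replicate_length_same[symmetric]) (auto dest: set_takeWhileD)
  then have "D = replicate ?k Vert @ ?D'" by (metis takeWhile_dropWhile_id)
  then have rows: "rows h (Vert # D) = replicate (Suc ?k) h @ rows h ?D'"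
    by (metis rows_replicate_Vert append_Cons replicate_Suc)
  have "h \<notin> set (rows h ?D')"
  proof (cases ?D')
    case Nil
    then show ?thesis by (metis rows.simps(1) empty_iff list.set(1))
  next
    case (Cons s D'')
    then have "s = Horiz" using hd_dropWhile[of "\<lambda>s. s = Vert" D] by (cases s) auto
    then show ?thesis using Cons rows_bounds[of h "Suc h" D''] by auto
  qed
  then show ?case
    using zs rows by (intro exI[of _ "(Suc ?k, h) # zs"]) (auto simp: zs(4)[symmetric] simp del: replicate_Suc)
qed

section \<open>Young subgroups as stabilizers\<close>

definition block :: "nat list \<Rightarrow> nat \<Rightarrow> nat set" where
  "block lam j = {sum_list (take j lam)<..sum_list (take (Suc j) lam)}"

lemma block_cover:
  "i \<in> {1..sum_list lam} \<Longrightarrow> \<exists>j<length lam. i \<in> block lam j"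
proof (induction lam arbitrary: i)
  case (Cons a lam)
  show ?case
  proof (cases "i \<le> a")
    case True
    then show ?thesis using Cons.prems by (intro exI[of _ 0]) (auto simp: block_def)
  next
    case False
    then have "i - a \<in> {1..sum_list lam}" using Cons.prems by (auto simp: One_nat_def)
    then obtain j where "j < length lam" "i - a \<in> block lam j" using Cons.IH by blast
    then show ?thesis using False by (intro exI[of _ "Suc j"]) (auto simp: block_def)
  qed
qed auto

lemma block_subset: "j < length lam \<Longrightarrow> block lam j \<subseteq> {1..sum_list lam}"
proof -
  assume "j < length lam"
  have "sum_list lam = sum_list (take (Suc j) lam) + sum_list (drop (Suc j) lam)"
    by (metis append_take_drop_id sum_list_append)
  then show ?thesis by (auto simp: block_def)
qed

lemma nth_concat_replicate:
  "j < length zs \<Longrightarrow> i \<in> block (map fst zs) j \<Longrightarrow>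
    concat (map (\<lambda>(k, x). replicate k x) zs) ! (i - 1) = snd (zs ! j)"
proof (induction zs arbitrary: i j)
  case (Cons z zs)
  obtain k x where z: "z = (k, x)" by (cases z)
  show ?case
  proof (cases j)
    case 0
    then have "i - 1 < k" using Cons.prems by (auto simp: block_def z)
    then show ?thesis by (simp add: z 0 nth_append)
  next
    case (Suc j')
    then have "i - k \<in> block (map fst zs) j'" "i > k" using Cons.prems by (auto simp: block_def z)
    then show ?thesis using Cons.IH[of j' "i - k"] Cons.prems
      by (auto simp: z Suc nth_append add.commute)
  qed
qed simp

text \<open>\<open>b\<close> rearranges the row vector so that it is constant exactly on the blocks
  of the standard Young subgroup. Different blocks carry different values, so its stabilizer is this
  subgroup and nothing larger.\<close>

lemma dyck_filling:
  obtains b :: "nat \<Rightarrow> nat" where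
    "\<And>i. i \<notin> {1..count_list D Vert} \<Longrightarrow> b i = 0"
    "image_mset b (mset_set {1..count_list D Vert}) = mset (rows 0 D)"
    "young_subgroup (vertical_run_partition D) =
       {\<sigma>. \<sigma> permutes {1..count_list D Vert} \<and> (\<forall>i\<in>{1..count_list D Vert}. b (\<sigma> i) = b i)}"
proof -
  let ?N = "count_list D Vert"
  obtain zs0 where zs0: "map fst zs0 = vertical_runs D" "rows 0 D = concat (map (\<lambda>(k, x). replicate k x) zs0)"
    "distinct (map snd zs0)"
    using vertical_runs_rows[of D 0] by auto
  \<comment> \<open>Runs are ordered by decreasing length, carrying their positions along; the order
    of the positions is given up, only their distinctness is kept.\<close>
  define zs where "zs = rev (sort_key fst zs0)"
  define lam where "lam = vertical_run_partition D"
  have zs: "mset zs = mset zs0" by (simp add: zs_def)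
  have "sort (vertical_runs D) = map fst (sort_key fst zs0)"
    by (rule properties_for_sort) (simp_all flip: zs0(1))
  then have lam: "lam = map fst zs"
    by (simp add: lam_def vertical_run_partition_def zs_def rev_map)
  have dist: "distinct (map snd zs)"
    using zs0(3) zs by (metis mset_eq_imp_distinct_iff mset_map)
  define L where "L = concat (map (\<lambda>(k, x). replicate k x) zs)"
  have mL: "mset L = mset (rows 0 D)"
    unfolding L_def zs0(2) mset_concat using zs
    by (metis (no_types, lifting) mset_map sum_mset_sum_list)
  have len: "length L = ?N" using mL mset_eq_length length_rows by metis
  have lenL: "length L = sum_list lam"
    unfolding L_def lam by (simp add: length_concat comp_def case_prod_unfold)
  define b where "b i = (if i \<in> {1..?N} then L ! (i - 1) else 0)" for i
  have b_block: "b i = snd (zs ! j)" if "j < length lam" "i \<in> block lam j" for i j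
    using that nth_concat_replicate[of j zs i] block_subset[of j lam] len lenL
    by (auto simp: b_def L_def lam)
  have b_blockD: "i \<in> block lam j" if j: "j < length lam" and i: "i \<in> {1..?N}" and bi: "b i = snd (zs ! j)" for i j
  proof -
    obtain j' where j': "j' < length lam" "i \<in> block lam j'" using i block_cover[of i lam] len lenL by auto
    then have "map snd zs ! j' = map snd zs ! j" using j bi b_block by (simp add: lam)
    then have "j' = j" using dist j' j by (simp add: nth_eq_iff_index_eq lam del: nth_map)
    then show ?thesis using j' by simp
  qed
  have "image_mset b (mset_set {1..?N}) = mset L"
  proof -
    have "mset_set {1..?N} = mset (map Suc [0..<?N])"
      by (metis One_nat_def atLeastLessThanSuc_atLeastAtMost map_Suc_upt mset_upt)
    then have "image_mset b (mset_set {1..?N}) = mset (map (\<lambda>i. b (Suc i)) [0..<?N])"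
      by (simp add: image_mset.compositionality comp_def)
    also have "map (\<lambda>i. b (Suc i)) [0..<?N] = map ((!) L) [0..<length L]"
      unfolding len by (intro map_cong) (auto simp: b_def)
    finally show ?thesis by (simp add: map_nth)
  qed
  then have 2: "image_mset b (mset_set {1..?N}) = mset (rows 0 D)" by (simp add: mL)
  have 3: "young_subgroup lam = {\<sigma>. \<sigma> permutes {1..?N} \<and> (\<forall>i\<in>{1..?N}. b (\<sigma> i) = b i)}"
  proof (rule subset_antisym; rule subsetI)
    fix \<sigma> assume "\<sigma> \<in> young_subgroup lam"
    then have \<sigma>: "\<sigma> permutes {1..?N}" "\<And>j. j < length lam \<Longrightarrow> \<sigma> ` block lam j = block lam j"
      using len lenL by (auto simp: young_subgroup_def block_def)
    have "b (\<sigma> i) = b i" if iN: "i \<in> {1..?N}" for i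
    proof -
      obtain j where j: "j < length lam" "i \<in> block lam j" using iN block_cover[of i lam] len lenL by auto
      then have "\<sigma> i \<in> block lam j" using \<sigma>(2)[of j] by blast
      then show ?thesis using b_block j by simp
    qed
    then show "\<sigma> \<in> {\<sigma>. \<sigma> permutes {1..?N} \<and> (\<forall>i\<in>{1..?N}. b (\<sigma> i) = b i)}" using \<sigma> by simp
  next
    fix \<sigma> assume "\<sigma> \<in> {\<sigma>. \<sigma> permutes {1..?N} \<and> (\<forall>i\<in>{1..?N}. b (\<sigma> i) = b i)}"
    then have \<sigma>: "\<sigma> permutes {1..?N}" "\<And>i. i \<in> {1..?N} \<Longrightarrow> b (\<sigma> i) = b i" by auto
    have "\<sigma> ` block lam j = block lam j" if j: "j < length lam" for j
    proof (rule endo_inj_surj)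
      show "finite (block lam j)" by (simp add: block_def)
      show "inj_on \<sigma> (block lam j)" using permutes_inj[OF \<sigma>(1)] by (rule inj_on_subset) simp
      show "\<sigma> ` block lam j \<subseteq> block lam j"
      proof (rule image_subsetI)
        fix i assume i: "i \<in> block lam j"
        then have iN: "i \<in> {1..?N}" using block_subset[OF j] len lenL by auto
        then have "\<sigma> i \<in> {1..?N}" using permutes_in_image[OF \<sigma>(1)] by blast
        then show "\<sigma> i \<in> block lam j"
          using \<sigma>(2)[OF iN] b_block[OF j i] b_blockD[OF j] by simp
      qed
    qed
    then show "\<sigma> \<in> young_subgroup lam"
      using \<sigma>(1) len lenL by (simp add: young_subgroup_def block_def)
  qed
  show ?thesis by (rule that[of b]) (use 2 3 in \<open>auto simp: b_def lam_def\<close>)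
qed

text \<open>The allowance \<open>l + m * (n - card I)\<close> depends on the size of
  \<open>I\<close> alone, so among sets of one size the hardest consists of the largest values.
  Testing these sets is the inequality for the sorted list.\<close>

lemma parking_complete_iff_sorted:
  assumes l: "l \<ge> 1" and f: "keys f \<subseteq> {1..n}" and as: "sorted as"
    "image_mset (lookup f) (mset_set {1..n}) = mset as"
  shows "parking (complete_multigraph l m n) {1..n} f \<longleftrightarrow> (\<forall>j<n. as ! j \<le> l - 1 + m * j)"
proof -
  have len: "length as = n" using as(2) by (metis card_atLeastAtMost diff_Suc_1 size_image_mset size_mset size_mset_set)
  define s where "s i = as ! (i - 1)" for i
  have "image_mset s (mset_set {1..n}) = mset as"
  proof -
    have "mset_set {1..n} = mset (map Suc [0..<n])"
      by (metis One_nat_def atLeastLessThanSuc_atLeastAtMost map_Suc_upt mset_upt)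
    then have "image_mset s (mset_set {1..n}) = mset (map ((!) as) [0..<length as])"
      by (simp add: image_mset.compositionality comp_def s_def len)
    then show ?thesis by (simp add: map_nth)
  qed
  then have eq: "image_mset (lookup f) (mset_set {1..n}) = image_mset s (mset_set {1..n})"
    using as(2) by simp
  obtain g where g: "g permutes {1..n}" and g': "\<forall>i\<in>{1..n}. lookup f i = s (g i)"
    by (rule image_mset_eq_implies_permutes[OF finite_atLeastAtMost eq])
  have gin: "g i \<in> {1..n} \<longleftrightarrow> i \<in> {1..n}" for i by (rule permutes_in_image[OF g])
  show ?thesis
  proof
    assume park: "parking (complete_multigraph l m n) {1..n} f"
    show "\<forall>j<n. as ! j \<le> l - 1 + m * j"
    proof (intro allI impI)
      fix j assume j: "j < n"
      \<comment> \<open>\<open>g i\<close> is the rank of \<open>i\<close> in the sorted order, so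
        these are the positions of the \<open>n - j\<close> largest values, the least of which is
        \<open>as ! j\<close>.\<close>
      define I where "I = inv' g ` {j + 1..n}"
      have gI: "g ` I = {j + 1..n}"
        unfolding I_def by (simp add: image_image permutes_inverses[OF g])
      have sub: "I \<subseteq> {1..n}"
      proof
        fix i assume "i \<in> I"
        then have "g i \<in> {j + 1..n}" using gI by blast
        then show "i \<in> {1..n}" using gin[of i] by auto
      qed
      have "card I = card {j + 1..n}"
        unfolding I_def by (rule card_image) (rule inj_on_subset[OF permutes_inj[OF permutes_inv[OF g]]], simp)
      then have card: "card I = n - j" by simp
      have "I \<noteq> {}" using card j by auto
      then obtain i where i: "i \<in> I" "lookup f i < out_degree (complete_multigraph l m n) I i"
        using park sub unfolding parking_def by blast
      then have "s (g i) < l + m * j"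
        using sub g' out_degree_complete_multigraph[OF sub i(1)] card j by auto
      moreover have "g i \<in> {j + 1..n}" using i gI by blast
      then have "as ! j \<le> s (g i)"
        unfolding s_def using sorted_nth_mono[OF as(1), of j "g i - 1"] len by auto
      ultimately show "as ! j \<le> l - 1 + m * j" by simp
    qed
  next
    assume bound: "\<forall>j<n. as ! j \<le> l - 1 + m * j"
    show "parking (complete_multigraph l m n) {1..n} f"
      unfolding parking_def
    proof (intro conjI f allI impI)
      fix I assume I: "I \<subseteq> {1..n}" "I \<noteq> {}"
      have fin: "finite I" using I finite_subset by blast
      have card: "1 \<le> card I" "card I \<le> n"
        using I fin card_gt_0_iff[of I] card_mono[OF _ I(1)] by auto
      \<comment> \<open>Pigeonhole: only \<open>card I - 1\<close> ranks lie above this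
        bound.\<close>
      have "\<exists>i\<in>I. g i \<le> n - card I + 1"
      proof (rule ccontr)
        assume *: "\<not> (\<exists>i\<in>I. g i \<le> n - card I + 1)"
        have "g ` I \<subseteq> {n - card I + 2..n}"
        proof (rule image_subsetI)
          fix i assume i: "i \<in> I"
          then have "g i \<in> {1..n}" using gin I by blast
          moreover have "\<not> g i \<le> n - card I + 1" using * i by blast
          ultimately show "g i \<in> {n - card I + 2..n}" by auto
        qed
        then have "card (g ` I) \<le> card {n - card I + 2..n}" by (intro card_mono) auto
        moreover have "card (g ` I) = card I"
          by (rule card_image) (rule inj_on_subset[OF permutes_inj[OF g]], simp)
        ultimately show False using card by simp
      qed
      then obtain i where i: "i \<in> I" "g i \<le> n - card I + 1" by auto
      have gi: "g i \<in> {1..n}" using gin i I by blast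
      have "s (g i) \<le> l - 1 + m * (g i - 1)"
        using bound gi by (auto simp: s_def)
      also have "\<dots> \<le> l - 1 + m * (n - card I)" using i by (intro add_left_mono mult_left_mono) auto
      also have "\<dots> < l + m * (n - card I)" using l by simp
      finally show "\<exists>i\<in>I. lookup f i < out_degree (complete_multigraph l m n) I i"
        using i(1) I g' out_degree_complete_multigraph[OF I(1) i(1)] by (intro bexI[of _ i]) auto
    qed
  qed
qed

lemma monom_degree_eq_sum_mset:
  assumes "keys f \<subseteq> {1..n}" "image_mset (lookup f) (mset_set {1..n}) = mset as"
  shows "monom_degree f = sum_list as"
proof -
  have "monom_degree f = (\<Sum>i\<in>{1..n}. lookup f i)" using assms by (intro monom_degree_superset) auto
  also have "\<dots> = sum_mset (image_mset (lookup f) (mset_set {1..n}))" by (simp add: sum_unfold_sum_mset)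
  finally show ?thesis by (simp add: assms(2) sum_mset_sum_list)
qed

section \<open>Rearrangements of exponent vectors and the path components\<close>

lemma lookup_map_key_permutes:
  "g permutes A \<Longrightarrow> lookup (map_key g t) i = lookup t (g i)"
  by (simp add: map_key.rep_eq permutes_inj)

lemma keys_map_key_permutes:
  assumes "g permutes A" "keys t \<subseteq> A"
  shows "keys (map_key g t) \<subseteq> A"
proof
  fix i assume "i \<in> keys (map_key g t)"
  then have "g i \<in> keys t" by (simp add: in_keys_iff lookup_map_key_permutes[OF assms(1)])
  then show "i \<in> A" using assms permutes_in_image[OF assms(1)] by blast
qed

lemma image_mset_map_key_permutes:
  assumes "g permutes A"
  shows "image_mset (lookup (map_key g t)) (mset_set A) = image_mset (lookup t) (mset_set A)"
proof -
  have "image_mset (lookup (map_key g t)) (mset_set A) =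
    image_mset (lookup t) (image_mset g (mset_set A))"
    by (auto simp: image_mset.compositionality lookup_map_key_permutes[OF assms] intro!: image_mset_cong)
  also have "image_mset g (mset_set A) = mset_set A"
    using permutes_inj_on[OF assms] permutes_image[OF assms] by (simp add: image_mset_mset_set)
  finally show ?thesis .
qed

text \<open>A base point in the orbit of parking functions belonging to the path, chosen so that its
  stabilizer is the standard Young subgroup and not just a conjugate.\<close>

definition dyck_monom :: "step list \<Rightarrow> nat \<Rightarrow>\<^sub>0 nat" where
  "dyck_monom D = (SOME B. keys B \<subseteq> {1..count_list D Vert} \<and>
     image_mset (lookup B) (mset_set {1..count_list D Vert}) = mset (rows 0 D) \<and>
     young_subgroup (vertical_run_partition D) =
       {\<sigma>. \<sigma> permutes {1..count_list D Vert} \<and>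
            (\<forall>i\<in>{1..count_list D Vert}. lookup B (\<sigma> i) = lookup B i)})"

lemma dyck_monom_spec:
  "keys (dyck_monom D) \<subseteq> {1..count_list D Vert} \<and>
     image_mset (lookup (dyck_monom D)) (mset_set {1..count_list D Vert}) = mset (rows 0 D) \<and>
     young_subgroup (vertical_run_partition D) =
       {\<sigma>. \<sigma> permutes {1..count_list D Vert} \<and>
            (\<forall>i\<in>{1..count_list D Vert}. lookup (dyck_monom D) (\<sigma> i) = lookup (dyck_monom D) i)}"
  unfolding dyck_monom_def
proof (rule someI_ex, rule dyck_filling[of D])
  fix b :: "nat \<Rightarrow> nat"
  assume b: "\<And>i. i \<notin> {1..count_list D Vert} \<Longrightarrow> b i = 0"
    "image_mset b (mset_set {1..count_list D Vert}) = mset (rows 0 D)"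
    "young_subgroup (vertical_run_partition D) =
       {\<sigma>. \<sigma> permutes {1..count_list D Vert} \<and> (\<forall>i\<in>{1..count_list D Vert}. b (\<sigma> i) = b i)}"
  have "{i. b i \<noteq> 0} \<subseteq> {1..count_list D Vert}"
    by (rule subsetI, rule ccontr) (simp add: b(1) del: atLeastAtMost_iff)
  then have "finite {i. b i \<noteq> 0}" by (rule finite_subset) simp
  then have B: "lookup (Abs_poly_mapping b) = b" by simp
  have "keys (Abs_poly_mapping b) \<subseteq> {1..count_list D Vert}"
  proof
    fix i assume "i \<in> keys (Abs_poly_mapping b)"
    then have "b i \<noteq> 0" unfolding in_keys_iff B .
    then show "i \<in> {1..count_list D Vert}" by (rule contrapos_np) (rule b(1))
  qed
  then show "\<exists>B. keys B \<subseteq> {1..count_list D Vert} \<and>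
     image_mset (lookup B) (mset_set {1..count_list D Vert}) = mset (rows 0 D) \<and>
     young_subgroup (vertical_run_partition D) =
       {\<sigma>. \<sigma> permutes {1..count_list D Vert} \<and>
            (\<forall>i\<in>{1..count_list D Vert}. lookup B (\<sigma> i) = lookup B i)}"
    using b(2,3) by (intro exI[of _ "Abs_poly_mapping b"]) (simp add: B)
qed

lemma finite_dyck_paths: "finite {D. dyck_path l m n D}"
proof -
  have "set D \<subseteq> {Vert, Horiz}" for D by (metis insertCI step.exhaust subsetI)
  moreover have "length D = count_list D Vert + count_list D Horiz" for D
    by (induction D) (use step.exhaust in auto)
  moreover have "count_list D Vert = n \<and> count_list D Horiz = nat (int (m * n) + int l - 1)" if "dyck_path l m n D" for D
    using that by (auto simp: dyck_path_def path_point_def)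
  ultimately have "{D. dyck_path l m n D} \<subseteq> {D. set D \<subseteq> {Vert, Horiz} \<and> length D = n + nat (int (m * n) + int l - 1)}"
    by auto
  then show ?thesis by (rule finite_subset) (rule finite_lists_length_eq, simp)
qed

context
  fixes l m n k :: nat
  assumes lm: "l \<ge> 1" "m \<ge> 1"
begin

private abbreviation (input) "paths \<equiv> {D. dyck_path l m n D \<and> area l D = k}"

lemma dyck_monom_props:
  assumes "D \<in> paths"
  shows "keys (dyck_monom D) \<subseteq> {1..n}"
    and "image_mset (lookup (dyck_monom D)) (mset_set {1..n}) = mset (rows 0 D)"
    and "young_subgroup (vertical_run_partition D) =
       {\<sigma>. \<sigma> permutes {1..n} \<and> (\<forall>i\<in>{1..n}. lookup (dyck_monom D) (\<sigma> i) = lookup (dyck_monom D) i)}"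
proof -
  have "count_list D Vert = n" using assms dyck_path_iff[OF lm] by simp
  then show "keys (dyck_monom D) \<subseteq> {1..n}"
    "image_mset (lookup (dyck_monom D)) (mset_set {1..n}) = mset (rows 0 D)"
    "young_subgroup (vertical_run_partition D) =
       {\<sigma>. \<sigma> permutes {1..n} \<and> (\<forall>i\<in>{1..n}. lookup (dyck_monom D) (\<sigma> i) = lookup (dyck_monom D) i)}"
    using dyck_monom_spec[of D] by auto
qed

lemma dyck_monom_parking:
  assumes D: "D \<in> paths" and g: "g permutes {1..n}"
  shows "map_key g (dyck_monom D) \<in> parking_degree l m n k"
proof -
  let ?f = "map_key g (dyck_monom D)"
  have f: "keys ?f \<subseteq> {1..n}"
    "image_mset (lookup ?f) (mset_set {1..n}) = mset (rows 0 D)"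
    using keys_map_key_permutes[OF g, of "dyck_monom D"] image_mset_map_key_permutes[OF g, of "dyck_monom D"]
      dyck_monom_props[OF D] by simp_all
  have "parking (complete_multigraph l m n) {1..n} ?f"
    using parking_complete_iff_sorted[OF lm(1) f(1) sorted_rows f(2), of m] D dyck_path_iff[OF lm] by simp
  moreover have "monom_degree ?f = k"
    using monom_degree_eq_sum_mset[OF f] D by (simp add: area_eq_sum_rows)
  ultimately show ?thesis by (simp add: parking_degree_def)
qed

lemma parking_dyck_monom:
  assumes f: "f \<in> parking_degree l m n k"
  obtains D g where "D \<in> paths" "g permutes {1..n}" "f = map_key g (dyck_monom D)"
proof -
  have keys: "keys f \<subseteq> {1..n}" and park: "parking (complete_multigraph l m n) {1..n} f"
    and deg: "monom_degree f = k"
    using f by (auto simp: parking_degree_def parking_def)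
  define as where "as = sorted_list_of_multiset (image_mset (lookup f) (mset_set {1..n}))"
  have as: "sorted as" "image_mset (lookup f) (mset_set {1..n}) = mset as"
    by (simp_all add: as_def)
  have bound: "\<forall>j<n. as ! j \<le> l - 1 + m * j"
    using parking_complete_iff_sorted[OF lm(1) keys as, of m] park by simp
  have len: "length as = n" using as(2) by (metis card_atLeastAtMost diff_Suc_1 size_image_mset size_mset size_mset_set)
  have "x \<le> l - 1 + m * n" if x: "x \<in> set as" for x
  proof -
    obtain j where j: "j < n" "x = as ! j" using x len by (metis in_set_conv_nth)
    then have "x \<le> l - 1 + m * j" using bound by simp
    also have "\<dots> \<le> l - 1 + m * n" using j by simp
    finally show ?thesis .
  qed
  then obtain D where D: "rows 0 D = as" "count_list D Horiz = l - 1 + m * n"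
    using rows_exists[OF as(1), of 0 "l - 1 + m * n"] by auto
  then have "D \<in> paths"
    using bound len length_rows[of 0 D] monom_degree_eq_sum_mset[OF keys as(2)] deg
    by (auto simp: dyck_path_iff[OF lm] area_eq_sum_rows)
  note props = dyck_monom_props[OF this]
  have eq: "image_mset (lookup f) (mset_set {1..n}) = image_mset (lookup (dyck_monom D)) (mset_set {1..n})"
    using as(2) props(2) D(1) by simp
  obtain g where g: "g permutes {1..n}" "\<forall>i\<in>{1..n}. lookup f i = lookup (dyck_monom D) (g i)"
    by (rule image_mset_eq_implies_permutes[OF finite_atLeastAtMost eq])
  have "f = map_key g (dyck_monom D)"
  proof (rule poly_mapping_eqI)
    fix i
    show "lookup f i = lookup (map_key g (dyck_monom D)) i"
    proof (cases "i \<in> {1..n}")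
      case True
      then show ?thesis using g by (simp add: lookup_map_key_permutes)
    next
      case False
      then have "i \<notin> keys f" "i \<notin> keys (map_key g (dyck_monom D))"
        using keys keys_map_key_permutes[OF g(1) props(1)] by auto
      then show ?thesis by (simp add: not_in_keys_iff_lookup_eq_zero)
    qed
  qed
  then show ?thesis using that \<open>D \<in> paths\<close> g(1) by blast
qed

text \<open>The multiset of exponents determines the rows and hence the path;
  \<open>g' \<circ> inv' g\<close> stabilizes the base point. Parking functions of degree
  \<open>k\<close> are thus pairs of a path and a coset \<open>H g\<close> of its Young subgroup
  \<open>H\<close>, which matches the invariance \<open>f (h g) = f g\<close> in the induced
  module.\<close>

lemma dyck_monom_eqD:
  assumes D: "D \<in> paths" "D' \<in> paths" and g: "g permutes {1..n}" "g' permutes {1..n}"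
    and eq: "map_key g (dyck_monom D) = map_key g' (dyck_monom D')"
  shows "D = D' \<and> (\<exists>h\<in>young_subgroup (vertical_run_partition D). g' = h \<circ> g)"
proof -
  have "mset (rows 0 D) = mset (rows 0 D')"
    using image_mset_map_key_permutes[OF g(1), of "dyck_monom D"] image_mset_map_key_permutes[OF g(2), of "dyck_monom D'"]
      dyck_monom_props(2)[OF D(1)] dyck_monom_props(2)[OF D(2)] eq by simp
  then have "rows 0 D = rows 0 D'" using sorted_rows by (metis properties_for_sort)
  then have DD: "D = D'" using D by (auto intro!: rows_inject simp: dyck_path_iff[OF lm])
  define h where "h = g' \<circ> inv' g"
  have h: "h permutes {1..n}" unfolding h_def using g by (intro permutes_compose permutes_inv)
  have "lookup (dyck_monom D) (h i) = lookup (dyck_monom D) i" for i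
  proof -
    have "lookup (dyck_monom D) (g (inv' g i)) = lookup (dyck_monom D) (g' (inv' g i))"
      using eq lookup_map_key_permutes[OF g(1), of "dyck_monom D" "inv' g i"] lookup_map_key_permutes[OF g(2), of "dyck_monom D" "inv' g i"]
      by (simp add: DD)
    then show ?thesis by (simp add: h_def permutes_inverses[OF g(1)])
  qed
  then have "h \<in> young_subgroup (vertical_run_partition D)"
    using h dyck_monom_props(3)[OF D(1)] by simp
  moreover have "g' = h \<circ> g" by (simp add: h_def fun_eq_iff permutes_inverses[OF g(1)])
  ultimately show ?thesis using DD by blast
qed

lemma young_subgroup_subset:
  assumes "D \<in> paths"
  shows "young_subgroup (vertical_run_partition D) \<subseteq> carrier (sym_group n)"
  using dyck_monom_props(3)[OF assms] by (auto simp: sym_group_carrier)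

lemma map_key_young:
  assumes D: "D \<in> paths" and h: "h \<in> young_subgroup (vertical_run_partition D)" and g: "g permutes {1..n}"
  shows "map_key (h \<circ> g) (dyck_monom D) = map_key g (dyck_monom D)"
proof (rule poly_mapping_eqI)
  fix i
  have "h permutes {1..n} \<and> (\<forall>i\<in>{1..n}. lookup (dyck_monom D) (h i) = lookup (dyck_monom D) i)"
    using h unfolding dyck_monom_props(3)[OF D] by (rule CollectD)
  then have h': "h permutes {1..n}" "\<And>i. i \<in> {1..n} \<Longrightarrow> lookup (dyck_monom D) (h i) = lookup (dyck_monom D) i"
    by blast+
  have "lookup (dyck_monom D) (h (g i)) = lookup (dyck_monom D) (g i)"
  proof (cases "g i \<in> {1..n}")
    case False
    then show ?thesis using h'(1) by (simp add: permutes_not_in)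
  qed (rule h'(2))
  then show "lookup (map_key (h \<circ> g) (dyck_monom D)) i =
    lookup (map_key g (dyck_monom D)) i"
    using permutes_compose[OF g h'(1)] g by (simp add: lookup_map_key_permutes)
qed

theorem slim_component_dyck:
  "rep_iso (sym_group n) (slim_rep l m n k)
     (direct_sum_rep paths (\<lambda>D. young_module n (vertical_run_partition D)))"
proof -
  let ?S = "direct_sum_rep paths (\<lambda>D. young_module n (vertical_run_partition D))"
  \<comment> \<open>The coefficient map, with the parking functions written as base point and
    rearrangement.\<close>
  define \<phi> where "\<phi> p = (\<lambda>D. if D \<in> paths then (\<lambda>g. if g \<in> carrier (sym_group n)
      then lookup p (map_key g (dyck_monom D)) else 0) else 0)" for p :: cpoly
  have R: "is_rep (sym_group n) (slim_rep l m n k)" by (rule is_rep_slim_rep) simp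
  have S: "is_rep (sym_group n) ?S"
  proof (rule is_rep_direct_sum)
    show "vector_space (rep_scale (young_module n (vertical_run_partition D)))" for D
      by (simp add: young_module_def induced_rep_def char_rep_def vector_space_function)
    show "is_rep (sym_group n) (young_module n (vertical_run_partition D))" if "D \<in> paths" for D
      unfolding young_module_def by (rule is_rep_induced_char[OF sym_group_is_group young_subgroup_subset[OF that]])
  qed
  have fin: "finite paths" by (rule finite_subset[OF _ finite_dyck_paths]) auto
  have mem_S: "T \<in> rep_space ?S \<longleftrightarrow> (\<forall>D\<in>paths. (\<forall>g. g \<notin> carrier (sym_group n) \<longrightarrow> T D g = 0) \<and>
      (\<forall>h\<in>young_subgroup (vertical_run_partition D). \<forall>g\<in>carrier (sym_group n). T D (h \<circ> g) = T D g)) \<and>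
      (\<forall>D. D \<notin> paths \<longrightarrow> T D = 0)" for T
  proof -
    have "finite {D. T D \<noteq> 0}" if "\<forall>D. D \<notin> paths \<longrightarrow> T D = 0"
      by (rule finite_subset[OF _ fin]) (use that in blast)
    then show ?thesis
      by (auto simp: direct_sum_rep_def young_module_def induced_rep_def char_rep_def sym_group_mult)
  qed
  have \<phi>_eq: "\<phi> p D g = lookup p (map_key g (dyck_monom D))"
    if "D \<in> paths" "g permutes {1..n}" for p D g
    using that by (simp add: \<phi>_def sym_group_carrier)
  have "bij_betw \<phi> (rep_space (slim_rep l m n k)) (rep_space ?S)"
    unfolding bij_betw_def
  proof (intro conjI inj_onI subset_antisym subsetI)
    fix p q assume *: "p \<in> rep_space (slim_rep l m n k)" "q \<in> rep_space (slim_rep l m n k)" "\<phi> p = \<phi> q"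
    have "p - q \<in> slim_component l m n k"
      using * cpoly.subspace_diff[OF subspace_slim_component] by (simp add: slim_rep_def)
    moreover have "lookup (p - q) f = 0" if "f \<in> parking_degree l m n k" for f
    proof -
      obtain D g where Dg: "D \<in> paths" "g permutes {1..n}" "f = map_key g (dyck_monom D)"
        using parking_dyck_monom[OF \<open>f \<in> parking_degree l m n k\<close>] by metis
      then show ?thesis using \<phi>_eq[OF Dg(1,2), of p] \<phi>_eq[OF Dg(1,2), of q] *(3) by (simp add: lookup_minus)
    qed
    ultimately have "p - q = 0" by (rule slim_component_eq_0I)
    then show "p = q" by simp
  next
    fix T assume "T \<in> \<phi> ` rep_space (slim_rep l m n k)"
    then obtain p where T: "T = \<phi> p" by auto
    show "T \<in> rep_space ?S"
      unfolding mem_S T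
    proof (intro conjI ballI allI impI)
      fix D assume D: "D \<in> paths"
      show "\<phi> p D g = 0" if "g \<notin> carrier (sym_group n)" for g using that by (simp add: \<phi>_def)
      fix h g assume h: "h \<in> young_subgroup (vertical_run_partition D)" and g: "g \<in> carrier (sym_group n)"
      have "h permutes {1..n}" "g permutes {1..n}"
        using young_subgroup_subset[OF D] h g by (auto simp: sym_group_carrier)
      then show "\<phi> p D (h \<circ> g) = \<phi> p D g"
        using \<phi>_eq[OF D] map_key_young[OF D h] by (simp add: permutes_compose)
    next
      show "\<phi> p D = 0" if "D \<notin> paths" for D
        unfolding \<phi>_def using that by (simp only: if_False)
    qed
  next
    fix T assume T: "T \<in> rep_space ?S"
    \<comment> \<open>Several \<open>g\<close> give the same parking function; they differ by the
      Young subgroup, under which \<open>T D\<close> is invariant, so the choice does not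
      matter.\<close>
    define F where "F f = (let (D, g) = SOME (D, g). D \<in> paths \<and> g permutes {1..n} \<and> f = map_key g (dyck_monom D) in T D g)" for f
    have F: "F (map_key g (dyck_monom D)) = T D g" if D: "D \<in> paths" and g: "g permutes {1..n}" for D g
    proof -
      let ?P = "\<lambda>(D', g'). D' \<in> paths \<and> g' permutes {1..n} \<and> map_key g (dyck_monom D) = map_key g' (dyck_monom D')"
      obtain D' g' where eq: "(SOME x. ?P x) = (D', g')" by (cases "SOME x. ?P x")
      have "?P (SOME x. ?P x)" by (rule someI[of ?P "(D, g)"]) (use D g in simp)
      then have P: "D' \<in> paths" "g' permutes {1..n}" "map_key g (dyck_monom D) = map_key g' (dyck_monom D')"
        unfolding eq by auto
      obtain h where h: "D = D'" "h \<in> young_subgroup (vertical_run_partition D)" "g' = h \<circ> g"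
        using dyck_monom_eqD[OF D P(1) g P(2,3)] by auto
      have "g \<in> carrier (sym_group n)" using g by (simp add: sym_group_carrier)
      then have "T D (h \<circ> g) = T D g"
        using T D h(2) unfolding mem_S by blast
      then show ?thesis unfolding F_def eq Let_def using h by simp
    qed
    obtain p where p: "p \<in> slim_component l m n k" "\<And>f. f \<in> parking_degree l m n k \<Longrightarrow> lookup p f = F f"
      using slim_component_prescribed_coeffs[of l m n k F] by blast
    have "\<phi> p = T"
    proof (rule ext, rule ext)
      fix D g
      show "\<phi> p D g = T D g"
      proof (cases "D \<in> paths \<and> g permutes {1..n}")
        case True
        then show ?thesis using \<phi>_eq p(2)[OF dyck_monom_parking] F by simp
      next
        case False
        then show ?thesis using T unfolding mem_S by (auto simp: \<phi>_def sym_group_carrier)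
      qed
    qed
    then show "T \<in> \<phi> ` rep_space (slim_rep l m n k)" using p(1) by (auto simp: slim_rep_def)
  qed
  moreover have "\<phi> (p + q) = \<phi> p + \<phi> q" for p q
    by (auto simp: \<phi>_def fun_eq_iff lookup_add)
  moreover have "\<phi> (rep_scale (slim_rep l m n k) c p) = rep_scale ?S c (\<phi> p)" for c p
    by (auto simp: \<phi>_def fun_eq_iff slim_rep_def lookup_pscale direct_sum_rep_def young_module_def induced_rep_def char_rep_def)
  moreover have "\<phi> (rep_act (slim_rep l m n k) x p) = rep_act ?S x (\<phi> p)" if x: "x \<in> carrier (sym_group n)" for x p
  proof (rule ext, rule ext)
    fix D g
    have xp: "x permutes {1..n}" using x by (simp add: sym_group_carrier)
    show "\<phi> (rep_act (slim_rep l m n k) x p) D g = rep_act ?S x (\<phi> p) D g"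
    proof (cases "D \<in> paths \<and> g permutes {1..n}")
      case True
      then have g: "g permutes {1..n}" by simp
      \<comment> \<open>Here the substitution of variables becomes right translation by
        \<open>x\<close>.\<close>
      have "map_key x (map_key g (dyck_monom D)) = map_key (g \<circ> x) (dyck_monom D)"
        by (rule poly_mapping_eqI) (simp add: lookup_map_key_permutes[OF xp] lookup_map_key_permutes[OF g]
            lookup_map_key_permutes[OF permutes_compose[OF xp g]])
      then show ?thesis
        using True \<phi>_eq[of D g] \<phi>_eq[of D "g \<circ> x" p] permutes_compose[OF xp g]
        by (simp add: slim_rep_def direct_sum_rep_def young_module_def induced_rep_def sym_group_carrier
            sym_group_mult lookup_permute_vars[OF permutes_bij[OF xp]])
    next
      case False
      then show ?thesis
        by (auto simp: \<phi>_def direct_sum_rep_def young_module_def induced_rep_def sym_group_carrier)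
    qed
  qed
  ultimately show ?thesis
    unfolding rep_iso_def using R S by blast
qed

end


section \<open>Word products and shuffles\<close>

text \<open>The \<open>P_w\<close> of the overview.\<close>

fun word_prod :: "(nat \<Rightarrow> 'f::field) \<Rightarrow> nat list \<Rightarrow> 'f" where
  "word_prod x (a # b # w) = word_prod x (b # w) / (x a - x b)"
| "word_prod x w = 1"

lemma sum_shuffles_Cons:
  fixes f :: "'a list \<Rightarrow> 'b::comm_monoid_add"
  assumes "a \<noteq> b"
  shows "(\<Sum>w\<in>shuffles (a # u) (b # v). f w) =
    (\<Sum>w\<in>shuffles u (b # v). f (a # w)) + (\<Sum>w\<in>shuffles (a # u) v. f (b # w))"
proof -
  have "(#) a ` shuffles u (b # v) \<inter> (#) b ` shuffles (a # u) v = {}" using assms by auto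
  then show ?thesis by (simp add: sum.union_disjoint sum.reindex)
qed

text \<open>Splitting the shuffles by their first letter and applying the hypothesis to each half
  leaves the partial fraction identity
  \<open>1/((r-a)(a-b)) + 1/((r-b)(b-a)) = 1/((r-a)(r-b))\<close>, the letters standing for their
  values.\<close>

lemma word_prod_shuffle:
  assumes "inj_on x (insert r (set u \<union> set v))" "distinct (r # u @ v)"
  shows "(\<Sum>w\<in>shuffles u v. word_prod x (r # w)) = word_prod x (r # u) * word_prod x (r # v)"
  using assms
proof (induction u v arbitrary: r rule: shuffles.induct)
  case (3 a u b v)
  have ne: "x r - x a \<noteq> 0" "x r - x b \<noteq> 0" "x a - x b \<noteq> 0"
    using 3(3,4) by (auto simp: inj_on_def)
  have "(\<Sum>w\<in>shuffles u (b # v). word_prod x (a # w)) = word_prod x (a # u) * word_prod x (a # b # v)"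
    using 3(3,4) by (intro 3(1)) (auto simp: inj_on_def)
  moreover have "(\<Sum>w\<in>shuffles (a # u) v. word_prod x (b # w)) = word_prod x (b # a # u) * word_prod x (b # v)"
    using 3(3,4) by (intro 3(2)) (auto simp: inj_on_def)
  ultimately have "(\<Sum>w\<in>shuffles (a # u) (b # v). word_prod x (r # w)) =
      word_prod x (a # u) * word_prod x (a # b # v) / (x r - x a) +
      word_prod x (b # a # u) * word_prod x (b # v) / (x r - x b)"
  proof -
    have "a \<noteq> b" using 3(4) by auto
    from sum_shuffles_Cons[OF this, of "\<lambda>w. word_prod x (r # w)" u v] show ?thesis
      using \<open>(\<Sum>w\<in>shuffles u (b # v). word_prod x (a # w)) = _\<close>
        \<open>(\<Sum>w\<in>shuffles (a # u) v. word_prod x (b # w)) = _\<close>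
      by (simp del: shuffles.simps flip: sum_divide_distrib)
  qed
  also have "\<dots> = word_prod x (a # u) * word_prod x (b # v) *
      (1 / ((x r - x a) * (x a - x b)) + 1 / ((x r - x b) * (x b - x a)))"
    using ne by (simp add: field_simps)
  also have "1 / ((x r - x a) * (x a - x b)) + 1 / ((x r - x b) * (x b - x a)) = 1 / ((x r - x a) * (x r - x b))"
  proof -
    have "x b - x a \<noteq> 0" using ne by auto
    then show ?thesis using ne by (simp add: divide_simps) (simp add: algebra_simps)
  qed
  finally show ?case by simp
qed simp_all

text \<open>Without a common first letter the shuffles starting with \<open>a\<close> and those
  starting with \<open>b\<close> sum to the same product times \<open>1/(a-b)\<close> and
  \<open>1/(b-a)\<close>, and cancel.\<close>

lemma word_prod_shuffle_0:
  assumes "inj_on x (set u \<union> set v)" "distinct (u @ v)" "u \<noteq> []" "v \<noteq> []"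
  shows "(\<Sum>w\<in>shuffles u v. word_prod x w) = 0"
proof -
  obtain a u' b v' where uv: "u = a # u'" "v = b # v'" using assms by (cases u; cases v) auto
  have ne: "x a - x b \<noteq> 0" using assms uv by (auto simp: inj_on_def)
  have "(\<Sum>w\<in>shuffles u v. word_prod x w) =
      word_prod x (a # u') * word_prod x (a # b # v') + word_prod x (b # a # u') * word_prod x (b # v')"
  proof -
    have "a \<noteq> b" using assms(2) uv by auto
    moreover have "(\<Sum>w\<in>shuffles u' (b # v'). word_prod x (a # w)) = word_prod x (a # u') * word_prod x (a # b # v')"
      using assms uv by (intro word_prod_shuffle) auto
    moreover have "(\<Sum>w\<in>shuffles (a # u') v'. word_prod x (b # w)) = word_prod x (b # a # u') * word_prod x (b # v')"
      using assms uv by (intro word_prod_shuffle) (auto simp: insert_commute)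
    ultimately show ?thesis
      unfolding uv sum_shuffles_Cons[OF \<open>a \<noteq> b\<close>, of "word_prod x"] by simp
  qed
  also have "\<dots> = 0"
    using ne by (simp add: divide_simps) (simp add: algebra_simps)
  finally show ?thesis .
qed

text \<open>The filter makes the relation visibly depend only on the subword formed by the two
  letters, so it can be tested in any subword that contains both.\<close>

definition before :: "nat list \<Rightarrow> nat \<Rightarrow> nat \<Rightarrow> bool" where
  "before w i j \<longleftrightarrow> filter (\<lambda>z. z = i \<or> z = j) w = [i, j]"

lemma before_map_permutation:
  assumes "\<sigma> permutes {1..N}" "i \<in> {1..N}" "j \<in> {1..N}" "i \<noteq> j"
  shows "before (map \<sigma> [1..<N + 1]) i j \<longleftrightarrow> inv' \<sigma> i < inv' \<sigma> j"
proof -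
  let ?a = "inv' \<sigma> i" and ?b = "inv' \<sigma> j"
  note inv = permutes_inverses[OF assms(1)]
  have ab: "?a \<in> {1..N}" "?b \<in> {1..N}" "?a \<noteq> ?b"
    using permutes_in_image[OF permutes_inv[OF assms(1)]] assms inv by (metis (no_types, lifting))+
  have "(\<sigma> k = i \<or> \<sigma> k = j) \<longleftrightarrow> (k = ?a \<or> k = ?b)" for k using inv by auto
  then have "filter (\<lambda>z. z = i \<or> z = j) (map \<sigma> [1..<N + 1]) = map \<sigma> (filter (\<lambda>k. k = ?a \<or> k = ?b) [1..<N + 1])"
    by (simp add: filter_map comp_def)
  also have "filter (\<lambda>k. k = ?a \<or> k = ?b) [1..<N + 1] = (if ?a < ?b then [?a, ?b] else [?b, ?a])"
    using ab by (intro sorted_distinct_set_unique sorted_wrt_filter distinct_filter) (auto simp del: upt_Suc)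
  finally show ?thesis using inv assms(4) by (auto simp: before_def)
qed

lemma increasing_permutation_id:
  assumes "\<sigma> permutes {1..N}" "\<And>i. i \<in> {1..<N} \<Longrightarrow> \<sigma> i < \<sigma> (i + 1)"
  shows "map \<sigma> [1..<N + 1] = [1..<N + 1]"
proof (rule sorted_distinct_set_unique)
  show "sorted (map \<sigma> [1..<N + 1])"
    unfolding sorted_iff_nth_Suc
  proof (intro allI impI)
    fix i assume "Suc i < length (map \<sigma> [1..<N + 1])"
    then have "Suc i < N" by simp
    then show "map \<sigma> [1..<N + 1] ! i \<le> map \<sigma> [1..<N + 1] ! Suc i"
      using assms(2)[of "Suc i"] by (simp add: less_imp_le One_nat_def del: upt_Suc)
  qed
  show "distinct (map \<sigma> [1..<N + 1])"
    using permutes_inj_on[OF assms(1)] by (simp add: distinct_map)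
  have "set [1..<N + 1] = {1..N}" by auto
  then show "set (map \<sigma> [1..<N + 1]) = set [1..<N + 1]"
    using permutes_image[OF assms(1)] by simp
qed auto

lemma bij_betw_permutation_words:
  "bij_betw (\<lambda>\<sigma>. map \<sigma> [1..<N + 1]) {\<sigma>. \<sigma> permutes {1..N}} (permutations_of_set {1..N})"
proof -
  let ?f = "\<lambda>\<sigma>. map \<sigma> [1..<N + 1]"
  have upt: "set [1..<N + 1] = {1..N}" by auto
  have inj: "inj_on ?f {\<sigma>. \<sigma> permutes {1..N}}"
  proof (rule inj_onI)
    fix \<sigma> \<tau> assume *: "\<sigma> \<in> {\<sigma>. \<sigma> permutes {1..N}}" "\<tau> \<in> {\<sigma>. \<sigma> permutes {1..N}}" "?f \<sigma> = ?f \<tau>"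
    show "\<sigma> = \<tau>"
    proof
      fix i show "\<sigma> i = \<tau> i"
      proof (cases "i \<in> {1..N}")
        case True
        then show ?thesis using *(3) upt by (metis map_eq_conv)
      next
        case False
        then show ?thesis using * by (simp add: permutes_not_in)
      qed
    qed
  qed
  moreover have "?f ` {\<sigma>. \<sigma> permutes {1..N}} \<subseteq> permutations_of_set {1..N}"
  proof (rule image_subsetI)
    fix \<sigma> assume \<sigma>: "\<sigma> \<in> {\<sigma>. \<sigma> permutes {1..N}}"
    have "set (?f \<sigma>) = {1..N}" using \<sigma> upt permutes_image[of \<sigma> "{1..N}"] by simp
    moreover have "distinct (?f \<sigma>)" using \<sigma> permutes_inj_on[of \<sigma> "{1..N}"] by (simp add: distinct_map)
    ultimately show "?f \<sigma> \<in> permutations_of_set {1..N}" by (rule permutations_of_setI)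
  qed
  moreover have "card (?f ` {\<sigma>. \<sigma> permutes {1..N}}) = card (permutations_of_set {1..N})"
    using card_image[OF inj] card_permutations[of "{1..N}" N] by simp
  ultimately show ?thesis by (simp add: bij_betw_def card_subset_eq)
qed

text \<open>If some \<open>i0\<close> is missing from \<open>S\<close>, no constraint relates the
  letters up to \<open>i0\<close> to the larger ones. The admissible words then fall into full
  shuffle classes, each with sum zero. With all constraints present only the increasing word is
  left.\<close>

lemma sum_constrained_words:
  assumes x: "inj_on x {1..N}" and S: "S \<subseteq> {1..<N}"
  shows "(\<Sum>w\<in>{w \<in> permutations_of_set {1..N}. \<forall>i\<in>S. before w i (i + 1)}. word_prod x w) =
    (if S = {1..<N} then word_prod x [1..<N + 1] else 0)"
proof (cases "S = {1..<N}")
  case True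
  have "{w \<in> permutations_of_set {1..N}. \<forall>i\<in>S. before w i (i + 1)} = {[1..<N + 1]}" (is "?X = _")
  proof (rule subset_antisym; rule subsetI)
    fix w assume w: "w \<in> ?X"
    then have "w \<in> (\<lambda>\<sigma>. map \<sigma> [1..<N + 1]) ` {\<sigma>. \<sigma> permutes {1..N}}"
      using bij_betw_permutation_words[of N] unfolding bij_betw_def by blast
    then obtain \<sigma> where \<sigma>: "w = map \<sigma> [1..<N + 1]" "\<sigma> permutes {1..N}" by blast
    have "inv' \<sigma> i < inv' \<sigma> (i + 1)" if i: "i \<in> {1..<N}" for i
    proof -
      have "before w i (i + 1)" using w i True by blast
      then show ?thesis using before_map_permutation[OF \<sigma>(2), of i "i + 1"] i by (simp add: \<sigma>(1))
    qed
    then have id: "map (inv' \<sigma>) [1..<N + 1] = [1..<N + 1]"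
      by (intro increasing_permutation_id permutes_inv[OF \<sigma>(2)])
    have "map \<sigma> [1..<N + 1] = map \<sigma> (map (inv' \<sigma>) [1..<N + 1])" by (simp only: id)
    also have "\<dots> = [1..<N + 1]" by (simp add: permutes_inverses[OF \<sigma>(2)] comp_def)
    finally show "w \<in> {[1..<N + 1]}" by (simp add: \<sigma>(1))
  next
    fix w assume "w \<in> {[1..<N + 1]}"
    then have w: "w = map id [1..<N + 1]" by simp
    have "before w i (i + 1)" if "i \<in> S" for i
    proof -
      have "i \<in> {1..N}" "i + 1 \<in> {1..N}" using that S by auto
      then show ?thesis unfolding w by (subst before_map_permutation[OF permutes_id]) (auto simp: inv_id)
    qed
    moreover have "w \<in> permutations_of_set {1..N}" unfolding w by (intro permutations_of_setI) auto
    ultimately show "w \<in> ?X" by blast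
  qed
  then show ?thesis using True by simp
next
  case False
  then obtain i0 where i0: "i0 \<in> {1..<N}" "i0 \<notin> S" using S by blast
  let ?X = "{w \<in> permutations_of_set {1..N}. \<forall>i\<in>S. before w i (i + 1)}"
  let ?Q = "\<lambda>z. z \<le> i0"
  define h where "h w = (filter ?Q w, filter (\<lambda>z. \<not> ?Q z) w)" for w
  have fin: "finite ?X" by simp
  have fiber: "(\<Sum>w\<in>{w. w \<in> ?X \<and> h w = y}. word_prod x w) = 0" if y: "y \<in> h ` ?X" for y
  proof -
    obtain w0 where w0: "w0 \<in> ?X" "y = h w0" using y by blast
    define u v where "u = filter ?Q w0" and "v = filter (\<lambda>z. \<not> ?Q z) w0"
    have w0set: "set w0 = {1..N}" "distinct w0" using w0 by (auto dest: permutations_of_setD)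
    have uQ: "\<And>z. z \<in> set u \<Longrightarrow> ?Q z" and vQ: "\<And>z. z \<in> set v \<Longrightarrow> \<not> ?Q z"
      by (auto simp: u_def v_def)
    have disj: "set u \<inter> set v = {}" using uQ vQ by blast
    have dist: "distinct u" "distinct v" using w0set by (auto simp: u_def v_def)
    have union: "set u \<union> set v = {1..N}" unfolding u_def v_def w0set(1)[symmetric] by auto
    have "1 \<in> set u" "N \<in> set v" using i0 w0set by (auto simp: u_def v_def)
    then have ne: "u \<noteq> []" "v \<noteq> []" by auto
    \<comment> \<open>A class is given by its subwords of small and of large letters, and these can
      be interleaved freely.\<close>
    have "{w. w \<in> ?X \<and> h w = y} = shuffles u v"
    proof (rule subset_antisym; rule subsetI)
      fix w assume "w \<in> {w. w \<in> ?X \<and> h w = y}"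
      then have "filter ?Q w = u" "filter (\<lambda>z. \<not> ?Q z) w = v"
        by (simp_all add: w0 h_def u_def v_def)
      then show "w \<in> shuffles u v" using partition_in_shuffles[of w ?Q] by simp
    next
      fix w assume w: "w \<in> shuffles u v"
      have "filter ?Q u = u" "filter ?Q v = []" using uQ vQ by (auto simp: filter_empty_conv filter_id_conv)
      then have "filter ?Q ` shuffles u v = {u}" using filter_shuffles[of ?Q u v] by simp
      then have fu: "filter ?Q w = u" using w by blast
      have "filter (\<lambda>z. \<not> ?Q z) u = []" "filter (\<lambda>z. \<not> ?Q z) v = v" using uQ vQ by (auto simp: filter_empty_conv filter_id_conv)
      then have "filter (\<lambda>z. \<not> ?Q z) ` shuffles u v = {v}" using filter_shuffles[of "\<lambda>z. \<not> ?Q z" u v] by simp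
      then have fv: "filter (\<lambda>z. \<not> ?Q z) w = v" using w by blast
      have "before w i (i + 1)" if i: "i \<in> S" for i
      proof -
        have b0: "before w0 i (i + 1)" using w0 i by blast
        have "i \<noteq> i0" using i i0 by blast
        \<comment> \<open>Since \<open>i \<noteq> i0\<close>, the letters \<open>i\<close> and
          \<open>i + 1\<close> lie on the same side of the split.\<close>
        then consider "i + 1 \<le> i0" | "i0 < i" by linarith
        then show ?thesis
        proof cases
          case 1
          have "filter (\<lambda>z. z = i \<or> z = i + 1) w' = filter (\<lambda>z. z = i \<or> z = i + 1) (filter ?Q w')" for w'
            unfolding filter_filter using 1 by (intro filter_cong) auto
          then show ?thesis using b0 fu unfolding before_def u_def by metis
        next
          case 2
          have "filter (\<lambda>z. z = i \<or> z = i + 1) w' = filter (\<lambda>z. z = i \<or> z = i + 1) (filter (\<lambda>z. \<not> ?Q z) w')" for w'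
            unfolding filter_filter using 2 by (intro filter_cong) auto
          then show ?thesis using b0 fv unfolding before_def v_def by metis
        qed
      qed
      moreover have "w \<in> permutations_of_set {1..N}"
        using distinct_disjoint_shuffles[OF dist disj w] set_shuffles[OF w] union by (intro permutations_of_setI) auto
      moreover have "h w = y" using fu fv by (simp add: h_def w0 u_def v_def)
      ultimately show "w \<in> {w. w \<in> ?X \<and> h w = y}" by blast
    qed
    then show ?thesis
      using word_prod_shuffle_0[of x u v] x ne dist disj union by simp
  qed
  have "(\<Sum>w\<in>?X. word_prod x w) = (\<Sum>y\<in>h ` ?X. \<Sum>w\<in>{w. w \<in> ?X \<and> h w = y}. word_prod x w)"
    by (rule sum.group[symmetric, OF fin finite_imageI[OF fin] order_refl])
  also have "\<dots> = 0" using fiber by (intro sum.neutral) blast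
  finally show ?thesis using False by simp
qed

text \<open>
  Klyachko's identity. Each factor is \<open>c i + (1 - c i) [i before i + 1]\<close>; after expanding the
  product, every term but the full one is a sum over shuffles and vanishes.
\<close>

theorem klyachko_sum:
  fixes x :: "nat \<Rightarrow> 'f::field"
  assumes x: "inj_on x {1..N}"
  shows "(\<Sum>w\<in>permutations_of_set {1..N}. (\<Prod>i\<in>{1..<N}. if before w i (i + 1) then 1 else c i) * word_prod x w) =
    (\<Prod>i\<in>{1..<N}. 1 - c i) * word_prod x [1..<N + 1]"
proof -
  let ?W = "permutations_of_set {1..N}"
  let ?k = "\<lambda>S. (\<Prod>i\<in>S. 1 - c i) * (\<Prod>i\<in>{1..<N} - S. c i)"
  have expand: "(\<Prod>i\<in>{1..<N}. if before w i (i + 1) then 1 else c i) =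
      (\<Sum>S\<in>Pow {1..<N}. ?k S * (if \<forall>i\<in>S. before w i (i + 1) then 1 else 0))" for w
  proof -
    have "(\<Prod>i\<in>{1..<N}. if before w i (i + 1) then 1 else c i) =
        (\<Prod>i\<in>{1..<N}. (1 - c i) * (if before w i (i + 1) then 1 else 0) + c i)"
      by (intro prod.cong) auto
    also have "\<dots> = (\<Sum>S\<in>Pow {1..<N}. (\<Prod>i\<in>S. (1 - c i) * (if before w i (i + 1) then 1 else 0)) * (\<Prod>i\<in>{1..<N} - S. c i))"
      by (rule prod_add) simp
    also have "\<dots> = (\<Sum>S\<in>Pow {1..<N}. ?k S * (if \<forall>i\<in>S. before w i (i + 1) then 1 else 0))"
    proof (rule sum.cong[OF refl])
      fix S assume "S \<in> Pow {1..<N}"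
      then have "finite S" using finite_subset by blast
      then have "(\<Prod>i\<in>S. if before w i (i + 1) then 1 else 0 :: 'f) = (if \<forall>i\<in>S. before w i (i + 1) then 1 else 0)"
        by (induction S) auto
      then show "(\<Prod>i\<in>S. (1 - c i) * (if before w i (i + 1) then 1 else 0)) * (\<Prod>i\<in>{1..<N} - S. c i) =
        ?k S * (if \<forall>i\<in>S. before w i (i + 1) then 1 else 0)"
        by (simp add: prod.distrib)
    qed
    finally show ?thesis .
  qed
  have "(\<Sum>w\<in>?W. (\<Prod>i\<in>{1..<N}. if before w i (i + 1) then 1 else c i) * word_prod x w) =
      (\<Sum>S\<in>Pow {1..<N}. \<Sum>w\<in>?W. ?k S * ((if \<forall>i\<in>S. before w i (i + 1) then 1 else 0) * word_prod x w))"
    unfolding expand sum_distrib_right by (subst sum.swap) (simp add: mult.assoc)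
  also have "\<dots> = (\<Sum>S\<in>Pow {1..<N}. ?k S * (if S = {1..<N} then word_prod x [1..<N + 1] else 0))"
  proof (rule sum.cong[OF refl])
    fix S assume "S \<in> Pow {1..<N}"
    then have S: "S \<subseteq> {1..<N}" by simp
    have "(\<Sum>w\<in>?W. (if \<forall>i\<in>S. before w i (i + 1) then 1 else 0) * word_prod x w) =
      (\<Sum>w\<in>{w \<in> ?W. \<forall>i\<in>S. before w i (i + 1)}. word_prod x w)"
      by (intro sum.mono_neutral_cong_right) auto
    then show "(\<Sum>w\<in>?W. ?k S * ((if \<forall>i\<in>S. before w i (i + 1) then 1 else 0) * word_prod x w)) =
      ?k S * (if S = {1..<N} then word_prod x [1..<N + 1] else 0)"
      unfolding sum_distrib_left[symmetric] sum_constrained_words[OF x S, symmetric] by simp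
  qed
  also have "\<dots> = (\<Sum>S\<in>{{1..<N}}. ?k S * (if S = {1..<N} then word_prod x [1..<N + 1] else 0))"
    by (rule sum.mono_neutral_right) auto
  finally show ?thesis by simp
qed

text \<open>The additive group generated by the word products. Trees produce no coefficients other
  than integers, so no scalar action on the field \<open>'f\<close> is required.\<close>

inductive_set word_span :: "(nat \<Rightarrow> 'f::field) \<Rightarrow> nat set \<Rightarrow> 'f set" for x A where
  zero: "0 \<in> word_span x A"
| add: "w \<in> permutations_of_set A \<Longrightarrow> y \<in> word_span x A \<Longrightarrow> word_prod x w + y \<in> word_span x A"
| sub: "w \<in> permutations_of_set A \<Longrightarrow> y \<in> word_span x A \<Longrightarrow> y - word_prod x w \<in> word_span x A"

lemma word_span_base: "w \<in> permutations_of_set A \<Longrightarrow> word_prod x w \<in> word_span x A"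
  using word_span.add[OF _ word_span.zero] by fastforce

lemma word_span_plus: "y \<in> word_span x A \<Longrightarrow> z \<in> word_span x A \<Longrightarrow> y + z \<in> word_span x A"
proof (induction rule: word_span.induct)
  case (sub w y)
  then show ?case using word_span.sub[of w A "y + z" x] by (simp add: algebra_simps)
qed (auto simp: add.assoc intro: word_span.intros)

lemma word_span_uminus: "y \<in> word_span x A \<Longrightarrow> - y \<in> word_span x A"
proof (induction rule: word_span.induct)
  case (add w y)
  then show ?case using word_span.sub[of w A "- y" x] by (simp add: algebra_simps)
next
  case (sub w y)
  then show ?case using word_span.add[of w A "- y" x] by (simp add: algebra_simps)
qed (auto intro: word_span.zero)

lemma word_span_sum: "(\<And>i. i \<in> I \<Longrightarrow> f i \<in> word_span x A) \<Longrightarrow> sum f I \<in> word_span x A"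
  by (induction I rule: infinite_finite_induct) (auto intro: word_span.zero word_span_plus)

lemma word_prod_append: "word_prod x (u @ j # v) = word_prod x (u @ [j]) * word_prod x (j # v)"
  by (induction x u rule: word_prod.induct) (auto simp: neq_Nil_conv)

text \<open>\<open>1 / (x j - x v)\<close> is the product of the word \<open>[j, v]\<close>; so
  attaching \<open>v\<close> at \<open>j\<close> to a word \<open>a @ j # b\<close> amounts to
  shuffling \<open>v\<close> into \<open>b\<close>.\<close>

lemma word_span_leaf:
  assumes x: "inj_on x (insert v A)" and j: "j \<in> A" and v: "v \<notin> A" and y: "y \<in> word_span x A"
  shows "y / (x j - x v) \<in> word_span x (insert v A)"
proof -
  have word: "word_prod x w / (x j - x v) \<in> word_span x (insert v A)" if w: "w \<in> permutations_of_set A" for w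
  proof -
    have wA: "set w = A" "distinct w" using permutations_of_setD[OF w] by auto
    then obtain a b where ab: "w = a @ j # b" using j by (metis split_list)
    have "word_prod x w / (x j - x v) = word_prod x (a @ [j]) * (word_prod x (j # b) * word_prod x (j # [v]))"
      unfolding ab by (subst word_prod_append) simp
    also have "word_prod x (j # b) * word_prod x (j # [v]) = (\<Sum>u\<in>shuffles b [v]. word_prod x (j # u))"
    proof (rule word_prod_shuffle[symmetric])
      show "inj_on x (insert j (set b \<union> set [v]))" using x wA ab by (intro inj_on_subset[OF x]) auto
      show "distinct (j # b @ [v])" using wA ab v by auto
    qed
    also have "word_prod x (a @ [j]) * (\<Sum>u\<in>shuffles b [v]. word_prod x (j # u)) = (\<Sum>u\<in>shuffles b [v]. word_prod x (a @ j # u))"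
      by (subst (2) word_prod_append) (simp add: sum_distrib_left)
    also have "\<dots> \<in> word_span x (insert v A)"
    proof (intro word_span_sum word_span_base permutations_of_setI)
      fix u assume u: "u \<in> shuffles b [v]"
      have vb: "v \<notin> set b" "distinct b" using wA ab v by auto
      have su: "set u = insert v (set b)" using set_shuffles[OF u] by auto
      have du: "distinct u" using distinct_disjoint_shuffles[OF _ _ _ u] vb by auto
      show "set (a @ j # u) = insert v A" using su wA ab by auto
      show "distinct (a @ j # u)" using su du wA ab v by auto
    qed
    finally show ?thesis .
  qed
  show ?thesis
    using y
  proof (induction rule: word_span.induct)
    case zero
    then show ?case by (simp add: word_span.zero)
  next
    case (add w y)
    then show ?case using word_span_plus[OF word add.IH] by (simp add: add_divide_distrib)
  next
    case (sub w y)
    then show ?case using word_span_plus[OF sub.IH word_span_uminus[OF word]] by (simp add: diff_divide_distrib)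
  qed
qed

definition edge_prod :: "(nat \<Rightarrow> 'f::field) \<Rightarrow> (nat \<times> nat) multiset \<Rightarrow> 'f" where
  "edge_prod x E = (\<Prod>e\<in>#E. 1 / (x (fst e) - x (snd e)))"

lemma connected_crossing_edge:
  assumes "connected_multigraph U E" "S \<subseteq> U" "S \<noteq> {}" "S \<noteq> U"
  obtains e where "e \<in># E" "(fst e \<in> S) \<noteq> (snd e \<in> S)"
proof -
  obtain s u where su: "s \<in> S" "u \<in> U" "u \<notin> S" using assms by blast
  then have path: "(s, u) \<in> (set_mset E \<union> (set_mset E)\<inverse>)\<^sup>*"
    using assms by (auto simp: connected_multigraph_def)
  have "\<exists>e. e \<in># E \<and> (fst e \<in> S) \<noteq> (snd e \<in> S)"
  proof (rule ccontr)
    assume *: "\<not> ?thesis"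
    from path have "u \<in> S"
      by induction (use su * in force)+
    then show False using su by blast
  qed
  then show ?thesis using that by blast
qed

text \<open>Grow the tree one crossing edge at a time; each new edge attaches a leaf.\<close>

lemma edge_prod_tree:
  assumes c: "connected_multigraph U E" and U: "finite U" "U \<noteq> {}" and E: "size E = card U - 1"
    and sub: "\<And>e. e \<in># E \<Longrightarrow> fst e \<in> U \<and> snd e \<in> U" and x: "inj_on x U"
  shows "edge_prod x E \<in> word_span x U"
proof -
  have grow: "\<exists>S F. S \<subseteq> U \<and> card S = Suc k \<and> F \<subseteq># E \<and> size F = k \<and>
      (\<forall>e\<in>#F. fst e \<in> S \<and> snd e \<in> S) \<and> edge_prod x F \<in> word_span x S" if "k < card U" for k
    using that
  proof (induction k)
    case 0
    obtain u where "u \<in> U" using U by blast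
    moreover have "1 \<in> word_span x {u}" using word_span_base[of "[u]" "{u}" x] by simp
    ultimately show ?case by (intro exI[of _ "{u}"] exI[of _ "{#}"]) (auto simp: edge_prod_def)
  next
    case (Suc k)
    then obtain S F where SF: "S \<subseteq> U" "card S = Suc k" "F \<subseteq># E" "size F = k"
      "\<forall>e\<in>#F. fst e \<in> S \<and> snd e \<in> S" "edge_prod x F \<in> word_span x S" by auto
    have fS: "finite S" using SF(1) U(1) by (rule finite_subset)
    have "S \<noteq> U" using SF(2) Suc.prems by auto
    moreover have "S \<noteq> {}" using SF(2) by auto
    ultimately obtain e where e: "e \<in># E" "(fst e \<in> S) \<noteq> (snd e \<in> S)"
      using connected_crossing_edge[OF c SF(1)] by blast
    have eF: "e \<notin># F" using SF(5) e(2) by blast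
    define j v where "j = (if fst e \<in> S then fst e else snd e)" and "v = (if fst e \<in> S then snd e else fst e)"
    have jv: "j \<in> S" "v \<notin> S" "v \<in> U" using e sub[OF e(1)] by (auto simp: j_def v_def)
    have leaf: "edge_prod x F / (x j - x v) \<in> word_span x (insert v S)"
      using jv SF by (intro word_span_leaf inj_on_subset[OF x]) auto
    have "edge_prod x (add_mset e F) \<in> word_span x (insert v S)"
    proof (cases "fst e \<in> S")
      case True
      then show ?thesis using leaf by (simp add: edge_prod_def j_def v_def)
    next
      case False
      \<comment> \<open>The new leaf is the first end of the stored edge, which costs a
        sign.\<close>
      have "edge_prod x (add_mset e F) = - (edge_prod x F / (x j - x v))"
      proof -
        have "1 / (x (fst e) - x (snd e)) = - (1 / (x (snd e) - x (fst e)))"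
          unfolding minus_diff_eq[of "x (snd e)" "x (fst e)", symmetric] by (rule divide_minus_right)
        then show ?thesis using False by (simp add: edge_prod_def j_def v_def)
      qed
      then show ?thesis using word_span_uminus[OF leaf] by simp
    qed
    moreover have "add_mset e F \<subseteq># E"
    proof (rule mset_subset_eqI)
      fix a show "count (add_mset e F) a \<le> count E a"
      proof (cases "a = e")
        case True
        then show ?thesis using eF e(1) by (simp add: not_in_iff Suc_le_eq)
      next
        case False
        then show ?thesis using mset_subset_eq_count[OF SF(3)] by simp
      qed
    qed
    moreover have "\<forall>e'\<in>#add_mset e F. fst e' \<in> insert v S \<and> snd e' \<in> insert v S"
      using SF(5) e(2) by (auto simp: v_def)
    ultimately show ?case
      using SF jv fS by (intro exI[of _ "insert v S"] exI[of _ "add_mset e F"]) simp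
  qed
  have "card U > 0" using U by (simp add: card_gt_0_iff)
  then obtain S F where SF: "S \<subseteq> U" "card S = card U" "F \<subseteq># E" "size F = card U - 1"
      "edge_prod x F \<in> word_span x S"
    using grow[of "card U - 1"] by auto
  have "S = U" using SF(1,2) U(1) card_subset_eq by blast
  \<comment> \<open>The size hypothesis enters here: a grown tree on all of \<open>U\<close> has as
    many edges as \<open>E\<close>, so none are left over.\<close>
  moreover have "F = E"
    using SF(3,4) E by (metis mset_subset_size subset_mset.le_imp_less_or_eq nat_neq_iff)
  ultimately show ?thesis using SF(5) by simp
qed


section \<open>The top degree component\<close>

lemma pvar_eq_iff: "pvar i = pvar j \<longleftrightarrow> i = j"
proof -
  have "single i (1::nat) = single j 1 \<longleftrightarrow> i = j"
    by (metis lookup_single_eq lookup_single_not_eq zero_neq_one)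
  moreover have "pvar i = pvar j \<longleftrightarrow> single i (1::nat) = single j 1"
    unfolding pvar_def by (metis lookup_single_eq lookup_single_not_eq zero_neq_one)
  ultimately show ?thesis by simp
qed

lemma pvar_diff_neq_0: "i \<noteq> j \<Longrightarrow> pvar i - pvar j \<noteq> 0"
  by (simp add: pvar_eq_iff)

lemma graph_poly_union: "graph_poly (G + H) = graph_poly G * graph_poly H"
  by (simp add: graph_poly_def)

definition vandermonde :: "nat \<Rightarrow> cpoly" where
  "vandermonde n = (\<Prod>e\<in>all_edges n. pvar (fst e) - pvar (snd e))"

lemma graph_poly_complete_multigraph: "graph_poly (complete_multigraph l l n) = vandermonde n ^ l"
proof -
  have rep: "graph_poly (replicate_mset k e) = (pvar (fst e) - pvar (snd e)) ^ k" for k e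
    by (induction k) (simp_all add: graph_poly_add_mset)
  have "graph_poly (\<Sum>e\<in>A. replicate_mset l e) = (\<Prod>e\<in>A. pvar (fst e) - pvar (snd e)) ^ l" if "finite A" for A
    using that by induction (simp_all add: graph_poly_union rep power_mult_distrib)
  then show ?thesis
    unfolding complete_multigraph_all_edges vandermonde_def using finite_all_edges by simp
qed

lemma vandermonde_neq_0: "vandermonde n \<noteq> 0"
proof -
  have "pvar (fst e) - pvar (snd e) \<noteq> 0" if "e \<in> all_edges n" for e
    using that by (intro pvar_diff_neq_0) (auto simp: all_edges_def)
  then show ?thesis using finite_all_edges by (simp add: vandermonde_def)
qed

text \<open>The edges of the complete graph are permuted among themselves, so the product is
  reproduced up to orientations.\<close>

lemma permute_vandermonde_cases:
  assumes "\<sigma> permutes {1..n + 1}"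
  shows "permute_vars \<sigma> (vandermonde n) = vandermonde n \<or> permute_vars \<sigma> (vandermonde n) = - vandermonde n"
proof -
  have "image_mset (permute_edge \<sigma>) (complete_multigraph 1 1 n) = complete_multigraph 1 1 n"
    by (rule complete_multigraph_permute[OF assms]) simp
  then have "vandermonde n = permute_vars \<sigma> (vandermonde n) \<or> vandermonde n = - permute_vars \<sigma> (vandermonde n)"
    using graph_poly_permute_edges[of \<sigma> "complete_multigraph 1 1 n"] graph_poly_complete_multigraph[of 1 n]
    by simp
  then show ?thesis by (metis minus_minus)
qed

text \<open>
  If a transposition of \<open>a\<close> and \<open>b\<close> fixed the product, it would negate the product of the factors
  other than \<open>x\<^sub>a - x\<^sub>b\<close>; but that one does not vanish after identifying \<open>x\<^sub>a\<close> with \<open>x\<^sub>b\<close>.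
\<close>

lemma permute_vandermonde_transpose_less:
  assumes ab: "a \<in> {1..n + 1}" "b \<in> {1..n + 1}" "a < b"
  shows "permute_vars (Transposition.transpose a b) (vandermonde n) = - vandermonde n"
proof (rule ccontr)
  let ?\<tau> = "Transposition.transpose a b"
  assume contra: "permute_vars ?\<tau> (vandermonde n) \<noteq> - vandermonde n"
  have "?\<tau> permutes {1..n + 1}" by (rule permutes_swap_id[OF ab(1,2)])
  then have fixed: "permute_vars ?\<tau> (vandermonde n) = vandermonde n"
    using permute_vandermonde_cases contra by blast
  define D where "D = (\<Prod>e\<in>all_edges n - {(a, b)}. pvar (fst e) - pvar (snd e))"
  have "(a, b) \<in> all_edges n" using ab by (auto simp: all_edges_def)
  define d where "d = pvar a - pvar b"
  have d0: "d \<noteq> 0" using pvar_diff_neq_0[of a b] ab(3) by (simp add: d_def)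
  have vD: "vandermonde n = d * D"
    unfolding vandermonde_def D_def d_def using finite_all_edges \<open>(a, b) \<in> all_edges n\<close> by (simp add: prod.remove)
  have "permute_vars ?\<tau> d = - d"
    by (simp add: d_def rhom_diff[OF permute_vars_hom] permute_vars_pvar)
  then have "d * (- permute_vars ?\<tau> D) = d * D"
    using fixed by (simp add: vD rhom_mult[OF permute_vars_hom])
  then have "- permute_vars ?\<tau> D = D" using d0 by (metis mult_left_cancel)
  then have neg: "permute_vars ?\<tau> D = - D" by (metis minus_minus)
  define f where "f i = (if i = b then a else i)" for i
  let ?\<kappa> = "csubst (\<lambda>i. pvar (f i))"
  have "?\<kappa> (permute_vars ?\<tau> D) = ?\<kappa> D"
  proof -
    have "(\<lambda>i. ?\<kappa> (pvar (?\<tau> i))) = (\<lambda>i. pvar (f i))"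
      by (auto simp: fun_eq_iff psubst_pvar ring_hom_fun_pconst f_def transpose_def)
    then show ?thesis
      unfolding permute_vars_csubst psubst_psubst[OF ring_hom_fun_pconst] by simp
  qed
  then have "?\<kappa> D = - ?\<kappa> D" by (simp add: neg rhom_uminus[OF csubst_hom])
  then have "2 * ?\<kappa> D = 0" by (metis mult_2 add.right_inverse)
  then have "?\<kappa> D = 0" by simp
  moreover have "?\<kappa> D \<noteq> 0"
  proof -
    have "?\<kappa> D = (\<Prod>e\<in>all_edges n - {(a, b)}. pvar (f (fst e)) - pvar (f (snd e)))"
      by (simp add: D_def rhom_prod[OF csubst_hom] rhom_diff[OF csubst_hom] psubst_pvar ring_hom_fun_pconst)
    moreover have "f (fst e) \<noteq> f (snd e)" if "e \<in> all_edges n - {(a, b)}" for e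
      using that ab(3) by (auto simp: all_edges_def f_def)
    ultimately show ?thesis using finite_all_edges by (simp add: pvar_eq_iff)
  qed
  ultimately show False by contradiction
qed

lemma permute_vandermonde:
  assumes "\<sigma> permutes {1..n + 1}"
  shows "permute_vars \<sigma> (vandermonde n) = pscale (sign_char \<sigma>) (vandermonde n)"
  using assms finite_atLeastAtMost
proof (induction rule: permutes_induct)
  case id
  show ?case using permute_vars_id[of "vandermonde n"] by (simp add: sign_char_def id_def)
next
  case (swap a b p)
  have "permute_vars (Transposition.transpose a b) (vandermonde n) = - vandermonde n"
    using permute_vandermonde_transpose_less[of a n b] permute_vandermonde_transpose_less[of b n a] swap(1-3)
    by (cases a b rule: linorder_cases) (auto simp: transpose_commute)
  moreover have "sign (Transposition.transpose a b \<circ> p) = - sign p"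
  proof -
    have "permutation p" unfolding permutation_permutes using swap by (intro exI[of _ "{1..n + 1}"]) simp
    then show ?thesis using swap.hyps(3) by (simp add: sign_compose permutation_swap_id sign_swap_id)
  qed
  ultimately have "permute_vars (Transposition.transpose a b \<circ> p) (vandermonde n) =
      pscale (sign_char (Transposition.transpose a b \<circ> p)) (vandermonde n)"
    unfolding permute_vars_compose swap.IH by (simp add: permute_vars_pscale sign_char_def)
  then show ?case by (simp add: comp_def)
qed

definition sign_power :: "nat \<Rightarrow> (nat \<Rightarrow> nat) \<Rightarrow> complex" where
  "sign_power l \<sigma> = sign_char \<sigma> ^ l"

lemma sign_power_square: "sign_power l \<sigma> * sign_power l \<sigma> = 1"
proof -
  have "sign_char \<sigma> * sign_char \<sigma> = 1" by (simp add: sign_char_def flip: of_int_mult)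
  then show ?thesis by (simp add: sign_power_def flip: power_mult_distrib)
qed

lemma sign_power_compose:
  "finite A \<Longrightarrow> \<sigma> permutes A \<Longrightarrow> \<tau> permutes A \<Longrightarrow> sign_power l (\<sigma> \<circ> \<tau>) = sign_power l \<sigma> * sign_power l \<tau>"
  using permutation_permutes[of \<sigma>] permutation_permutes[of \<tau>]
  by (auto simp: sign_power_def sign_char_def sign_compose power_mult_distrib)

lemma permute_vandermonde_power:
  assumes "\<sigma> permutes {1..n + 1}"
  shows "permute_vars \<sigma> (vandermonde n ^ l) = pscale (sign_power l \<sigma>) (vandermonde n ^ l)"
proof -
  have "pconst c ^ k = pconst (c ^ k)" for c k
    using rhom_power[OF ring_hom_fun_pconst] by metis
  then show ?thesis
    by (simp add: rhom_power[OF permute_vars_hom] permute_vandermonde[OF assms] pscale_def power_mult_distrib sign_power_def)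
qed

section \<open>Hamiltonian paths and the top degree\<close>

definition path_graph :: "nat \<Rightarrow> (nat \<times> nat) multiset" where
  "path_graph n = mset_set ((\<lambda>i. (i, i + 1)) ` {1..n})"

lemma graph_poly_path: "graph_poly (path_graph n) = (\<Prod>i\<in>{1..n}. pvar i - pvar (i + 1))"
  unfolding graph_poly_def path_graph_def
  by (simp add: prod_unfold_prod_mset[symmetric] prod.reindex inj_on_def case_prod_unfold)

lemma path_graph_subset: "l \<ge> 1 \<Longrightarrow> path_graph n \<subseteq># complete_multigraph l l n"
proof -
  assume l: "l \<ge> 1"
  have "count (complete_multigraph l l n) e = (if e \<in> all_edges n then l else 0)" for e
    unfolding complete_multigraph_all_edges using finite_all_edges by (simp add: count_sum)
  moreover have "(\<lambda>i. (i, i + 1)) ` {1..n} \<subseteq> all_edges n" by (auto simp: all_edges_def)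
  ultimately have "count (path_graph n) e \<le> count (complete_multigraph l l n) e" for e
    using l by (cases "e \<in> (\<lambda>i. (i, i + 1)) ` {1..n}") (auto simp: path_graph_def subset_iff)
  then show ?thesis by (rule mset_subset_eqI)
qed

lemma size_path_graph: "size (path_graph n) = n"
  by (simp add: path_graph_def card_image inj_on_def)

lemma connected_path_graph: "connected_multigraph {1..n + 1} (path_graph n)"
proof -
  let ?r = "set_mset (path_graph n) \<union> (set_mset (path_graph n))\<inverse>"
  have step: "(i, i + 1) \<in> ?r" if "i \<in> {1..n}" for i
    using that by (auto simp: path_graph_def)
  have from1: "(1, Suc k) \<in> ?r\<^sup>*" if "k \<le> n" for k
    using that
  proof (induction k)
    case (Suc k)
    have "(Suc k, Suc (Suc k)) \<in> ?r" using step[of "Suc k"] Suc.prems by (simp add: One_nat_def)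
    moreover have "(1, Suc k) \<in> ?r\<^sup>*" using Suc by simp
    ultimately show ?case by (rule rtrancl_into_rtrancl[rotated])
  qed (simp add: One_nat_def)
  have "sym (?r\<^sup>*)" by (intro sym_rtrancl) (auto simp: sym_def)
  moreover have "(1, u) \<in> ?r\<^sup>*" if "u \<in> {1..n + 1}" for u
    using from1[of "u - 1"] that by auto
  ultimately show ?thesis
    unfolding connected_multigraph_def by (meson rtrancl_trans symD)
qed

definition path_poly :: "nat \<Rightarrow> nat \<Rightarrow> cpoly" where
  "path_poly l n = graph_poly (complete_multigraph l l n - path_graph n)"

text \<open>The summands are the largest values allowed in a sorted parking function.\<close>

definition top_degree :: "nat \<Rightarrow> nat \<Rightarrow> nat" where
  "top_degree l n = (\<Sum>j<n. l - 1 + l * j)"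

text \<open>Connects two descriptions of the top degree: the sum of the largest parking values, and
  the number of edges outside a spanning tree.\<close>

lemma size_complete_multigraph:
  assumes "l \<ge> 1"
  shows "size (complete_multigraph l l n) = top_degree l n + n"
proof -
  have "size (\<Sum>e\<in>A. replicate_mset l e) = l * card A" if "finite A" for A :: "(nat \<times> nat) set"
    using that by induction auto
  then have "size (complete_multigraph l l n) = l * card (all_edges n)"
    unfolding complete_multigraph_all_edges using finite_all_edges by simp
  also have "card (all_edges n) = (\<Sum>i\<in>{1..n}. n + 1 - i)"
    by (simp add: all_edges_def)
  also have "\<dots> = (\<Sum>j<n. j + 1)"
    by (rule sum.reindex_bij_witness[of _ "\<lambda>j. n - j" "\<lambda>i. n - i"]) auto
  also have "l * (\<Sum>j<n. j + 1) = (\<Sum>j<n. l - 1 + l * j + 1)"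
    unfolding sum_distrib_left using assms by (intro sum.cong) (auto simp: algebra_simps)
  finally show ?thesis by (simp add: top_degree_def sum.distrib)
qed

lemma slim_component_span_size:
  assumes "p \<in> slim_component l m n k"
  shows "p \<in> cpoly.span {graph_poly G | G. slim l m n G \<and> size G = k}"
proof -
  have "hom_part k q \<in> cpoly.span {graph_poly G | G. slim l m n G \<and> size G = k}" if "q \<in> slim_space l m n" for q
    using that unfolding slim_space_def
  proof (induction rule: cpoly.span_induct_alt)
    case base
    then show ?case using hom_part_homogeneous[of k 0] by (simp add: cpoly.span_zero)
  next
    case (step c x y)
    then obtain G where G: "x = graph_poly G" "slim l m n G" by auto
    have "hom_part k x \<in> cpoly.span {graph_poly G | G. slim l m n G \<and> size G = k}"
    proof (cases "size G = k")
      case True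
      then have "hom_part k x = graph_poly G" using hom_part_homogeneous[OF homogeneous_graph_poly, of k G] by (simp add: G)
      then show ?thesis using G True by (intro cpoly.span_base) auto
    next
      case False
      then show ?thesis
        using hom_part_homogeneous[OF homogeneous_graph_poly, of k G] by (simp add: G cpoly.span_zero)
    qed
    then show ?case
      using step by (simp add: hom_part_add hom_part_pscale cpoly.span_add cpoly.span_scale)
  qed
  then have "hom_part k p \<in> cpoly.span {graph_poly G | G. slim l m n G \<and> size G = k}"
    using assms by (simp add: slim_component_def)
  then show ?thesis
    using assms hom_part_homogeneous[of k p k] by (simp add: slim_component_def)
qed

section \<open>Passage to the field of fractions\<close>

abbreviation xfrac :: "nat \<Rightarrow> cpoly fract" where
  "xfrac i \<equiv> to_fract (pvar i)"

lemma ring_hom_fun_to_fract: "ring_hom_fun (to_fract :: cpoly \<Rightarrow> cpoly fract)"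
  by (intro ring_hom_funI) auto

lemma inj_xfrac: "inj_on xfrac A"
  by (simp add: inj_on_def pvar_eq_iff)

lemma edge_prod_xfrac: "edge_prod xfrac E = inverse (to_fract (graph_poly E))"
  by (induction E) (simp_all add: edge_prod_def graph_poly_add_mset divide_inverse mult.commute)

lemma to_fract_eq_quotient:
  assumes "p * q = v" "q \<noteq> (0 :: cpoly)"
  shows "to_fract p = to_fract v * inverse (to_fract q)"
proof -
  have "to_fract v = to_fract p * to_fract q" using assms(1) by auto
  then show ?thesis using assms(2) by (simp add: mult.assoc)
qed

lemma word_prod_upt:
  "word_prod y (map \<sigma> [a..<a + k + 1]) = inverse (\<Prod>i\<in>{a..<a + k}. y (\<sigma> i) - y (\<sigma> (i + 1)))"
proof (induction k arbitrary: a)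
  case 0
  then show ?case by (simp add: One_nat_def)
next
  case (Suc k)
  have upt: "[a..<a + Suc k + 1] = a # Suc a # [Suc (Suc a)..<a + Suc k + 1]" "[Suc a..<Suc a + k + 1] = Suc a # [Suc (Suc a)..<a + Suc k + 1]"
    by (simp_all add: upt_conv_Cons del: upt_Suc)
  have "word_prod y (map \<sigma> [a..<a + Suc k + 1]) = word_prod y (map \<sigma> [Suc a..<Suc a + k + 1]) / (y (\<sigma> a) - y (\<sigma> (a + 1)))"
    unfolding upt by (simp add: One_nat_def del: upt_Suc)
  also have "\<dots> = inverse ((y (\<sigma> a) - y (\<sigma> (a + 1))) * (\<Prod>i\<in>{Suc a..<Suc a + k}. y (\<sigma> i) - y (\<sigma> (i + 1))))"
    unfolding Suc.IH by (simp add: divide_inverse mult.commute)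
  also have "(y (\<sigma> a) - y (\<sigma> (a + 1))) * (\<Prod>i\<in>{Suc a..<Suc a + k}. y (\<sigma> i) - y (\<sigma> (i + 1))) =
      (\<Prod>i\<in>{a..<a + Suc k}. y (\<sigma> i) - y (\<sigma> (i + 1)))"
    by (subst (2) prod.atLeast_Suc_lessThan) auto
  finally show ?case .
qed

context
  fixes l n :: nat
  assumes l: "l \<ge> 1"
begin

private abbreviation (input) "KL \<equiv> complete_multigraph l l n"

text \<open>Permuting the variables also multiplies the \<open>l\<close>-th power of the Vandermonde
  product by a sign. The factor undoes this, so that the quotient by that power is exactly
  \<open>P_w\<close> for the word \<open>w\<close> of \<open>\<sigma>\<close>.\<close>

definition path_form :: "(nat \<Rightarrow> nat) \<Rightarrow> cpoly" where
  "path_form \<sigma> = pscale (sign_power l \<sigma>) (permute_vars \<sigma> (path_poly l n))"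

lemma path_poly_mem: "path_poly l n \<in> slim_component l l n (top_degree l n)"
proof -
  have "KL - (KL - path_graph n) = path_graph n"
    using path_graph_subset[OF l, of n] by (metis subset_mset.add_diff_inverse add_diff_cancel_right')
  then have "slim l l n (KL - path_graph n)"
    using connected_path_graph by (simp add: slim_def)
  then have "path_poly l n \<in> slim_space l l n"
    unfolding slim_space_def path_poly_def by (intro cpoly.span_base) auto
  moreover have "size (KL - path_graph n) = top_degree l n"
    using path_graph_subset[OF l, of n] size_complete_multigraph[OF l, of n] size_path_graph
    by (simp add: size_Diff_submset)
  ultimately show ?thesis
    using homogeneous_graph_poly[of "KL - path_graph n"] by (simp add: slim_component_def path_poly_def)
qed

lemma path_form_mem:
  assumes "\<sigma> permutes {1..n + 1}"
  shows "path_form \<sigma> \<in> slim_component l l n (top_degree l n)"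
proof -
  have "permute_vars \<sigma> (path_poly l n) \<in> slim_component l l n (top_degree l n)"
    using path_poly_mem permute_vars_slim_space[OF assms] by (auto simp: slim_component_def homogeneous_permute_vars)
  then show ?thesis
    unfolding path_form_def by (rule cpoly.subspace_scale[OF subspace_slim_component])
qed

text \<open>The group acts on the path forms by left multiplication, except for the sign left over
  from the normalization: this is the origin of the tensor factor.\<close>

lemma permute_path_form:
  assumes "\<sigma> permutes {1..n + 1}" "\<tau> permutes {1..n + 1}"
  shows "permute_vars \<tau> (path_form \<sigma>) = pscale (sign_power l \<tau>) (path_form (\<tau> \<circ> \<sigma>))"
proof -
  have "sign_power l \<tau> * sign_power l (\<tau> \<circ> \<sigma>) = sign_power l \<sigma>"
    using sign_power_compose[OF _ assms(2,1), of l] sign_power_square[of l \<tau>] by (simp flip: mult.assoc)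
  then show ?thesis
    by (simp add: path_form_def permute_vars_pscale permute_vars_compose)
qed

lemma to_fract_graph_poly:
  assumes "G \<subseteq># KL"
  shows "to_fract (graph_poly G) = to_fract (vandermonde n ^ l) * edge_prod xfrac (KL - G)"
proof -
  have "graph_poly G * graph_poly (KL - G) = vandermonde n ^ l"
    using assms by (simp flip: graph_poly_union graph_poly_complete_multigraph)
  moreover from this have "graph_poly (KL - G) \<noteq> 0" using vandermonde_neq_0[of n] by auto
  ultimately show ?thesis
    unfolding edge_prod_xfrac by (rule to_fract_eq_quotient)
qed

lemma to_fract_path_form:
  assumes \<sigma>: "\<sigma> permutes {1..n + 1}"
  shows "to_fract (path_form \<sigma>) = to_fract (vandermonde n ^ l) * word_prod xfrac (map \<sigma> [1..<n + 1 + 1])"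
proof -
  let ?Q = "\<Prod>i\<in>{1..n}. pvar (\<sigma> i) - pvar (\<sigma> (i + 1))"
  have Q: "permute_vars \<sigma> (graph_poly (path_graph n)) = ?Q"
    by (simp add: graph_poly_path rhom_prod[OF permute_vars_hom] rhom_diff[OF permute_vars_hom] permute_vars_pvar)
  have "path_poly l n * graph_poly (path_graph n) = vandermonde n ^ l"
    unfolding path_poly_def graph_poly_union[symmetric] graph_poly_complete_multigraph[symmetric]
    using path_graph_subset[OF l, of n] by simp
  then have "permute_vars \<sigma> (path_poly l n) * ?Q = pscale (sign_power l \<sigma>) (vandermonde n ^ l)"
    by (metis Q permute_vandermonde_power[OF \<sigma>] rhom_mult[OF permute_vars_hom])
  then have "path_form \<sigma> * ?Q = pscale (sign_power l \<sigma>) (pscale (sign_power l \<sigma>) (vandermonde n ^ l))"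
    by (simp add: path_form_def pscale_def mult.assoc)
  also have "\<dots> = vandermonde n ^ l" by (simp add: sign_power_square)
  finally have eq: "path_form \<sigma> * ?Q = vandermonde n ^ l" .
  have "?Q \<noteq> 0" using vandermonde_neq_0[of n] eq by (metis mult_zero_right power_not_zero)
  with eq have "to_fract (path_form \<sigma>) = to_fract (vandermonde n ^ l) * inverse (to_fract ?Q)"
    by (rule to_fract_eq_quotient)
  also have "to_fract ?Q = (\<Prod>i\<in>{1..<1 + n}. xfrac (\<sigma> i) - xfrac (\<sigma> (i + 1)))"
  proof -
    have "{1..<1 + n} = {1..n}" by auto
    then show ?thesis by (simp add: rhom_prod[OF ring_hom_fun_to_fract])
  qed
  finally show ?thesis
    using word_prod_upt[of xfrac \<sigma> 1 n] by (simp add: add.commute del: upt_Suc)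
qed

text \<open>Relations found among fractions are brought back to polynomials: each word product,
  multiplied by the common numerator, is a path form.\<close>

lemma word_span_path_forms:
  assumes "y \<in> word_span xfrac {1..n + 1}"
  shows "\<exists>p\<in>cpoly.span (path_form ` {\<sigma>. \<sigma> permutes {1..n + 1}}). to_fract p = to_fract (vandermonde n ^ l) * y"
proof -
  let ?V = "path_form ` {\<sigma>. \<sigma> permutes {1..n + 1}}"
  have word: "\<exists>p\<in>cpoly.span ?V. to_fract p = to_fract (vandermonde n ^ l) * word_prod xfrac w"
    if w: "w \<in> permutations_of_set {1..n + 1}" for w
  proof -
    have "w \<in> (\<lambda>\<sigma>. map \<sigma> [1..<n + 1 + 1]) ` {\<sigma>. \<sigma> permutes {1..n + 1}}"
      using w bij_betw_permutation_words[of "n + 1"] unfolding bij_betw_def by blast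
    then obtain \<sigma> where \<sigma>: "w = map \<sigma> [1..<n + 1 + 1]" "\<sigma> permutes {1..n + 1}" by blast
    then have "path_form \<sigma> \<in> cpoly.span ?V" by (intro cpoly.span_base) blast
    then show ?thesis using to_fract_path_form[OF \<sigma>(2)] \<sigma>(1) by blast
  qed
  show ?thesis
    using assms
  proof (induction rule: word_span.induct)
    case zero
    then show ?case by (intro bexI[of _ 0]) (simp_all add: cpoly.span_zero)
  next
    case (add w y)
    obtain p q where "p \<in> cpoly.span ?V" "to_fract p = to_fract (vandermonde n ^ l) * word_prod xfrac w"
      "q \<in> cpoly.span ?V" "to_fract q = to_fract (vandermonde n ^ l) * y" using word[OF add(1)] add.IH by blast
    then show ?case by (intro bexI[of _ "p + q"]) (simp_all add: cpoly.span_add distrib_left)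
  next
    case (sub w y)
    obtain p q where "p \<in> cpoly.span ?V" "to_fract p = to_fract (vandermonde n ^ l) * word_prod xfrac w"
      "q \<in> cpoly.span ?V" "to_fract q = to_fract (vandermonde n ^ l) * y" using word[OF sub(1)] sub.IH by blast
    then show ?case by (intro bexI[of _ "q - p"]) (simp_all add: cpoly.span_diff right_diff_distrib)
  qed
qed

text \<open>In the top degree the complement of a slim graph is connected with \<open>n\<close>
  edges on \<open>n + 1\<close> vertices. It is a spanning tree, so its edge product is a
  combination of word products.\<close>

lemma top_component_span:
  "slim_component l l n (top_degree l n) \<subseteq> cpoly.span (path_form ` {\<sigma>. \<sigma> permutes {1..n + 1}})"
proof -
  let ?V = "path_form ` {\<sigma>. \<sigma> permutes {1..n + 1}}"
  have "{graph_poly G | G. slim l l n G \<and> size G = top_degree l n} \<subseteq> cpoly.span ?V"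
  proof
    fix p assume "p \<in> {graph_poly G | G. slim l l n G \<and> size G = top_degree l n}"
    then obtain G where G: "p = graph_poly G" "slim l l n G" "size G = top_degree l n" by auto
    have GK: "G \<subseteq># KL" and con: "connected_multigraph {1..n + 1} (KL - G)" using G(2) by (auto simp: slim_def)
    have "edge_prod xfrac (KL - G) \<in> word_span xfrac {1..n + 1}"
    proof (rule edge_prod_tree[OF con])
      show "size (KL - G) = card {1..n + 1} - 1"
        using size_complete_multigraph[OF l, of n] G(3) GK by (simp add: size_Diff_submset)
      show "fst e \<in> {1..n + 1} \<and> snd e \<in> {1..n + 1}" if "e \<in># KL - G" for e
        using mem_complete_multigraph[OF in_diffD[OF that]] by auto
    qed (use inj_xfrac in auto)
    then obtain q where q: "q \<in> cpoly.span ?V" "to_fract q = to_fract (vandermonde n ^ l) * edge_prod xfrac (KL - G)"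
      using word_span_path_forms by blast
    then have "to_fract q = to_fract p" using to_fract_graph_poly[OF GK] G(1) by simp
    then show "p \<in> cpoly.span ?V" using q(1) by simp
  qed
  then show ?thesis
    using slim_component_span_size[of _ l l n "top_degree l n"] cpoly.span_minimal[OF _ cpoly.subspace_span] by blast
qed

end


section \<open>The Lie representation\<close>

definition root_unity :: "nat \<Rightarrow> complex" where
  "root_unity n = exp (2 * of_real pi * \<i> / of_nat (n + 1))"

lemma root_unity_power: "root_unity n ^ k = cis (2 * pi * real k / real (n + 1))"
proof -
  have "root_unity n = cis (2 * pi / real (n + 1))"
    by (simp add: root_unity_def cis_conv_exp mult.commute)
  then show ?thesis by (simp add: DeMoivre field_simps)
qed

lemma root_unity_order: "root_unity n ^ (n + 1) = 1"
  unfolding root_unity_power by simp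

lemma root_unity_primitive:
  assumes "0 < k" "k < n + 1"
  shows "root_unity n ^ k \<noteq> 1"
proof
  assume "root_unity n ^ k = 1"
  then have eq: "cis (2 * pi * real k / real (n + 1)) = cis (2 * pi * real 0 / real (n + 1))"
    unfolding root_unity_power by simp
  have inj: "inj_on (\<lambda>k. cis (2 * pi * real k / real (n + 1))) {..<n + 1}"
    using bij_betw_roots_unity[of "n + 1"] by (simp add: bij_betw_def)
  have "k = 0" by (rule inj_onD[OF inj eq]) (use assms in auto)
  then show False using assms by simp
qed

lemma root_unity_neq_0: "root_unity n \<noteq> 0"
  by (simp add: root_unity_def)

section \<open>The cyclic group and its induced representation\<close>

lemma long_cycle_permutes: "long_cycle n permutes {1..n + 1}"
proof -
  have "set [1..<n + 2] = {1..n + 1}" by auto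
  then show ?thesis unfolding long_cycle_def using cycle_permutes[of "[1..<n + 2]"] by simp
qed

lemma long_cycle_apply:
  assumes "i \<in> {1..n + 1}"
  shows "long_cycle n i = i mod (n + 1) + 1"
proof -
  let ?L = "[1..<n + 2]"
  have rot: "map (long_cycle n) ?L = rotate1 ?L"
    using cyclic_rotation[of ?L 1] by (simp add: long_cycle_def One_nat_def del: upt_Suc)
  have len: "i - 1 < length ?L" using assms by auto
  have i: "Suc (i - 1) = i" using assms by simp
  have lt: "i mod (n + 1) < n + 1" by (rule mod_less_divisor) simp
  have "?L ! (i - 1) = 1 + (i - 1)" by (rule nth_upt) (use assms in auto)
  then have L1: "?L ! (i - 1) = i" using assms by (simp del: upt_Suc)
  have "?L ! (i mod (n + 1)) = 1 + i mod (n + 1)" by (rule nth_upt) (use lt in linarith)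
  then have L2: "?L ! (i mod (n + 1)) = i mod (n + 1) + 1" by (rule trans) (rule add.commute)
  have L3: "length ?L = n + 1" by simp
  have "long_cycle n (?L ! (i - 1)) = ?L ! (Suc (i - 1) mod length ?L)"
    unfolding nth_map[OF len, symmetric] rot by (rule nth_rotate1[OF len])
  then show ?thesis unfolding L1 L3 i L2 .
qed

lemma long_cycle_funpow_permutes: "(long_cycle n ^^ k) permutes {1..n + 1}"
proof (induction k)
  case 0
  then show ?case using permutes_id by (simp add: id_def)
next
  case (Suc k)
  show ?case using permutes_compose[OF Suc long_cycle_permutes] by (simp add: comp_def)
qed

lemma long_cycle_funpow_apply:
  assumes "i \<in> {1..n + 1}"
  shows "(long_cycle n ^^ k) i = (i - 1 + k) mod (n + 1) + 1"
proof (induction k)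
  case 0
  then show ?case using assms by auto
next
  case (Suc k)
  have "(i - 1 + k) mod (n + 1) < n + 1" by (rule mod_less_divisor) simp
  then have "(i - 1 + k) mod (n + 1) + 1 \<in> {1..n + 1}" unfolding atLeastAtMost_iff by linarith
  then have "(long_cycle n ^^ Suc k) i = ((i - 1 + k) mod (n + 1) + 1) mod (n + 1) + 1"
    by (simp add: Suc.IH long_cycle_apply)
  also have "((i - 1 + k) mod (n + 1) + 1) mod (n + 1) = (i - 1 + Suc k) mod (n + 1)"
    by (metis Suc_eq_plus1 add_Suc_right mod_add_left_eq)
  finally show ?case .
qed

lemma long_cycle_order: "long_cycle n ^^ (n + 1) = id"
proof
  fix i
  show "(long_cycle n ^^ (n + 1)) i = id i"
  proof (cases "i \<in> {1..n + 1}")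
    case True
    have "i - 1 < n + 1" using True unfolding atLeastAtMost_iff by linarith
    then have "(i - 1 + (n + 1)) mod (n + 1) = i - 1" by (simp only: mod_add_self2 mod_less)
    then show ?thesis unfolding long_cycle_funpow_apply[OF True] by (simp only: id_apply) (use True in simp)
  next
    case False
    then show ?thesis using permutes_not_in[OF long_cycle_funpow_permutes] by simp
  qed
qed

lemma cyclic_subgroup_funpow:
  assumes "h \<in> cyclic_subgroup n"
  shows "\<exists>k. long_cycle n ^^ k = h"
  using assms unfolding cyclic_subgroup_def
proof (induction rule: generate.induct)
  case one
  then show ?case by (intro exI[of _ 0]) (simp add: sym_group_one)
next
  case (incl h)
  then show ?case by (intro exI[of _ 1]) (simp add: One_nat_def)
next
  case (inv h)
  have carr: "long_cycle n \<in> carrier (sym_group (n + 1))" by (simp add: sym_group_carrier long_cycle_permutes)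
  \<comment> \<open>The inverse of the cycle is its \<open>n\<close>-th power, so powers with
    natural exponents exhaust the group.\<close>
  have "(long_cycle n ^^ n) \<circ> long_cycle n = id"
    using long_cycle_order[of n] by (metis Suc_eq_plus1 funpow_Suc_right)
  then have "long_cycle n ^^ n = inv' (long_cycle n)"
    using permutes_inv_o(1)[OF long_cycle_permutes[of n]] by (metis comp_assoc comp_id fun.map_id0 id_apply)
  then show ?case using inv carr by auto
next
  case (eng h1 h2)
  then show ?case by (metis funpow_add sym_group_mult)
qed

lemma cyclic_subgroup_subset: "cyclic_subgroup n \<subseteq> carrier (sym_group (n + 1))"
  unfolding cyclic_subgroup_def
  by (rule group.generate_incl[OF sym_group_is_group]) (simp add: sym_group_carrier long_cycle_permutes)

lemma equivariant_funpow:
  fixes F :: "(nat \<Rightarrow> nat) \<Rightarrow> complex"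
  assumes "\<And>g. g permutes {1..n + 1} \<Longrightarrow> F (long_cycle n \<circ> g) = root_unity n * F g" "g permutes {1..n + 1}"
  shows "F ((long_cycle n ^^ k) \<circ> g) = root_unity n ^ k * F g"
proof (induction k)
  case (Suc k)
  have "(long_cycle n ^^ Suc k) \<circ> g = long_cycle n \<circ> ((long_cycle n ^^ k) \<circ> g)" by (simp add: comp_assoc)
  moreover have "(long_cycle n ^^ k) \<circ> g permutes {1..n + 1}"
    by (rule permutes_compose[OF assms(2) long_cycle_funpow_permutes])
  moreover have "F ((long_cycle n ^^ k) \<circ> g) = root_unity n ^ k * F g" using Suc by (simp add: comp_def)
  ultimately have "F ((long_cycle n ^^ Suc k) \<circ> g) = root_unity n ^ Suc k * F g"
    using assms(1) by (simp only: power_Suc mult.assoc)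
  then show ?case by (simp add: comp_def)
qed simp

text \<open>Equivariance under the generator suffices: \<open>zeta\<close> is defined through an
  exponent of the cycle, and iterating the condition reproduces the matching power of the
  root.\<close>

lemma mem_lie_rep:
  assumes "n \<ge> 1"
  shows "F \<in> rep_space (lie_rep n) \<longleftrightarrow> (\<forall>g. \<not> g permutes {1..n + 1} \<longrightarrow> F g = 0) \<and>
    (\<forall>g. g permutes {1..n + 1} \<longrightarrow> F (long_cycle n \<circ> g) = root_unity n * F g)"
proof -
  have mem: "F \<in> rep_space (lie_rep n) \<longleftrightarrow> (\<forall>g. \<not> g permutes {1..n + 1} \<longrightarrow> F g = 0) \<and>
    (\<forall>h\<in>cyclic_subgroup n. \<forall>g. g permutes {1..n + 1} \<longrightarrow> F (h \<circ> g) = zeta n h * F g)"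
    by (simp add: lie_rep_def induced_rep_def char_rep_def sym_group_def)
  have c1: "long_cycle n \<noteq> id"
    using long_cycle_apply[of 1 n] assms by auto
  \<comment> \<open>For \<open>n \<ge> 1\<close> the cycle is not the identity, so the least
    exponent is not 0 and \<open>zeta\<close> takes the intended value on the generator.\<close>
  have "(LEAST k. long_cycle n ^^ k = long_cycle n) = 1"
  proof (rule Least_equality)
    show "1 \<le> k" if "long_cycle n ^^ k = long_cycle n" for k
      using that c1 by (cases k) auto
  qed (simp add: One_nat_def)
  then have zc: "zeta n (long_cycle n) = root_unity n" by (simp add: zeta_def root_unity_def)
  have cin: "long_cycle n \<in> cyclic_subgroup n" unfolding cyclic_subgroup_def by (rule generate.incl) simp
  have "F (h \<circ> g) = zeta n h * F g"
    if eq: "\<And>g. g permutes {1..n + 1} \<Longrightarrow> F (long_cycle n \<circ> g) = root_unity n * F g"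
      and h: "h \<in> cyclic_subgroup n" and g: "g permutes {1..n + 1}" for h g
  proof -
    let ?k = "LEAST k. long_cycle n ^^ k = h"
    have "long_cycle n ^^ ?k = h" by (rule LeastI_ex[OF cyclic_subgroup_funpow[OF h]])
    then show ?thesis using equivariant_funpow[of n F g ?k] eq g by (simp add: zeta_def root_unity_def)
  qed
  then show ?thesis unfolding mem using zc cin by metis
qed

text \<open>The function \<open>q^maj\<close>, where \<open>maj\<close> is the sum of the descents.
  The root is inverted because the cycle lowers the major index, whereas members of the induced
  space gain a factor \<open>root_unity n\<close>.\<close>

definition major_weight :: "nat \<Rightarrow> (nat \<Rightarrow> nat) \<Rightarrow> complex" where
  "major_weight n g = (if g permutes {1..n + 1}
     then \<Prod>i\<in>{1..<n + 1}. if g i < g (i + 1) then 1 else inverse (root_unity n) ^ i else 0)"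

text \<open>
  Multiplying \<open>g\<close> by the cycle moves the descent after the position \<open>p\<close> of the largest value one step
  to the left, so the major index drops by one modulo \<open>n + 1\<close>.
\<close>

lemma major_weight_cycle:
  assumes g: "g permutes {1..n + 1}"
  shows "major_weight n (long_cycle n \<circ> g) = root_unity n * major_weight n g"
proof -
  let ?q = "inverse (root_unity n)" and ?c = "long_cycle n" and ?I = "{1..<n + 1}"
  define maj where "maj h = (\<Sum>i\<in>?I. if h i < h (i + 1) then 0 else i)" for h :: "nat \<Rightarrow> nat"
  have weight: "major_weight n h = ?q ^ maj h" if "h permutes {1..n + 1}" for h
  proof -
    have "?q ^ maj h = (\<Prod>i\<in>?I. ?q ^ (if h i < h (i + 1) then 0 else i))"
      unfolding maj_def by (rule power_sum)
    also have "\<dots> = (\<Prod>i\<in>?I. if h i < h (i + 1) then 1 else ?q ^ i)" by (intro prod.cong) auto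
    finally show ?thesis using that by (simp add: major_weight_def)
  qed
  define p where "p = inv' g (n + 1)"
  have p: "p \<in> {1..n + 1}"
    unfolding p_def using permutes_in_image[OF permutes_inv[OF g], of "n + 1"] by simp
  have gp: "g i = n + 1 \<longleftrightarrow> i = p" for i
    unfolding p_def using permutes_inverses[OF g] by metis
  have gin: "g i \<in> {1..n + 1}" if "i \<in> {1..n + 1}" for i
    using permutes_in_image[OF g] that by blast
  have c: "?c x = (if x = n + 1 then 1 else x + 1)" if "x \<in> {1..n + 1}" for x
    using long_cycle_apply[OF that] that by auto
  \<comment> \<open>Only the comparisons with the largest value change, as it becomes the smallest:
    the descent at \<open>p\<close> disappears and one at \<open>p - 1\<close> arises. Terms are
    placed so that nothing is subtracted in the natural numbers.\<close>
  have "(if (?c \<circ> g) i < (?c \<circ> g) (i + 1) then 0 else i) + (if i = p then i else 0) =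
      (if g i < g (i + 1) then 0 else i) + (if i + 1 = p then i else 0)" if i: "i \<in> ?I" for i
  proof -
    have i1: "g i \<in> {1..n + 1}" "g (i + 1) \<in> {1..n + 1}" using i gin by auto
    have ne: "g i \<noteq> g (i + 1)" using permutes_inj[OF g] by (metis Suc_eq_plus1 injD n_not_Suc_n)
    show ?thesis
      using i1 ne unfolding comp_def c[OF i1(1)] c[OF i1(2)] gp[symmetric] by auto
  qed
  then have "maj (?c \<circ> g) + (\<Sum>i\<in>?I. if i = p then i else 0) = maj g + (\<Sum>i\<in>?I. if i + 1 = p then i else 0)"
    unfolding maj_def sum.distrib[symmetric] by (rule sum.cong[OF refl])
  moreover have "(\<Sum>i\<in>?I. if i = p then i else 0) = (if p \<le> n then p else 0)"
    using p by auto
  moreover have "(\<Sum>i\<in>?I. if i + 1 = p then i else 0) = p - 1"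
  proof -
    have "(\<Sum>i\<in>?I. if i + 1 = p then i else 0) = (\<Sum>i\<in>?I. if i = p - 1 then i else 0)"
      using p by (intro sum.cong) auto
    also have "\<dots> = p - 1" using p by (cases "p = 1") auto
    finally show ?thesis .
  qed
  ultimately have maj: "maj (?c \<circ> g) + (if p \<le> n then p else 0) = maj g + (p - 1)" by simp
  have "?q ^ maj (?c \<circ> g) * ?q = ?q ^ maj g"
  proof (cases "p \<le> n")
    case True
    then have "maj (?c \<circ> g) + 1 = maj g" using maj p by auto
    then show ?thesis by (metis power_add power_one_right)
  next
    \<comment> \<open>The largest value stands last and has no descent after it. The major index
      rises by \<open>n\<close>, which is again -1 modulo \<open>n + 1\<close>.\<close>
    case False
    then have "p = n + 1" using p by simp
    then have "maj (?c \<circ> g) + 1 = maj g + (n + 1)" using maj False by simp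
    then have "?q ^ maj (?c \<circ> g) * ?q = ?q ^ maj g * ?q ^ (n + 1)"
      by (metis power_add power_one_right)
    also have "?q ^ (n + 1) = 1" using root_unity_order[of n] by (simp only: power_inverse inverse_1)
    finally show ?thesis by (simp only: mult_1_right)
  qed
  then have "major_weight n (?c \<circ> g) * ?q = major_weight n g"
    by (simp only: weight[OF g] weight[OF permutes_compose[OF g long_cycle_permutes]])
  then have "root_unity n * major_weight n g = major_weight n (?c \<circ> g) * (?q * root_unity n)"
    by (metis mult.assoc mult.commute)
  also have "?q * root_unity n = 1" using root_unity_neq_0[of n] by simp
  finally show ?thesis by (simp only: mult_1_right)
qed

lemma coefficients_vanish_by_dimension:
  fixes u b :: "'h \<Rightarrow> cpoly" and t :: "'h \<Rightarrow> nat \<Rightarrow>\<^sub>0 nat"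
  assumes H: "finite H"
    and b: "\<And>h h'. h \<in> H \<Longrightarrow> h' \<in> H \<Longrightarrow> lookup (b h) (t h') = (if h = h' then 1 else 0)"
    and span: "\<And>h. h \<in> H \<Longrightarrow> b h \<in> cpoly.span (u ` H)"
    and zero: "(\<Sum>h\<in>H. pscale (c h) (u h)) = 0"
    and h0: "h0 \<in> H"
  shows "c h0 = 0"
proof (rule ccontr)
  assume c0: "c h0 \<noteq> 0"
  have inj: "inj_on b H"
  proof (rule inj_onI)
    fix h h' assume "h \<in> H" "h' \<in> H" "b h = b h'"
    then show "h = h'" using b[of h h] b[of h' h] by (metis zero_neq_one)
  qed
  have "cpoly.independent (b ` H)"
  proof (rule cpoly.independent_if_scalars_zero)
    fix f x assume sum: "(\<Sum>x\<in>b ` H. pscale (f x) x) = 0" and "x \<in> b ` H"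
    then obtain h where h: "h \<in> H" "x = b h" by auto
    have "0 = lookup (\<Sum>h'\<in>H. pscale (f (b h')) (b h')) (t h)"
      using sum by (simp add: sum.reindex[OF inj])
    also have "\<dots> = (\<Sum>h'\<in>H. if h' = h then f (b h') else 0)"
      unfolding lookup_sum lookup_pscale using b h(1) by (intro sum.cong) auto
    also have "\<dots> = f (b h)" using H h(1) by simp
    finally show "f x = 0" by (simp add: h(2))
  qed (simp add: H)
  let ?T = "u ` (H - {h0})"
  have "(\<Sum>h\<in>H. pscale (c h) (u h)) = pscale (c h0) (u h0) + (\<Sum>h\<in>H - {h0}. pscale (c h) (u h))"
    using H h0 by (rule sum.remove)
  then have "pscale (c h0) (u h0) = - (\<Sum>h\<in>H - {h0}. pscale (c h) (u h))"
    using zero by (simp add: eq_neg_iff_add_eq_0)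
  also have "\<dots> \<in> cpoly.span ?T"
    by (intro cpoly.span_neg cpoly.span_sum cpoly.span_scale cpoly.span_base) auto
  finally have "pscale (inverse (c h0)) (pscale (c h0) (u h0)) \<in> cpoly.span ?T" by (rule cpoly.span_scale)
  then have "u h0 \<in> cpoly.span ?T" using c0 by simp
  then have "u ` H \<subseteq> cpoly.span ?T" using cpoly.span_superset[of ?T] by auto
  then have "cpoly.span (u ` H) \<subseteq> cpoly.span ?T" by (rule cpoly.span_minimal) simp
  then have "b ` H \<subseteq> cpoly.span ?T" using span by auto
  then have "card (b ` H) \<le> card ?T"
    using cpoly.independent_span_bound[of ?T "b ` H"] \<open>cpoly.independent (b ` H)\<close> H by simp
  also have "card ?T \<le> card (H - {h0})" using H by (intro card_image_le) simp
  also have "\<dots> < card H" using H h0 by (rule card_Diff1_less)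
  finally show False by (simp add: card_image[OF inj])
qed

section \<open>Parking functions of the top degree\<close>

lemma parking_degree_above_top:
  assumes l: "l \<ge> 1" and f: "f \<in> parking_degree l l n k"
  shows "k \<le> top_degree l n"
proof -
  have keys: "keys f \<subseteq> {1..n}" and park: "parking (complete_multigraph l l n) {1..n} f"
    and deg: "monom_degree f = k"
    using f by (auto simp: parking_degree_def parking_def)
  define as where "as = sorted_list_of_multiset (image_mset (lookup f) (mset_set {1..n}))"
  have as: "sorted as" "image_mset (lookup f) (mset_set {1..n}) = mset as"
    by (simp_all add: as_def)
  have len: "length as = n" using as(2) by (metis card_atLeastAtMost diff_Suc_1 size_image_mset size_mset size_mset_set)
  have "k = sum_list as" using monom_degree_eq_sum_mset[OF keys as(2)] deg by simp
  also have "\<dots> = (\<Sum>j<n. as ! j)" by (simp add: sum_list_sum_nth len atLeast0LessThan)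
  also have "\<dots> \<le> top_degree l n"
    unfolding top_degree_def using parking_complete_iff_sorted[OF l keys as, of l] park by (intro sum_mono) auto
  finally show ?thesis .
qed

text \<open>The largest parking values are distinct as \<open>l\<close> is positive, so their
  rearrangements give \<open>n!\<close> different monomials, indexed by the permutations of
  \<open>{1..n}\<close>.\<close>

lemma top_parking_monomials:
  assumes l: "l \<ge> 1"
  obtains t :: "(nat \<Rightarrow> nat) \<Rightarrow> nat \<Rightarrow>\<^sub>0 nat" where
    "\<And>h. h permutes {1..n} \<Longrightarrow> t h \<in> parking_degree l l n (top_degree l n)"
    "inj_on t {h. h permutes {1..n}}"
proof -
  define d where "d i = (if i \<in> {1..n} then l - 1 + l * (i - 1) else 0)" for i
  have "{i. d i \<noteq> 0} \<subseteq> {1..n}" by (auto simp: d_def)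
  then have "finite {i. d i \<noteq> 0}" by (rule finite_subset) simp
  then have look: "lookup (Abs_poly_mapping d) = d" by simp
  define t where "t h = map_key h (Abs_poly_mapping d)" for h :: "nat \<Rightarrow> nat"
  have keys: "keys (Abs_poly_mapping d) \<subseteq> {1..n}"
  proof
    fix i assume "i \<in> keys (Abs_poly_mapping d)"
    then have "d i \<noteq> 0" unfolding in_keys_iff look .
    then show "i \<in> {1..n}" by (rule contrapos_np) (simp only: d_def if_False)
  qed
  define as where "as = map (\<lambda>j. l - 1 + l * j) [0..<n]"
  have sorted: "sorted as" by (auto simp: as_def sorted_iff_nth_mono)
  have im: "image_mset d (mset_set {1..n}) = mset as"
  proof -
    have "mset_set {1..n} = mset (map Suc [0..<n])"
      by (metis One_nat_def atLeastLessThanSuc_atLeastAtMost map_Suc_upt mset_upt)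
    then have "image_mset d (mset_set {1..n}) = mset (map (\<lambda>j. d (Suc j)) [0..<n])"
      by (simp add: image_mset.compositionality comp_def)
    also have "map (\<lambda>j. d (Suc j)) [0..<n] = as"
      unfolding as_def by (intro map_cong) (auto simp: d_def)
    finally show ?thesis .
  qed
  have "t h \<in> parking_degree l l n (top_degree l n)" if h: "h permutes {1..n}" for h
  proof -
    have k: "keys (t h) \<subseteq> {1..n}" unfolding t_def by (rule keys_map_key_permutes[OF h keys])
    have m: "image_mset (lookup (t h)) (mset_set {1..n}) = mset as"
      unfolding t_def image_mset_map_key_permutes[OF h] look by (rule im)
    have "parking (complete_multigraph l l n) {1..n} (t h)"
      unfolding parking_complete_iff_sorted[OF l k sorted m] by (simp add: as_def)
    moreover have "monom_degree (t h) = top_degree l n"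
      unfolding monom_degree_eq_sum_mset[OF k m] as_def top_degree_def by (simp add: interv_sum_list_conv_sum_set_nat atLeast0LessThan)
    ultimately show ?thesis by (simp add: parking_degree_def)
  qed
  moreover have "inj_on t {h. h permutes {1..n}}"
  proof (rule inj_onI)
    fix h h' assume "h \<in> {h. h permutes {1..n}}" "h' \<in> {h. h permutes {1..n}}" and eq: "t h = t h'"
    then have h: "h permutes {1..n}" "h' permutes {1..n}" by auto
    show "h = h'"
    proof
      fix i
      show "h i = h' i"
      proof (cases "i \<in> {1..n}")
        case True
        then have in': "h i \<in> {1..n}" "h' i \<in> {1..n}" using permutes_in_image[OF h(1)] permutes_in_image[OF h(2)] by blast+
        have "d (h i) = d (h' i)"
          using arg_cong[OF eq, of "\<lambda>f. lookup f i"]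
          unfolding t_def lookup_map_key_permutes[OF h(1)] lookup_map_key_permutes[OF h(2)] look .
        then have "l * (h i - 1) = l * (h' i - 1)" using in' unfolding d_def by (simp only: if_True add_left_cancel)
        then have "h i - 1 = h' i - 1" using l by simp
        then show ?thesis using in' by auto
      next
        case False
        then show ?thesis using permutes_not_in[OF h(1)] permutes_not_in[OF h(2)] by simp
      qed
    qed
  qed
  ultimately show ?thesis using that by blast
qed

section \<open>The equivariant map onto the top component\<close>

context
  fixes l n :: nat
  assumes l: "l \<ge> 1" and n: "n \<ge> 1"
begin

private abbreviation (input) "perms \<equiv> {\<sigma>. \<sigma> permutes {1..n + 1}}"
private abbreviation (input) "top_comp \<equiv> slim_component l l n (top_degree l n)"

text \<open>The inverse reconciles the two actions: right translation of functions, and left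
  multiplication on the indices of path forms.\<close>

definition lie_map :: "((nat \<Rightarrow> nat) \<Rightarrow> complex) \<Rightarrow> cpoly" where
  "lie_map F = (\<Sum>g\<in>perms. pscale (F g) (path_form l n (inv' g)))"

lemma finite_perms: "finite perms"
  by (simp add: finite_permutations)

lemma lie_map_mem: "lie_map F \<in> top_comp"
  unfolding lie_map_def
  by (intro cpoly.subspace_sum[OF subspace_slim_component] cpoly.subspace_scale[OF subspace_slim_component]
      path_form_mem[OF l]) (auto intro: permutes_inv)

lemma lie_map_add: "lie_map (F + G) = lie_map F + lie_map G"
  by (simp add: lie_map_def cpoly.scale_left_distrib sum.distrib)

lemma lie_map_scale: "lie_map (\<lambda>g. c * F g) = pscale c (lie_map F)"
  by (simp add: lie_map_def cpoly.scale_sum_right)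

lemma lie_map_act:
  assumes \<tau>: "\<tau> permutes {1..n + 1}"
  shows "lie_map (\<lambda>g. sign_power l \<tau> * (if g permutes {1..n + 1} then F (g \<circ> \<tau>) else 0)) = permute_vars \<tau> (lie_map F)"
proof -
  let ?f = "\<lambda>g. pscale (sign_power l \<tau> * F g) (path_form l n (\<tau> \<circ> inv' g))"
  have "lie_map (\<lambda>g. sign_power l \<tau> * (if g permutes {1..n + 1} then F (g \<circ> \<tau>) else 0)) = (\<Sum>g\<in>perms. ?f (g \<circ> \<tau>))"
    unfolding lie_map_def
  proof (rule sum.cong[OF refl])
    fix g assume "g \<in> perms"
    then have g: "g permutes {1..n + 1}" by simp
    have "\<tau> \<circ> inv' (g \<circ> \<tau>) = \<tau> \<circ> (inv' \<tau> \<circ> inv' g)"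
      using g \<tau> by (simp add: o_inv_distrib permutes_bij)
    also have "\<dots> = inv' g" by (simp add: fun_eq_iff permutes_inverses[OF \<tau>])
    finally show "pscale (sign_power l \<tau> * (if g permutes {1..n + 1} then F (g \<circ> \<tau>) else 0)) (path_form l n (inv' g)) = ?f (g \<circ> \<tau>)"
      using g by simp
  qed
  also have "\<dots> = (\<Sum>g\<in>perms. ?f g)"
    by (rule sum_permutations_compose_right[OF \<tau>, of ?f, symmetric])
  also have "\<dots> = permute_vars \<tau> (lie_map F)"
    unfolding lie_map_def rhom_sum[OF permute_vars_hom]
  proof (rule sum.cong[OF refl])
    fix g assume "g \<in> perms"
    then have "inv' g permutes {1..n + 1}" by (simp add: permutes_inv)
    then show "?f g = permute_vars \<tau> (pscale (F g) (path_form l n (inv' g)))"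
      by (simp add: permute_vars_pscale permute_path_form[OF l _ \<tau>] mult.commute)
  qed
  finally show ?thesis .
qed

text \<open>Klyachko's identity with \<open>c i = q^i\<close>: in the word of
  \<open>\<sigma>\<close> the letter \<open>i\<close> precedes \<open>i + 1\<close> exactly if
  \<open>inv' \<sigma>\<close> ascends at \<open>i\<close>. The identity lives in the fractions and
  returns to polynomials because \<open>to_fract\<close> is injective.\<close>

lemma lie_map_major_weight:
  "lie_map (major_weight n) = pscale (\<Prod>i\<in>{1..<n + 1}. 1 - inverse (root_unity n) ^ i) (path_form l n id)"
proof -
  let ?A = "to_fract (vandermonde n ^ l)" and ?q = "inverse (root_unity n)"
  let ?k = "\<lambda>c. to_fract (pconst c)" and ?I = "{1..<n + 1}"
  have hom: "ring_hom_fun ?k"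
    using ring_hom_fun_comp[OF ring_hom_fun_to_fract ring_hom_fun_pconst] by (simp add: comp_def)
  have scale: "to_fract (pscale c p) = ?k c * to_fract p" for c p by (simp add: pscale_def)
  have "to_fract (lie_map (major_weight n)) = (\<Sum>g\<in>perms. ?k (major_weight n g) * to_fract (path_form l n (inv' g)))"
    by (simp add: lie_map_def rhom_sum[OF ring_hom_fun_to_fract] scale)
  also have "\<dots> = (\<Sum>g\<in>perms. ?k (major_weight n (inv' g)) * to_fract (path_form l n (inv' (inv' g))))"
    by (rule sum_permutations_inverse)
  also have "\<dots> = (\<Sum>\<sigma>\<in>perms. ?A * ((\<Prod>i\<in>?I. if before (map \<sigma> [1..<n + 1 + 1]) i (i + 1) then 1 else ?k (?q ^ i)) *
      word_prod xfrac (map \<sigma> [1..<n + 1 + 1])))"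
  proof (rule sum.cong[OF refl])
    fix \<sigma> assume "\<sigma> \<in> perms"
    then have \<sigma>: "\<sigma> permutes {1..n + 1}" by simp
    have "major_weight n (inv' \<sigma>) = (\<Prod>i\<in>?I. if before (map \<sigma> [1..<n + 1 + 1]) i (i + 1) then 1 else ?q ^ i)"
      unfolding major_weight_def if_P[OF permutes_inv[OF \<sigma>]]
    proof (rule prod.cong[OF refl])
      fix i assume "i \<in> ?I"
      then show "(if inv' \<sigma> i < inv' \<sigma> (i + 1) then 1 else ?q ^ i) =
        (if before (map \<sigma> [1..<n + 1 + 1]) i (i + 1) then 1 else ?q ^ i)"
        using before_map_permutation[OF \<sigma>, of i "i + 1"] by simp
    qed
    then have "?k (major_weight n (inv' \<sigma>)) = (\<Prod>i\<in>?I. if before (map \<sigma> [1..<n + 1 + 1]) i (i + 1) then 1 else ?k (?q ^ i))"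
      by (simp add: rhom_prod[OF hom] if_distrib[of ?k] rhom_one[OF hom] del: upt_Suc cong: if_cong)
    then show "?k (major_weight n (inv' \<sigma>)) * to_fract (path_form l n (inv' (inv' \<sigma>))) =
      ?A * ((\<Prod>i\<in>?I. if before (map \<sigma> [1..<n + 1 + 1]) i (i + 1) then 1 else ?k (?q ^ i)) * word_prod xfrac (map \<sigma> [1..<n + 1 + 1]))"
      unfolding permutes_inv_inv[OF \<sigma>] to_fract_path_form[OF l \<sigma>] by (simp only: mult_ac)
  qed
  also have "\<dots> = ?A * (\<Sum>\<sigma>\<in>perms. (\<Prod>i\<in>?I. if before (map \<sigma> [1..<n + 1 + 1]) i (i + 1) then 1 else ?k (?q ^ i)) *
      word_prod xfrac (map \<sigma> [1..<n + 1 + 1]))"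
    by (rule sum_distrib_left[symmetric])
  also have "(\<Sum>\<sigma>\<in>perms. (\<Prod>i\<in>?I. if before (map \<sigma> [1..<n + 1 + 1]) i (i + 1) then 1 else ?k (?q ^ i)) *
      word_prod xfrac (map \<sigma> [1..<n + 1 + 1])) =
    (\<Sum>w\<in>permutations_of_set {1..n + 1}. (\<Prod>i\<in>?I. if before w i (i + 1) then 1 else ?k (?q ^ i)) * word_prod xfrac w)"
    by (rule sum.reindex_bij_betw[OF bij_betw_permutation_words])
  also have "\<dots> = (\<Prod>i\<in>?I. 1 - ?k (?q ^ i)) * word_prod xfrac [1..<n + 1 + 1]"
    by (rule klyachko_sum[OF inj_xfrac])
  also have "?A * ((\<Prod>i\<in>?I. 1 - ?k (?q ^ i)) * word_prod xfrac [1..<n + 1 + 1]) =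
    ?k (\<Prod>i\<in>?I. 1 - ?q ^ i) * to_fract (path_form l n id)"
    using to_fract_path_form[OF l permutes_id, of n]
    by (simp add: rhom_prod[OF hom] rhom_diff[OF hom] rhom_one[OF hom] mult_ac del: upt_Suc)
  finally show ?thesis by (simp flip: scale)
qed

lemma is_rep_lie_rep: "is_rep (sym_group (n + 1)) (lie_rep n)"
  unfolding lie_rep_def by (rule is_rep_induced_char[OF sym_group_is_group cyclic_subgroup_subset])

lemma rep_space_lie_rep:
  shows "F \<in> rep_space (lie_rep n) \<Longrightarrow> (\<lambda>g. c * F g) \<in> rep_space (lie_rep n)"
    and "F \<in> rep_space (lie_rep n) \<Longrightarrow> G \<in> rep_space (lie_rep n) \<Longrightarrow> F + G \<in> rep_space (lie_rep n)"
    and "F \<in> rep_space (lie_rep n) \<Longrightarrow> \<tau> permutes {1..n + 1} \<Longrightarrow>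
      (\<lambda>g. if g permutes {1..n + 1} then F (g \<circ> \<tau>) else 0) \<in> rep_space (lie_rep n)"
proof -
  have "rep_scale (lie_rep n) c F = (\<lambda>g. c * F g)"
    "rep_act (lie_rep n) \<tau> F = (\<lambda>g. if g permutes {1..n + 1} then F (g \<circ> \<tau>) else 0)"
    by (simp_all add: lie_rep_def induced_rep_def char_rep_def sym_group_def cong: if_cong)
  then show "F \<in> rep_space (lie_rep n) \<Longrightarrow> (\<lambda>g. c * F g) \<in> rep_space (lie_rep n)"
    "F \<in> rep_space (lie_rep n) \<Longrightarrow> G \<in> rep_space (lie_rep n) \<Longrightarrow> F + G \<in> rep_space (lie_rep n)"
    "F \<in> rep_space (lie_rep n) \<Longrightarrow> \<tau> permutes {1..n + 1} \<Longrightarrow>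
      (\<lambda>g. if g permutes {1..n + 1} then F (g \<circ> \<tau>) else 0) \<in> rep_space (lie_rep n)"
    using is_repD(3)[OF is_rep_lie_rep] is_repD(4)[OF is_rep_lie_rep, of F c]
      is_repD(5)[OF is_rep_lie_rep, of \<tau> F] by (simp_all add: sym_group_carrier)
qed

text \<open>The scalar in front of the identity path form is nonzero by primitivity, so a multiple
  of the major weight is mapped to it; translating by \<open>\<tau>\<close> yields the other path
  forms, with the same sign on both sides.\<close>

lemma path_form_in_image:
  assumes \<tau>: "\<tau> permutes {1..n + 1}"
  shows "path_form l n \<tau> \<in> lie_map ` rep_space (lie_rep n)"
proof -
  let ?\<kappa> = "\<Prod>i\<in>{1..<n + 1}. 1 - inverse (root_unity n) ^ i"
  have "1 - inverse (root_unity n) ^ i \<noteq> 0" if "i \<in> {1..<n + 1}" for i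
  proof -
    have "root_unity n ^ i \<noteq> 1" using root_unity_primitive[of i n] that by simp
    then have "inverse (root_unity n) ^ i \<noteq> 1" unfolding power_inverse inverse_eq_1_iff .
    then show ?thesis by (metis eq_iff_diff_eq_0)
  qed
  then have \<kappa>: "?\<kappa> \<noteq> 0" unfolding prod_zero_iff[OF finite_atLeastLessThan] by (rule_tac notI) (elim bexE, metis)
  have mw: "major_weight n \<in> rep_space (lie_rep n)"
    unfolding mem_lie_rep[OF n]
  proof (intro conjI allI impI)
    show "major_weight n g = 0" if "\<not> g permutes {1..n + 1}" for g
      unfolding major_weight_def using that by (rule if_not_P)
  qed (rule major_weight_cycle)
  define F where "F = (\<lambda>g. inverse ?\<kappa> * major_weight n g)"
  have F: "F \<in> rep_space (lie_rep n)" unfolding F_def by (rule rep_space_lie_rep(1)[OF mw])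
  have LF: "lie_map F = path_form l n id"
    using \<kappa> unfolding F_def lie_map_scale lie_map_major_weight by simp
  define F' where "F' = (\<lambda>g. if g permutes {1..n + 1} then F (g \<circ> \<tau>) else 0)"
  have F': "F' \<in> rep_space (lie_rep n)" unfolding F'_def by (rule rep_space_lie_rep(3)[OF F \<tau>])
  have "pscale (sign_power l \<tau>) (lie_map F') = permute_vars \<tau> (path_form l n id)"
    using lie_map_act[OF \<tau>, of F] unfolding F'_def LF lie_map_scale .
  also have "\<dots> = pscale (sign_power l \<tau>) (path_form l n \<tau>)"
    using permute_path_form[OF l permutes_id \<tau>] by simp
  finally have "pscale (sign_power l \<tau>) (pscale (sign_power l \<tau>) (lie_map F')) =
    pscale (sign_power l \<tau>) (pscale (sign_power l \<tau>) (path_form l n \<tau>))" by simp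
  then have "lie_map F' = path_form l n \<tau>" by (simp add: sign_power_square)
  then show ?thesis by (intro image_eqI[OF _ F']) simp
qed

lemma lie_map_image: "lie_map ` rep_space (lie_rep n) = top_comp"
proof (rule subset_antisym)
  show "lie_map ` rep_space (lie_rep n) \<subseteq> top_comp" using lie_map_mem by blast
  have "cpoly.subspace (lie_map ` rep_space (lie_rep n))"
  proof (rule cpoly.subspaceI)
    have "0 = lie_map 0" by (simp add: lie_map_def)
    moreover have "0 \<in> rep_space (lie_rep n)" by (rule is_repD(2)[OF is_rep_lie_rep])
    ultimately show "0 \<in> lie_map ` rep_space (lie_rep n)" by blast
  next
    fix p q assume "p \<in> lie_map ` rep_space (lie_rep n)" "q \<in> lie_map ` rep_space (lie_rep n)"
    then obtain F G where "F \<in> rep_space (lie_rep n)" "G \<in> rep_space (lie_rep n)" "p = lie_map F" "q = lie_map G"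
      by blast
    then show "p + q \<in> lie_map ` rep_space (lie_rep n)"
      by (intro image_eqI[of _ _ "F + G"] rep_space_lie_rep(2)) (simp_all only: lie_map_add)
  next
    fix c p assume "p \<in> lie_map ` rep_space (lie_rep n)"
    then obtain F where "F \<in> rep_space (lie_rep n)" "p = lie_map F" by blast
    then show "pscale c p \<in> lie_map ` rep_space (lie_rep n)"
      by (intro image_eqI[of _ _ "\<lambda>g. c * F g"] rep_space_lie_rep(1)) (simp_all only: lie_map_scale)
  qed
  moreover have "path_form l n ` perms \<subseteq> lie_map ` rep_space (lie_rep n)"
    by (rule image_subsetI) (simp only: mem_Collect_eq path_form_in_image)
  ultimately have "cpoly.span (path_form l n ` perms) \<subseteq> lie_map ` rep_space (lie_rep n)"
    by (intro cpoly.span_minimal)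
  then show "top_comp \<subseteq> lie_map ` rep_space (lie_rep n)"
    by (rule order_trans[OF top_component_span[OF l]])
qed

text \<open>
  Every permutation is uniquely a power of the cycle times a permutation fixing \<open>n + 1\<close>, so the
  induced space has dimension at most \<open>n!\<close>, which is the number of parking functions of top degree.
\<close>

lemma lie_map_injective:
  assumes F: "F \<in> rep_space (lie_rep n)" and zero: "lie_map F = 0"
  shows "F = 0"
proof -
  let ?N = "n + 1" and ?c = "long_cycle n" and ?\<omega> = "root_unity n"
  \<comment> \<open>The \<open>k\<close>-th power of the cycle sends \<open>?N\<close> to
    \<open>k\<close>, so removing the power with exponent \<open>g ?N\<close> leaves a permutation
    fixing \<open>?N\<close>.\<close>
  define r where "r g = inv' (?c ^^ g ?N) \<circ> g" for g :: "nat \<Rightarrow> nat"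
  have factor: "(?c ^^ g ?N) \<circ> r g = g" for g
    unfolding r_def by (simp add: fun_eq_iff permutes_inverses[OF long_cycle_funpow_permutes])
  have r: "r g permutes {1..n}" if g: "g permutes {1..?N}" for g
  proof (rule permutes_superset)
    show "r g permutes {1..?N}" unfolding r_def
      by (rule permutes_compose[OF g permutes_inv[OF long_cycle_funpow_permutes]])
    have gN: "g ?N \<in> {1..?N}" using permutes_in_image[OF g, of ?N] by simp
    have "(?c ^^ g ?N) ?N = g ?N"
    proof -
      have "(?c ^^ g ?N) ?N = (?N - 1 + g ?N) mod ?N + 1"
        by (rule long_cycle_funpow_apply) simp
      also have "?N - 1 + g ?N = (g ?N - 1) + ?N" using gN by simp
      also have "((g ?N - 1) + ?N) mod ?N = g ?N - 1"
      proof -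
        have "g ?N - 1 < ?N" using gN unfolding atLeastAtMost_iff by linarith
        then show ?thesis by (simp only: mod_add_self2 mod_less)
      qed
      finally show ?thesis using gN by simp
    qed
    then have "inv' (?c ^^ g ?N) (g ?N) = ?N" using permutes_inverses(2)[OF long_cycle_funpow_permutes] by metis
    then show "r g x = x" if "x \<in> {1..?N} - {1..n}" for x
    proof -
      have "x = ?N" using that by auto
      then show ?thesis using \<open>inv' (?c ^^ g ?N) (g ?N) = ?N\<close> by (simp add: r_def)
    qed
  qed
  have eq: "\<And>g. g permutes {1..?N} \<Longrightarrow> G (?c \<circ> g) = ?\<omega> * G g" if "G \<in> rep_space (lie_rep n)" for G
    using that unfolding mem_lie_rep[OF n] by blast
  have G_factor: "G g = ?\<omega> ^ g ?N * G (r g)" if G: "G \<in> rep_space (lie_rep n)" and g: "g permutes {1..?N}" for G g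
    using equivariant_funpow[of n G "r g" "g ?N"] eq[OF G] permutes_Suc_range[OF r[OF g]] unfolding factor by blast
  define H where "H = {h. h permutes {1..n}}"
  have finH: "finite H" unfolding H_def by (rule finite_permutations) simp
  \<comment> \<open>By equivariance a member of the induced space is determined on the coset of
    \<open>h\<close> by its value at \<open>h\<close>; \<open>u h\<close> collects the path forms of
    this coset with the resulting powers of the root.\<close>
  define u where "u h = (\<Sum>g\<in>{g. g \<in> perms \<and> r g = h}. pscale (?\<omega> ^ g ?N) (path_form l n (inv' g)))" for h
  have expand: "lie_map G = (\<Sum>h\<in>H. pscale (G h) (u h))" if G: "G \<in> rep_space (lie_rep n)" for G
  proof -
    have "lie_map G = (\<Sum>h\<in>H. \<Sum>g\<in>{g. g \<in> perms \<and> r g = h}. pscale (G g) (path_form l n (inv' g)))"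
      unfolding lie_map_def
      by (rule sum.group[symmetric, OF finite_perms finH]) (use r in \<open>auto simp: H_def\<close>)
    also have "\<dots> = (\<Sum>h\<in>H. pscale (G h) (u h))"
      unfolding u_def cpoly.scale_sum_right
      by (intro sum.cong refl) (auto simp: G_factor[OF G] mult.commute)
    finally show ?thesis .
  qed
  obtain t where t: "\<And>h. h permutes {1..n} \<Longrightarrow> t h \<in> parking_degree l l n (top_degree l n)"
    "inj_on t {h. h permutes {1..n}}"
    using top_parking_monomials[OF l] by blast
  \<comment> \<open>These polynomials are dual to the \<open>n!\<close> monomials
    \<open>t h\<close>. Since \<open>lie_map\<close> is onto, they lie in the span of the
    \<open>u h\<close>, which are therefore independent.\<close>
  have "\<exists>p. p \<in> top_comp \<and> (\<forall>f\<in>parking_degree l l n (top_degree l n). lookup p f = (if f = t h then 1 else 0))" for h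
  proof -
    obtain p where "p \<in> top_comp" "\<And>f. f \<in> parking_degree l l n (top_degree l n) \<Longrightarrow> lookup p f = (if f = t h then 1 else 0)"
      using slim_component_prescribed_coeffs[of l l n "top_degree l n" "\<lambda>f. if f = t h then 1 else 0"] by metis
    then show ?thesis by blast
  qed
  then obtain b where b: "\<And>h. b h \<in> top_comp"
    "\<And>h f. f \<in> parking_degree l l n (top_degree l n) \<Longrightarrow> lookup (b h) f = (if f = t h then 1 else 0)"
    by metis
  have Fh: "F h = 0" if h: "h \<in> H" for h
  proof (rule coefficients_vanish_by_dimension[OF finH, of b t u F])
    show "lookup (b h) (t h') = (if h = h' then 1 else 0)" if "h \<in> H" "h' \<in> H" for h h'
      using b(2)[OF t(1)[of h']] that t(2) unfolding H_def by (auto dest: inj_onD)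
    show "b h \<in> cpoly.span (u ` H)" for h
    proof -
      obtain G where "G \<in> rep_space (lie_rep n)" "b h = lie_map G"
        using b(1)[of h] unfolding lie_map_image[symmetric] by blast
      then have "b h = (\<Sum>h\<in>H. pscale (G h) (u h))" by (simp only: expand)
      also have "\<dots> \<in> cpoly.span (u ` H)" by (intro cpoly.span_sum cpoly.span_scale cpoly.span_base imageI)
      finally show ?thesis .
    qed
    show "(\<Sum>h\<in>H. pscale (F h) (u h)) = 0" using expand[OF F] zero by simp
  qed (rule h)
  show "F = 0"
  proof
    fix g
    show "F g = 0 g"
    proof (cases "g permutes {1..?N}")
      case True
      then show ?thesis using G_factor[OF F True] Fh[of "r g"] r[OF True] by (simp add: H_def)
    next
      case False
      then show ?thesis using F unfolding mem_lie_rep[OF n] by simp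
    qed
  qed
qed

theorem top_component_lie:
  "rep_iso (sym_group (n + 1)) (slim_rep l l n (top_degree l n))
     (tensor_char (lie_rep n) (\<lambda>\<sigma>. sign_char \<sigma> ^ l))"
proof (rule rep_iso_by_inverse[where \<psi> = lie_map])
  let ?S = "tensor_char (lie_rep n) (\<lambda>\<sigma>. sign_char \<sigma> ^ l)"
  have space: "rep_space ?S = rep_space (lie_rep n)" by (simp add: tensor_char_def)
  show "is_rep (sym_group (n + 1)) (slim_rep l l n (top_degree l n))" by (rule is_rep_slim_rep) simp
  show "is_rep (sym_group (n + 1)) ?S"
  proof (rule is_rep_tensor_char[OF is_rep_lie_rep])
    show "sign_char \<one>\<^bsub>sym_group (n + 1)\<^esub> ^ l = 1" by (simp add: sym_group_one sign_char_def)
    show "sign_char (g \<otimes>\<^bsub>sym_group (n + 1)\<^esub> h) ^ l = sign_char g ^ l * sign_char h ^ l"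
      if "g \<in> carrier (sym_group (n + 1))" "h \<in> carrier (sym_group (n + 1))" for g h
      using that sign_power_compose[of "{1..n + 1}" g h l]
      by (simp add: sym_group_carrier sym_group_mult sign_power_def)
  qed
  show "bij_betw lie_map (rep_space ?S) (rep_space (slim_rep l l n (top_degree l n)))"
    unfolding bij_betw_def space
  proof
    show "lie_map ` rep_space (lie_rep n) = rep_space (slim_rep l l n (top_degree l n))"
      using lie_map_image by (simp add: slim_rep_def)
    show "inj_on lie_map (rep_space (lie_rep n))"
    proof (rule inj_onI)
      fix F G assume FG: "F \<in> rep_space (lie_rep n)" "G \<in> rep_space (lie_rep n)" "lie_map F = lie_map G"
      define D where "D = F + (\<lambda>g. (-1) * G g)"
      have "D \<in> rep_space (lie_rep n)" unfolding D_def
        by (rule rep_space_lie_rep(2)[OF FG(1) rep_space_lie_rep(1)[OF FG(2)]])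
      moreover have "lie_map D = 0" unfolding D_def lie_map_add lie_map_scale using FG(3) by simp
      ultimately have "D = 0" by (rule lie_map_injective)
      then show "F = G" by (simp add: D_def fun_eq_iff)
    qed
  qed
  show "lie_map (F + G) = lie_map F + lie_map G" for F G by (rule lie_map_add)
  show "lie_map (rep_scale ?S c F) = rep_scale (slim_rep l l n (top_degree l n)) c (lie_map F)" for c F
    using lie_map_scale by (simp add: tensor_char_def lie_rep_def induced_rep_def char_rep_def slim_rep_def)
  show "lie_map (rep_act ?S \<tau> F) = rep_act (slim_rep l l n (top_degree l n)) \<tau> (lie_map F)"
    if "\<tau> \<in> carrier (sym_group (n + 1))" for \<tau> F
    using that lie_map_act[of \<tau> F]
    by (simp add: tensor_char_def lie_rep_def induced_rep_def char_rep_def slim_rep_def sym_group_def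
        sign_power_def cong: if_cong)
qed

lemma top_component_nonzero: "top_comp \<noteq> {0}"
proof -
  obtain t where t: "\<And>h. h permutes {1..n} \<Longrightarrow> t h \<in> parking_degree l l n (top_degree l n)"
    using top_parking_monomials[OF l] by metis
  obtain p where p: "p \<in> top_comp" "\<And>f. f \<in> parking_degree l l n (top_degree l n) \<Longrightarrow> lookup p f = 1"
    using slim_component_prescribed_coeffs[of l l n "top_degree l n" "\<lambda>_. 1"] by metis
  have "lookup p (t id) = 1" by (intro p(2) t permutes_id)
  then have "p \<noteq> 0" by auto
  then show ?thesis using p(1) by blast
qed

text \<open>There are no parking functions of larger degree, and the coefficient map is
  injective.\<close>

lemma above_top_component:
  assumes "k > top_degree l n"
  shows "slim_component l l n k = {0}"
proof (rule subset_antisym)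
  show "slim_component l l n k \<subseteq> {0}"
  proof
    fix p assume "p \<in> slim_component l l n k"
    then have "p = 0"
      using parking_degree_above_top[OF l] assms by (intro slim_component_eq_0I) (auto simp: not_le[symmetric])
    then show "p \<in> {0}" by simp
  qed
qed (use cpoly.subspace_0[OF subspace_slim_component] in blast)

end

theorem theorem3:
  fixes l m n :: nat
  assumes "l \<ge> 1" and "m \<ge> 1" and "n \<ge> 1"
  shows "(\<forall>k. rep_iso (sym_group n) (slim_rep l m n k)
              (direct_sum_rep {D. dyck_path l m n D \<and> area l D = k}
                 (\<lambda>D. young_module n (vertical_run_partition D)))) \<and>
         (\<forall>k<n. slim_component l m n k =
              cpoly.span {prod_list fs | fs. length fs = k \<and> set fs \<subseteq> slim_component l m n 1}) \<and>
         (l = m \<longrightarrow>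
            (\<forall>\<sigma>\<in>carrier (sym_group (n + 1)). permute_vars \<sigma> ` slim_space l m n \<subseteq> slim_space l m n) \<and>
            (\<not> (l = 1 \<and> n = 1) \<longrightarrow>
               rep_iso (sym_group (n + 1)) (slim_rep l m n 1) (reflection_rep (n + 1))) \<and>
            (\<exists>d. slim_component l m n d \<noteq> {0} \<and>
                 (\<forall>k>d. slim_component l m n k = {0}) \<and>
                 rep_iso (sym_group (n + 1)) (slim_rep l m n d)
                   (tensor_char (lie_rep n) (\<lambda>\<sigma>. sign_char \<sigma> ^ l))))"
proof (intro conjI allI impI ballI)
  show "rep_iso (sym_group n) (slim_rep l m n k)
      (direct_sum_rep {D. dyck_path l m n D \<and> area l D = k} (\<lambda>D. young_module n (vertical_run_partition D)))" for k
    by (rule slim_component_dyck[OF assms(1,2)])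
  show "slim_component l m n k =
      cpoly.span {prod_list fs | fs. length fs = k \<and> set fs \<subseteq> slim_component l m n 1}" if "k < n" for k
    by (rule slim_component_eq_span_products[OF assms(1,2) that])
  assume lm: "l = m"
  show "permute_vars \<sigma> ` slim_space l m n \<subseteq> slim_space l m n" if "\<sigma> \<in> carrier (sym_group (n + 1))" for \<sigma>
    using that lm permute_vars_slim_space[of \<sigma> n l m] by (auto simp: sym_group_carrier)
  show "rep_iso (sym_group (n + 1)) (slim_rep l m n 1) (reflection_rep (n + 1))" if "\<not> (l = 1 \<and> n = 1)"
    using slim_component_1_reflection[OF assms(1,3) that] lm by simp
  show "\<exists>d. slim_component l m n d \<noteq> {0} \<and> (\<forall>k>d. slim_component l m n k = {0}) \<and>
      rep_iso (sym_group (n + 1)) (slim_rep l m n d) (tensor_char (lie_rep n) (\<lambda>\<sigma>. sign_char \<sigma> ^ l))"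
    using top_component_nonzero[OF assms(1,3)] above_top_component[OF assms(1,3)] top_component_lie[OF assms(1,3)]
    unfolding lm by blast
qed

end
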